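(* Let $\tilde\Gamma$ be a discrete group with a finite family of generators $\tilde S=(\tilde s_1,\dots,\tilde s_d)$, and let $\varphi:\tilde\Gamma\to\Gamma$ and $\varphi_n:\tilde\Gamma\to\Gamma_n$ ($n\ge1$) be surjective homomorphisms onto discrete groups. Let $S=(\varphi(\tilde s_1),\dots,\varphi(\tilde s_d))$ and $S_n=(\varphi_n(\tilde s_1),\dots,\varphi_n(\tilde s_d))$ be the induced families of generators of $\Gamma$ and $\Gamma_n$. For $\tilde f\in L^1(\tilde\Gamma)$ set $f=\varphi_*(\tilde f)\in L^1(\Gamma)$ and $f_n=\varphi_{n*}(\tilde f)\in L^1(\Gamma_n)$. Assume that $[\Gamma_n,S_n]\to[\Gamma,S]$ in $X_d$ as $n\to\infty$. Then: (a) For every $\tilde f\in L^1(\tilde\Gamma)$, $\displaystyle\lim_{n\to\infty}\tau_{\mathcal{N}\Gamma_n}(f_n)=\tau_{\mathcal{N}\Gamma}(f)$. (b) If $\tilde f$ is invertible in $L^1(\tilde\Gamma)$, then in addition $\displaystyle\lim_{n\to\infty}\det\nolimits_{\mathcal{N}\Gamma_n}(f_n)=\det\nolimits_{\mathcal{N}\Gamma}(f)$.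
   Context: For a discrete group $\Gamma$ and $p=1,2$, elements of $L^p(\Gamma)$ are written as formal series $\sum_{\gamma\in\Gamma} x_\gamma \gamma$ with $x_\gamma\in\mathbb{C}$, $\sum_\gamma |x_\gamma|^p<\infty$. $L^1(\Gamma)$ is a unital Banach $*$-algebra under convolution. The von Neumann algebra $\mathcal{N}\Gamma$ is the algebra of bounded operators $A: L^2(\Gamma)\to L^2(\Gamma)$ that commute with left multiplication by every $\gamma\in\Gamma$. Its canonical trace is $\tau_{\mathcal{N}\Gamma}(A) = (A e, e)$, where $e\in\Gamma\subset L^2(\Gamma)$ is the unit element. Fuglede–Kadison determinant: for invertible $A\in\mathcal{N}\Gamma$, $\det_{\mathcal{N}\Gamma}A = \exp \tau_{\mathcal{N}\Gamma}(\log|A|)$ with $|A|=(A^*A)^{1/2}$; for arbitrary $A\in\mathcal{N}\Gamma$, $\det_{\mathcal{N}\Gamma}A=\lim_{\varepsilon\to0+}\det_{\mathcal{N}\Gamma}(|A|+\varepsilon)$. $L^1(\Gamma)$ is viewed as a subalgebra of $\mathcal{N}\Gamma$ via the injective homomorphism $r: L^1(\Gamma)\to\mathcal{N}\Gamma$, $r(\sum_\gamma f_\gamma\gamma)=\sum_\gamma f_\gamma R_{\gamma^{-1}}$, where $R_\gamma(x)=x\gamma$ on $L^2(\Gamma)$. So $\det_{\mathcal{N}\Gamma} f$ and $\tau_{\mathcal{N}\Gamma}(f)$ mean $\det_{\mathcal{N}\Gamma} r(f)$ and $\tau_{\mathcal{N}\Gamma}(r(f))$ (the latter equals the coefficient $f_e$).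 For a homomorphism $\varphi:\Gamma\to\Gamma'$ of discrete groups, $\varphi_*:L^1(\Gamma)\to L^1(\Gamma')$ is defined by $\varphi_*(\sum_\gamma f_\gamma\gamma)=\sum_\gamma f_\gamma\varphi(\gamma)$. Space of marked groups: $X_d$ is the set of isomorphism classes $[\Gamma,S]$ of pairs $(\Gamma,S)$, where $\Gamma$ is a discrete group and $S=(s_1,\dots,s_d)$ is a family of $d$ generators (repetitions allowed); $(\Gamma,S)\cong(\Gamma',S')$ if some group isomorphism $\alpha:\Gamma\to\Gamma'$ satisfies $\alpha(s_i)=s_i'$ for all $i$. $X_d$ is an ultrametric space with distance $2^{-N}$ between $[\Gamma_1,S_1]$ and $[\Gamma_2,S_2]$, where $N\le\infty$ is the largest radius such that the balls of radius $N$ around the origin in the two Cayley graphs are isomorphic as oriented graphs with edges labelled by $1,\dots,d$. An equivalent metric is $\delta([\Gamma_1,S_1],[\Gamma_2,S_2])=2^{-M}$, where $M\le\infty$ is maximal such that the correspondence of the $i$-th generators induces a bijection between the $S_1$-relations and the $S_2$-relations of length less than $M$; here an $S$-relation is a finite string of elements of $S$ and their inverses whose evaluation in the group is $e$, and its length is the number of entries in the string. *)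

theory Defs
  imports
    "HOL-Analysis.Analysis"
    "HOL-Algebra.Generated_Groups"
    "HOL-Library.Extended_Nat"
    "HOL-Computational_Algebra.Polynomial"
begin

section \<open>Bounded operators on square-summable functions\<close>

text \<open>
  The Hilbert space over an index set \<open>I\<close> consists of total functions vanishing outside \<open>I\<close>.
  A carrier set rather than a type is used because the groups of a sequence have different
  carriers. The inner product is linear in the first argument.
\<close>

definition l2 :: "'a set \<Rightarrow> ('a \<Rightarrow> complex) set" where
  "l2 I = {x. (\<forall>i. i \<notin> I \<longrightarrow> x i = 0) \<and> (\<lambda>i. (cmod (x i))\<^sup>2) summable_on I}"

definition l2_inner :: "'a set \<Rightarrow> ('a \<Rightarrow> complex) \<Rightarrow> ('a \<Rightarrow> complex) \<Rightarrow> complex" where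
  "l2_inner I x y = (\<Sum>\<^sub>\<infinity>i\<in>I. x i * cnj (y i))"

definition l2_norm :: "'a set \<Rightarrow> ('a \<Rightarrow> complex) \<Rightarrow> real" where
  "l2_norm I x = sqrt (\<Sum>\<^sub>\<infinity>i\<in>I. (cmod (x i))\<^sup>2)"

type_synonym 'a op = "('a \<Rightarrow> complex) \<Rightarrow> ('a \<Rightarrow> complex)"

text \<open>
  Operators are extensional functions on \<^term>\<open>l2 I\<close>, so that HOL equality is equality of operators.
\<close>

definition bounded_ops :: "'a set \<Rightarrow> 'a op set" where
  "bounded_ops I = {A. A \<in> l2 I \<rightarrow>\<^sub>E l2 I \<and>
     (\<forall>x\<in>l2 I. \<forall>y\<in>l2 I. A (\<lambda>i. x i + y i) = (\<lambda>i. A x i + A y i)) \<and>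
     (\<forall>c. \<forall>x\<in>l2 I. A (\<lambda>i. c * x i) = (\<lambda>i. c * A x i)) \<and>
     (\<exists>K. \<forall>x\<in>l2 I. l2_norm I (A x) \<le> K * l2_norm I x)}"

definition op_id :: "'a set \<Rightarrow> 'a op" where
  "op_id I = (\<lambda>x\<in>l2 I. x)"

definition op_mult :: "'a set \<Rightarrow> 'a op \<Rightarrow> 'a op \<Rightarrow> 'a op" where
  "op_mult I A B = compose (l2 I) A B"

definition op_minus :: "'a set \<Rightarrow> 'a op \<Rightarrow> 'a op \<Rightarrow> 'a op" where
  "op_minus I A B = (\<lambda>x\<in>l2 I. \<lambda>i. A x i - B x i)"

definition op_add_scalar :: "'a set \<Rightarrow> 'a op \<Rightarrow> complex \<Rightarrow> 'a op" where
  "op_add_scalar I A c = (\<lambda>x\<in>l2 I. \<lambda>i. A x i + c * x i)"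

definition op_norm :: "'a set \<Rightarrow> 'a op \<Rightarrow> real" where
  "op_norm I A = (SUP x\<in>{x\<in>l2 I. l2_norm I x \<le> 1}. l2_norm I (A x))"

definition op_adjoint :: "'a set \<Rightarrow> 'a op \<Rightarrow> 'a op" where
  "op_adjoint I A = (THE B. B \<in> bounded_ops I \<and>
     (\<forall>x\<in>l2 I. \<forall>y\<in>l2 I. l2_inner I (A x) y = l2_inner I x (B y)))"

definition op_invertible_in :: "'a set \<Rightarrow> 'a op set \<Rightarrow> 'a op \<Rightarrow> bool" where
  "op_invertible_in I \<A> A \<longleftrightarrow>
     A \<in> \<A> \<and> (\<exists>B\<in>\<A>. op_mult I A B = op_id I \<and> op_mult I B A = op_id I)"

definition op_spectrum :: "'a set \<Rightarrow> 'a op \<Rightarrow> complex set" where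
  "op_spectrum I A = {z. \<not> op_invertible_in I (bounded_ops I) (op_add_scalar I A (- z))}"

definition op_poly :: "'a set \<Rightarrow> real poly \<Rightarrow> 'a op \<Rightarrow> 'a op" where
  "op_poly I p A =
     (\<lambda>x\<in>l2 I. \<lambda>i. \<Sum>k\<le>degree p. complex_of_real (coeff p k) * (A ^^ k) x i)"

text \<open>
  Continuous functional calculus of a self-adjoint operator \<open>A\<close>, for a real function \<open>h\<close> that is
  continuous on the (real) spectrum of \<open>A\<close>: the norm limit of \<open>p\<^sub>n(A)\<close> for polynomials
  \<open>p\<^sub>n\<close> converging to \<open>h\<close> uniformly on the spectrum, for every choice of such polynomials.
  Outside this situation the value is unspecified.
\<close>

definition op_cfc :: "'a set \<Rightarrow> 'a op \<Rightarrow> (real \<Rightarrow> real) \<Rightarrow> 'a op" where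
  "op_cfc I A h = (THE B. B \<in> bounded_ops I \<and>
     (\<forall>p :: nat \<Rightarrow> real poly.
        uniform_limit {t. complex_of_real t \<in> op_spectrum I A} (\<lambda>n. poly (p n)) h sequentially
        \<longrightarrow> (\<lambda>n. op_norm I (op_minus I (op_poly I (p n) A) B)) \<longlonglongrightarrow> 0))"

definition op_abs :: "'a set \<Rightarrow> 'a op \<Rightarrow> 'a op" where
  "op_abs I A = op_cfc I (op_mult I (op_adjoint I A) A) sqrt"


section \<open>The group von Neumann algebra and its determinant\<close>

text \<open>Coefficientwise, left multiplication by \<open>\<gamma>\<close> and right multiplication by \<open>\<gamma>\<close> of a formal series.\<close>

definition left_mult :: "'a monoid \<Rightarrow> 'a \<Rightarrow> ('a \<Rightarrow> complex) \<Rightarrow> ('a \<Rightarrow> complex)" where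
  "left_mult G \<gamma> x = (\<lambda>g. if g \<in> carrier G then x (inv\<^bsub>G\<^esub> \<gamma> \<otimes>\<^bsub>G\<^esub> g) else 0)"

definition right_mult :: "'a monoid \<Rightarrow> 'a \<Rightarrow> ('a \<Rightarrow> complex) \<Rightarrow> ('a \<Rightarrow> complex)" where
  "right_mult G \<gamma> x = (\<lambda>g. if g \<in> carrier G then x (g \<otimes>\<^bsub>G\<^esub> inv\<^bsub>G\<^esub> \<gamma>) else 0)"

definition group_vN :: "'a monoid \<Rightarrow> 'a op set" where
  "group_vN G = {A \<in> bounded_ops (carrier G).
     \<forall>\<gamma>\<in>carrier G. \<forall>x\<in>l2 (carrier G). A (left_mult G \<gamma> x) = left_mult G \<gamma> (A x)}"

definition unit_series :: "'a monoid \<Rightarrow> 'a \<Rightarrow> complex" where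
  "unit_series G = (\<lambda>g. if g = \<one>\<^bsub>G\<^esub> then 1 else 0)"

definition vN_trace :: "'a monoid \<Rightarrow> 'a op \<Rightarrow> complex" where
  "vN_trace G A = l2_inner (carrier G) (A (unit_series G)) (unit_series G)"

definition exp_trace_log_abs :: "'a monoid \<Rightarrow> 'a op \<Rightarrow> real" where
  "exp_trace_log_abs G A =
     exp (Re (vN_trace G (op_cfc (carrier G) (op_abs (carrier G) A) ln)))"

text \<open>
  The trace of the self-adjoint operator \<open>log |A|\<close> is real, hence the harmless \<^const>\<open>Re\<close> above.
  The one-sided limit below would return the first value for invertible \<open>A\<close> as well.
\<close>

definition FK_det :: "'a monoid \<Rightarrow> 'a op \<Rightarrow> real" where
  "FK_det G A =
     (if op_invertible_in (carrier G) (group_vN G) A then exp_trace_log_abs G A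
      else Lim (at_right 0) (\<lambda>\<epsilon>. exp_trace_log_abs G
             (op_add_scalar (carrier G) (op_abs (carrier G) A) (complex_of_real \<epsilon>))))"


section \<open>The convolution algebra of summable functions\<close>

definition L1 :: "'a monoid \<Rightarrow> ('a \<Rightarrow> complex) set" where
  "L1 G = {f. (\<forall>g. g \<notin> carrier G \<longrightarrow> f g = 0) \<and> (\<lambda>g. cmod (f g)) summable_on carrier G}"

definition convolution :: "'a monoid \<Rightarrow> ('a \<Rightarrow> complex) \<Rightarrow> ('a \<Rightarrow> complex) \<Rightarrow> ('a \<Rightarrow> complex)" where
  "convolution G f h =
     (\<lambda>g. if g \<in> carrier G then \<Sum>\<^sub>\<infinity>\<gamma>\<in>carrier G. f \<gamma> * h (inv\<^bsub>G\<^esub> \<gamma> \<otimes>\<^bsub>G\<^esub> g) else 0)"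

definition L1_invertible :: "'a monoid \<Rightarrow> ('a \<Rightarrow> complex) \<Rightarrow> bool" where
  "L1_invertible G f \<longleftrightarrow> f \<in> L1 G \<and>
     (\<exists>h\<in>L1 G. convolution G f h = unit_series G \<and> convolution G h f = unit_series G)"

text \<open>
  The embedding of the convolution algebra into the group von Neumann algebra; the series
  \<open>\<Sum> f\<^sub>\<gamma> R\<^sub>\<gamma>\<^sub>-\<^sub>1\<close> converges absolutely in norm and is written here coefficientwise.
\<close>

definition right_reg :: "'a monoid \<Rightarrow> ('a \<Rightarrow> complex) \<Rightarrow> 'a op" where
  "right_reg G f = (\<lambda>x\<in>l2 (carrier G). \<lambda>g.
     \<Sum>\<^sub>\<infinity>\<gamma>\<in>carrier G. f \<gamma> * right_mult G (inv\<^bsub>G\<^esub> \<gamma>) x g)"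

definition push_forward :: "'a monoid \<Rightarrow> ('a \<Rightarrow> 'b) \<Rightarrow> ('a \<Rightarrow> complex) \<Rightarrow> ('b \<Rightarrow> complex)" where
  "push_forward G \<phi> f = (\<lambda>h. \<Sum>\<^sub>\<infinity>\<gamma>\<in>{\<gamma> \<in> carrier G. \<phi> \<gamma> = h}. f \<gamma>)"


section \<open>The space of marked groups\<close>

definition marked_group :: "nat \<Rightarrow> 'a monoid \<Rightarrow> 'a list \<Rightarrow> bool" where
  "marked_group d G S \<longleftrightarrow>
     group G \<and> length S = d \<and> set S \<subseteq> carrier G \<and> generate G (set S) = carrier G"

text \<open>
  Vertices of the ball of radius \<open>N\<close> around the origin in the Cayley graph, whose edges with label
  \<open>i\<close> lead from \<open>g\<close> to \<open>g s\<^sub>i\<close>; the graph distance disregards orientation.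
\<close>

primrec cayley_ball :: "'a monoid \<Rightarrow> 'a list \<Rightarrow> nat \<Rightarrow> 'a set" where
  "cayley_ball G S 0 = {\<one>\<^bsub>G\<^esub>}"
| "cayley_ball G S (Suc N) = cayley_ball G S N \<union>
     {g \<otimes>\<^bsub>G\<^esub> s | g s. g \<in> cayley_ball G S N \<and> s \<in> set S} \<union>
     {g \<otimes>\<^bsub>G\<^esub> inv\<^bsub>G\<^esub> s | g s. g \<in> cayley_ball G S N \<and> s \<in> set S}"

definition cayley_balls_isomorphic ::
  "nat \<Rightarrow> 'a monoid \<Rightarrow> 'a list \<Rightarrow> 'b monoid \<Rightarrow> 'b list \<Rightarrow> nat \<Rightarrow> bool" where
  "cayley_balls_isomorphic d G S H T N \<longleftrightarrow>
     (\<exists>\<psi>. bij_betw \<psi> (cayley_ball G S N) (cayley_ball H T N) \<and> \<psi> \<one>\<^bsub>G\<^esub> = \<one>\<^bsub>H\<^esub> \<and>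
        (\<forall>g\<in>cayley_ball G S N. \<forall>h\<in>cayley_ball G S N. \<forall>i<d.
           h = g \<otimes>\<^bsub>G\<^esub> S ! i \<longleftrightarrow> \<psi> h = \<psi> g \<otimes>\<^bsub>H\<^esub> T ! i))"

text \<open>
  The supremum of the empty set is 0, giving distance 1; this occurs when the balls of radius 0
  already differ, i.e. when different sets of labels occur on the loops at the origin.
\<close>

definition marked_radius ::
  "nat \<Rightarrow> 'a monoid \<Rightarrow> 'a list \<Rightarrow> 'b monoid \<Rightarrow> 'b list \<Rightarrow> enat" where
  "marked_radius d G S H T = Sup {enat N | N. cayley_balls_isomorphic d G S H T N}"

definition marked_dist ::
  "nat \<Rightarrow> 'a monoid \<Rightarrow> 'a list \<Rightarrow> 'b monoid \<Rightarrow> 'b list \<Rightarrow> real" where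
  "marked_dist d G S H T =
     (case marked_radius d G S H T of enat N \<Rightarrow> (1 / 2) ^ N | \<infinity> \<Rightarrow> 0)"

text \<open>
  Isomorphism of marked groups. The distance depends only on isomorphism classes
  (\<open>marked_dist_iso_cong\<close>), so convergence of classes is convergence to 0 of the distances
  between representatives, which may live in different types.
\<close>

definition marked_iso :: "'a monoid \<Rightarrow> 'a list \<Rightarrow> 'b monoid \<Rightarrow> 'b list \<Rightarrow> bool" where
  "marked_iso G S H T \<longleftrightarrow> (\<exists>\<alpha>\<in>iso G H. map \<alpha> S = T)"

lemma cayley_ball_subset:
  assumes "marked_group d G S"
  shows "cayley_ball G S N \<subseteq> carrier G"
proof -
  interpret group G using assms by (simp add: marked_group_def)
  show ?thesis using assms by (induction N) (auto simp: marked_group_def)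
qed

lemma cayley_ball_image:
  assumes "marked_group d G S" "marked_group d H T" "\<alpha> \<in> hom G H" "map \<alpha> S = T"
  shows "cayley_ball H T N = \<alpha> ` cayley_ball G S N"
proof -
  have [simp]: "group G" "group H" and S: "set S \<subseteq> carrier G"
    using assms by (auto simp: marked_group_def)
  have one: "\<alpha> \<one>\<^bsub>G\<^esub> = \<one>\<^bsub>H\<^esub>"
    using hom_one[OF assms(3)] by simp
  have T: "set T = \<alpha> ` set S" using assms(4) by auto
  interpret h: group_hom G H \<alpha>
    by (simp add: group_hom_def group_hom_axioms_def assms(3))
  show ?thesis
  proof (induction N)
    case 0
    then show ?case by (simp add: one)
  next
    case (Suc N)
    have B: "g \<in> carrier G" if "g \<in> cayley_ball G S N" for g
      using cayley_ball_subset[OF assms(1)] that by blast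
    have p: "\<alpha> (g \<otimes>\<^bsub>G\<^esub> s) = \<alpha> g \<otimes>\<^bsub>H\<^esub> \<alpha> s"
      "\<alpha> (g \<otimes>\<^bsub>G\<^esub> inv\<^bsub>G\<^esub> s) = \<alpha> g \<otimes>\<^bsub>H\<^esub> inv\<^bsub>H\<^esub> \<alpha> s"
      if "g \<in> cayley_ball G S N" "s \<in> set S" for g s
      using B[OF that(1)] S that(2) by auto
    have 1: "{g \<otimes>\<^bsub>H\<^esub> s | g s. g \<in> cayley_ball H T N \<and> s \<in> set T}
        = \<alpha> ` {g \<otimes>\<^bsub>G\<^esub> s | g s. g \<in> cayley_ball G S N \<and> s \<in> set S}"
      unfolding Suc.IH T by (force simp flip: p simp del: h.hom_mult)
    have 2: "{g \<otimes>\<^bsub>H\<^esub> inv\<^bsub>H\<^esub> s | g s. g \<in> cayley_ball H T N \<and> s \<in> set T}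
        = \<alpha> ` {g \<otimes>\<^bsub>G\<^esub> inv\<^bsub>G\<^esub> s | g s. g \<in> cayley_ball G S N \<and> s \<in> set S}"
      unfolding Suc.IH T by (force simp flip: p simp del: h.hom_mult h.hom_inv)
    show ?case
      unfolding cayley_ball.simps image_Un 1 2 unfolding Suc.IH ..
  qed
qed

lemma cayley_balls_isomorphic_trans:
  assumes "cayley_balls_isomorphic d G S H T N" "cayley_balls_isomorphic d H T K U N"
  shows "cayley_balls_isomorphic d G S K U N"
proof -
  obtain \<psi> where 1: "bij_betw \<psi> (cayley_ball G S N) (cayley_ball H T N)"
      "\<psi> \<one>\<^bsub>G\<^esub> = \<one>\<^bsub>H\<^esub>"
      "\<And>g h i. g \<in> cayley_ball G S N \<Longrightarrow> h \<in> cayley_ball G S N \<Longrightarrow> i < d \<Longrightarrow>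
           h = g \<otimes>\<^bsub>G\<^esub> S ! i \<longleftrightarrow> \<psi> h = \<psi> g \<otimes>\<^bsub>H\<^esub> T ! i"
    using assms(1) unfolding cayley_balls_isomorphic_def by blast
  obtain \<theta> where 2: "bij_betw \<theta> (cayley_ball H T N) (cayley_ball K U N)"
      "\<theta> \<one>\<^bsub>H\<^esub> = \<one>\<^bsub>K\<^esub>"
      "\<And>g h i. g \<in> cayley_ball H T N \<Longrightarrow> h \<in> cayley_ball H T N \<Longrightarrow> i < d \<Longrightarrow>
           h = g \<otimes>\<^bsub>H\<^esub> T ! i \<longleftrightarrow> \<theta> h = \<theta> g \<otimes>\<^bsub>K\<^esub> U ! i"
    using assms(2) unfolding cayley_balls_isomorphic_def by blast
  have m: "\<psi> g \<in> cayley_ball H T N" if "g \<in> cayley_ball G S N" for g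
    using bij_betwE[OF 1(1)] that by blast
  show ?thesis unfolding cayley_balls_isomorphic_def
  proof (intro exI[of _ "\<theta> \<circ> \<psi>"] conjI ballI allI impI)
    show "bij_betw (\<theta> \<circ> \<psi>) (cayley_ball G S N) (cayley_ball K U N)"
      using bij_betw_trans[OF 1(1) 2(1)] .
    show "(\<theta> \<circ> \<psi>) \<one>\<^bsub>G\<^esub> = \<one>\<^bsub>K\<^esub>" by (simp add: 1(2) 2(2))
  next
    fix g h i assume "g \<in> cayley_ball G S N" "h \<in> cayley_ball G S N" "i < d"
    then show "h = g \<otimes>\<^bsub>G\<^esub> S ! i \<longleftrightarrow> (\<theta> \<circ> \<psi>) h = (\<theta> \<circ> \<psi>) g \<otimes>\<^bsub>K\<^esub> U ! i"
      using 1(3)[of g h i] 2(3)[of "\<psi> g" "\<psi> h" i] m by simp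
  qed
qed

lemma marked_iso_imp_balls_isomorphic:
  assumes "marked_group d G S" "marked_group d H T" "marked_iso G S H T"
  shows "cayley_balls_isomorphic d G S H T N"
proof -
  obtain \<alpha> where a: "\<alpha> \<in> hom G H" "bij_betw \<alpha> (carrier G) (carrier H)" "map \<alpha> S = T"
    using assms(3) by (auto simp: marked_iso_def iso_def)
  have grp: "group G" "group H" and S: "set S \<subseteq> carrier G" "length S = d"
    using assms by (auto simp: marked_group_def)
  note sub = cayley_ball_subset[OF assms(1), of N]
  have inj: "inj_on \<alpha> (carrier G)" using a(2) by (rule bij_betw_imp_inj_on)
  show ?thesis unfolding cayley_balls_isomorphic_def
  proof (intro exI[of _ \<alpha>] conjI ballI allI impI)
    show "bij_betw \<alpha> (cayley_ball G S N) (cayley_ball H T N)"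
      using inj_on_subset[OF inj sub] cayley_ball_image[OF assms(1,2) a(1,3)]
      by (simp add: bij_betw_def)
    show "\<alpha> \<one>\<^bsub>G\<^esub> = \<one>\<^bsub>H\<^esub>" using hom_one[OF a(1) grp] .
  next
    fix g h i assume g: "g \<in> cayley_ball G S N" "h \<in> cayley_ball G S N" and i: "i < d"
    have s: "S ! i \<in> carrier G" "T ! i = \<alpha> (S ! i)"
      using S i nth_mem[of i S] a(3) by auto
    have c: "g \<in> carrier G" "h \<in> carrier G" using g sub by auto
    have "\<alpha> (g \<otimes>\<^bsub>G\<^esub> S ! i) = \<alpha> g \<otimes>\<^bsub>H\<^esub> T ! i"
      using hom_mult[OF a(1) c(1) s(1)] s(2) by simp
    moreover have "g \<otimes>\<^bsub>G\<^esub> S ! i \<in> carrier G"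
      using grp(1) c s by (simp add: group.is_monoid monoid.m_closed)
    ultimately show "h = g \<otimes>\<^bsub>G\<^esub> S ! i \<longleftrightarrow> \<alpha> h = \<alpha> g \<otimes>\<^bsub>H\<^esub> T ! i"
      using inj_onD[OF inj] c by metis
  qed
qed

lemma marked_iso_sym:
  assumes "marked_group d G S" "marked_iso G S H T"
  shows "marked_iso H T G S"
proof -
  obtain \<alpha> where a: "\<alpha> \<in> iso G H" "map \<alpha> S = T"
    using assms(2) by (auto simp: marked_iso_def)
  have "group G" "set S \<subseteq> carrier G" using assms(1) by (auto simp: marked_group_def)
  moreover have "inj_on \<alpha> (carrier G)" using a(1) by (auto simp: iso_def bij_betw_def)
  ultimately have "inv_into (carrier G) \<alpha> \<in> iso H G" "map (inv_into (carrier G) \<alpha>) T = S"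
    using a group.iso_set_sym[of G \<alpha> H]
    by (auto simp: o_def subset_iff intro!: map_idI)
  then show ?thesis by (auto simp: marked_iso_def)
qed

lemma marked_dist_iso_cong:
  assumes "marked_group d G S" "marked_group d G' S'" "marked_group d H T" "marked_group d H' T'"
    and "marked_iso G S G' S'" "marked_iso H T H' T'"
  shows "marked_dist d G S H T = marked_dist d G' S' H' T'"
proof -
  have "cayley_balls_isomorphic d G S H T N \<longleftrightarrow> cayley_balls_isomorphic d G' S' H' T' N" for N
    using marked_iso_imp_balls_isomorphic[of d] marked_iso_sym[of d]
      cayley_balls_isomorphic_trans[of d] assms by metis
  then show ?thesis by (simp add: marked_dist_def marked_radius_def)
qed

end

theory Submission
  imports Defs "HOL-Computational_Algebra.Fundamental_Theorem_Algebra"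
begin

text \<open>
  A homomorphism \<open>h\<close> from \<open>G\<close> to \<open>H\<close> makes every summable series on \<open>G\<close> act on
  \<open>l2 (carrier H)\<close>, and the trace of this action is the sum of the coefficients over the kernel of \<open>h\<close>.
  Convergence of marked groups means that every fixed word eventually lies in both kernels or in neither,
  so the traces converge by dominated convergence.

  If \<open>f\<close> has the inverse \<open>g\<close>, then in every quotient \<open>f\<^sup>*f\<close> acts as a self-adjoint
  operator \<open>T\<close> with spectrum in one fixed interval \<open>[a, b]\<close>, \<open>a > 0\<close>, determined by the
  \<open>L\<^sup>1\<close>-norms of \<open>f\<close> and \<open>g\<close>, and \<open>log |f|\<close> acts as the function
  \<open>ln \<circ> sqrt\<close> of \<open>T\<close>. A polynomial \<open>p\<close> that is \<open>\<epsilon>\<close>-close to this function on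
  \<open>[a, b]\<close> gives an \<open>\<epsilon>\<close>-approximation of the trace uniformly over all quotients, and the trace
  of \<open>p(T)\<close> converges by the first part, applied to the convolution powers of \<open>f\<^sup>*f\<close>.

  The spectral theory needed is the bound \<open>\<parallel>p(T)\<parallel> \<le> sup |p|\<close> over the approximate point
  spectrum: for \<open>M = \<parallel>p(T)\<parallel>\<close> the operator \<open>p(T)\<^sup>2 - M\<^sup>2\<close> is not bounded below,
  hence neither is one of its linear factors over the complex numbers.
\<close>


section \<open>Square-summable functions\<close>

text \<open>The determinant reaches its operators through definite descriptions.
  \<open>op_cfc\<close> asks for the common limit of all polynomial sequences that converge on the
  real points of the spectrum. Its value has to be constructed and shown unique before anything can
  be estimated, and polynomials have to be controlled by their size on the spectrum alone. No
  spectral measure is built: the norm bound for polynomials yields existence and uniqueness of the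
  calculus, and a Neumann series confines the real points of the spectrum to [a, b]. The operator
  \<open>|f|\<close> is itself such a limit and not visibly the action of a summable series, whereas
  \<open>f\<^sup>*f\<close> is. The two nested calculi, square root and then logarithm, are
  therefore merged into one function of \<open>f\<^sup>*f\<close> before polynomials enter. What
  remains to converge is a finite combination of traces of series on the source group, and these
  series do not depend on n. The spectra do vary with n; working on the whole interval [a, b] lets
  one polynomial serve every quotient.\<close>

lemma l2I_bound:
  assumes "\<And>i. i \<notin> I \<Longrightarrow> x i = 0"
    and "\<And>F. finite F \<Longrightarrow> F \<subseteq> I \<Longrightarrow> L2_set (\<lambda>i. cmod (x i)) F \<le> c"
  shows "x \<in> l2 I" and "l2_norm I x \<le> c"
proof -
  have c: "c \<ge> 0" using assms(2)[of "{}"] by simp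
  have *: "(\<Sum>i\<in>F. (cmod (x i))\<^sup>2) \<le> c\<^sup>2" if "finite F" "F \<subseteq> I" for F
    using assms(2)[OF that] by (simp add: L2_set_def sqrt_le_D)
  have s: "(\<lambda>i. (cmod (x i))\<^sup>2) summable_on I"
    by (rule nonneg_bdd_above_summable_on) (auto intro!: bdd_aboveI2[where M = "c\<^sup>2"] *)
  then show "x \<in> l2 I" using assms(1) by (simp add: l2_def)
  show "l2_norm I x \<le> c"
    unfolding l2_norm_def using infsum_le_finite_sums[OF s *] c by (simp add: real_le_lsqrt)
qed

lemma l2_outside: "x \<in> l2 I \<Longrightarrow> i \<notin> I \<Longrightarrow> x i = 0"
  by (simp add: l2_def)

lemma l2_summable: "x \<in> l2 I \<Longrightarrow> (\<lambda>i. (cmod (x i))\<^sup>2) summable_on I"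
  by (simp add: l2_def)

lemma l2_norm_nonneg [simp]: "l2_norm I x \<ge> 0"
  by (simp add: l2_norm_def infsum_nonneg)

text \<open>Converse of \<open>l2I_bound\<close>. With both, the triangle inequality, Cauchy-Schwarz
  and completeness reduce to estimates of \<open>L2_set\<close> on finite index sets.\<close>

lemma L2_set_le_l2_norm:
  assumes "x \<in> l2 I" "finite F" "F \<subseteq> I"
  shows "L2_set (\<lambda>i. cmod (x i)) F \<le> l2_norm I x"
  unfolding L2_set_def l2_norm_def
  using finite_sum_le_infsum[OF l2_summable[OF assms(1)] assms(2,3)] by simp

lemma cmod_le_l2_norm: "x \<in> l2 I \<Longrightarrow> cmod (x i) \<le> l2_norm I x"
proof (cases "i \<in> I")
  case True
  assume "x \<in> l2 I"
  from L2_set_le_l2_norm[OF this, of "{i}"] True show ?thesis by simp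
qed (simp add: l2_outside)

lemma l2_norm_eq_0_iff: "x \<in> l2 I \<Longrightarrow> l2_norm I x = 0 \<longleftrightarrow> x = (\<lambda>i. 0)"
  using cmod_le_l2_norm[of x I] by (auto simp: l2_norm_def fun_eq_iff)

lemma
  assumes "x \<in> l2 I" "y \<in> l2 I"
  shows l2_add: "(\<lambda>i. x i + y i) \<in> l2 I"
    and l2_norm_triangle: "l2_norm I (\<lambda>i. x i + y i) \<le> l2_norm I x + l2_norm I y"
proof -
  have "L2_set (\<lambda>i. cmod (x i + y i)) F \<le> l2_norm I x + l2_norm I y" if "finite F" "F \<subseteq> I" for F
  proof -
    have "L2_set (\<lambda>i. cmod (x i + y i)) F \<le> L2_set (\<lambda>i. cmod (x i) + cmod (y i)) F"
      by (intro L2_set_mono norm_triangle_ineq) auto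
    also have "\<dots> \<le> L2_set (\<lambda>i. cmod (x i)) F + L2_set (\<lambda>i. cmod (y i)) F"
      by (rule L2_set_triangle_ineq)
    finally show ?thesis
      using L2_set_le_l2_norm[OF assms(1) that] L2_set_le_l2_norm[OF assms(2) that] by linarith
  qed
  then show "(\<lambda>i. x i + y i) \<in> l2 I" "l2_norm I (\<lambda>i. x i + y i) \<le> l2_norm I x + l2_norm I y"
    using l2I_bound[of I "\<lambda>i. x i + y i"] assms by (auto simp: l2_outside)
qed

lemma l2_scale: "x \<in> l2 I \<Longrightarrow> (\<lambda>i. c * x i) \<in> l2 I"
  by (auto simp: l2_def norm_mult power_mult_distrib intro: summable_on_cmult_right)

lemma l2_norm_scale: "l2_norm I (\<lambda>i. c * x i) = cmod c * l2_norm I x"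
  by (simp add: l2_norm_def norm_mult power_mult_distrib infsum_cmult_right' real_sqrt_mult)

lemma l2_zero [simp]: "(\<lambda>i. 0) \<in> l2 I" and l2_norm_zero [simp]: "l2_norm I (\<lambda>i. 0) = 0"
  by (simp_all add: l2_def l2_norm_def)

lemma l2_diff: "x \<in> l2 I \<Longrightarrow> y \<in> l2 I \<Longrightarrow> (\<lambda>i. x i - y i) \<in> l2 I"
  using l2_add[of x I "\<lambda>i. -1 * y i"] l2_scale[of y I "-1"] by simp

lemma l2_norm_minus_commute: "l2_norm I (\<lambda>i. x i - y i) = l2_norm I (\<lambda>i. y i - x i)"
  by (simp add: l2_norm_def norm_minus_commute)

lemma l2_norm_diff_triangle:
  assumes "x \<in> l2 I" "y \<in> l2 I" "z \<in> l2 I"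
  shows "l2_norm I (\<lambda>i. x i - z i) \<le> l2_norm I (\<lambda>i. x i - y i) + l2_norm I (\<lambda>i. y i - z i)"
  using l2_norm_triangle[OF l2_diff[OF assms(1,2)] l2_diff[OF assms(2,3)]] by simp

lemma l2_norm_triangle_sub:
  assumes "x \<in> l2 I" "y \<in> l2 I"
  shows "l2_norm I x \<le> l2_norm I y + l2_norm I (\<lambda>i. x i - y i)"
  using l2_norm_triangle[OF assms(2) l2_diff[OF assms]] by simp

lemma l2_norm_diff_le:
  assumes "x \<in> l2 I" "y \<in> l2 I"
  shows "l2_norm I (\<lambda>i. x i - y i) \<le> l2_norm I x + l2_norm I y"
  using l2_norm_diff_triangle[OF assms(1) l2_zero assms(2)] l2_norm_minus_commute[of I "\<lambda>i. 0" y]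
  by simp

text \<open>The sum of absolute values is bounded, not only the inner product:
  \<open>series_op_adjoint\<close> interchanges summations and needs a bound that is uniform over
  all translates.\<close>

lemma
  assumes "x \<in> l2 I" "y \<in> l2 I"
  shows l2_inner_abs_summable: "(\<lambda>i. cmod (x i * cnj (y i))) summable_on I"
    and l2_inner_abs_le: "(\<Sum>\<^sub>\<infinity>i\<in>I. cmod (x i * cnj (y i))) \<le> l2_norm I x * l2_norm I y"
proof -
  have *: "(\<Sum>i\<in>F. cmod (x i * cnj (y i))) \<le> l2_norm I x * l2_norm I y"
    if "finite F" "F \<subseteq> I" for F
  proof -
    have "(\<Sum>i\<in>F. cmod (x i * cnj (y i))) \<le> L2_set (\<lambda>i. cmod (x i)) F * L2_set (\<lambda>i. cmod (y i)) F"
      using L2_set_mult_ineq[of "\<lambda>i. cmod (x i)" "\<lambda>i. cmod (y i)" F] by (simp add: norm_mult)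
    also have "\<dots> \<le> l2_norm I x * l2_norm I y"
      using assms that by (intro mult_mono L2_set_le_l2_norm) auto
    finally show ?thesis .
  qed
  show s: "(\<lambda>i. cmod (x i * cnj (y i))) summable_on I"
    by (rule nonneg_bdd_above_summable_on)
      (auto intro!: bdd_aboveI2[where M = "l2_norm I x * l2_norm I y"] * simp del: complex_mod_cnj)
  show "(\<Sum>\<^sub>\<infinity>i\<in>I. cmod (x i * cnj (y i))) \<le> l2_norm I x * l2_norm I y"
    using infsum_le_finite_sums[OF s *] .
qed

lemma l2_inner_summable:
  "x \<in> l2 I \<Longrightarrow> y \<in> l2 I \<Longrightarrow> (\<lambda>i. x i * cnj (y i)) summable_on I"
  by (rule abs_summable_summable) (rule l2_inner_abs_summable)

lemma l2_Cauchy_Schwarz: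
  assumes "x \<in> l2 I" "y \<in> l2 I"
  shows "cmod (l2_inner I x y) \<le> l2_norm I x * l2_norm I y"
  unfolding l2_inner_def
  using norm_infsum_bound[OF l2_inner_abs_summable[OF assms]] l2_inner_abs_le[OF assms] by linarith

lemma l2_inner_add_left:
  "x \<in> l2 I \<Longrightarrow> y \<in> l2 I \<Longrightarrow> z \<in> l2 I \<Longrightarrow>
    l2_inner I (\<lambda>i. x i + y i) z = l2_inner I x z + l2_inner I y z"
  by (simp add: l2_inner_def distrib_right infsum_add l2_inner_summable)

lemma l2_inner_scale_left: "l2_inner I (\<lambda>i. c * x i) y = c * l2_inner I x y"
  by (simp add: l2_inner_def mult.assoc infsum_cmult_right')

lemma l2_inner_cnj: "cnj (l2_inner I x y) = l2_inner I y x"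
  by (simp add: l2_inner_def mult.commute flip: infsum_cnj)

lemma l2_inner_diff_left:
  "x \<in> l2 I \<Longrightarrow> y \<in> l2 I \<Longrightarrow> z \<in> l2 I \<Longrightarrow>
    l2_inner I (\<lambda>i. x i - y i) z = l2_inner I x z - l2_inner I y z"
  using l2_inner_add_left[of x I "\<lambda>i. -1 * y i" z] l2_scale[of y I "-1"]
    l2_inner_scale_left[of I "-1" y z] by simp

lemma l2_inner_scale_right: "l2_inner I x (\<lambda>i. c * y i) = cnj c * l2_inner I x y"
  using arg_cong[where f = cnj, OF l2_inner_scale_left[of I c y x]] by (simp add: l2_inner_cnj)

lemma l2_inner_add_right:
  "x \<in> l2 I \<Longrightarrow> y \<in> l2 I \<Longrightarrow> z \<in> l2 I \<Longrightarrow>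
    l2_inner I x (\<lambda>i. y i + z i) = l2_inner I x y + l2_inner I x z"
  using arg_cong[where f = cnj, OF l2_inner_add_left[of y I z x]] by (simp add: l2_inner_cnj)

lemma l2_inner_diff_right:
  "x \<in> l2 I \<Longrightarrow> y \<in> l2 I \<Longrightarrow> z \<in> l2 I \<Longrightarrow>
    l2_inner I x (\<lambda>i. y i - z i) = l2_inner I x y - l2_inner I x z"
  using arg_cong[where f = cnj, OF l2_inner_diff_left[of y I z x]] by (simp add: l2_inner_cnj)

lemma l2_inner_self:
  assumes "x \<in> l2 I"
  shows "l2_inner I x x = complex_of_real ((l2_norm I x)\<^sup>2)"
proof -
  have "l2_inner I x x = (\<Sum>\<^sub>\<infinity>i\<in>I. complex_of_real ((cmod (x i))\<^sup>2))"
    by (simp only: l2_inner_def complex_norm_square)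
  also have "\<dots> = complex_of_real (\<Sum>\<^sub>\<infinity>i\<in>I. (cmod (x i))\<^sup>2)"
    using has_sum_of_real[OF has_sum_infsum[OF l2_summable[OF assms]]] by (rule infsumI)
  finally show ?thesis by (simp add: l2_norm_def infsum_nonneg)
qed

lemma l2_norm_diff_square:
  assumes "x \<in> l2 I" "y \<in> l2 I"
  shows "(l2_norm I (\<lambda>i. x i - y i))\<^sup>2
    = (l2_norm I x)\<^sup>2 - 2 * Re (l2_inner I x y) + (l2_norm I y)\<^sup>2"
proof -
  have "l2_inner I (\<lambda>i. x i - y i) (\<lambda>i. x i - y i)
      = l2_inner I x x - l2_inner I x y - (cnj (l2_inner I x y) - l2_inner I y y)"
    using assms by (simp add: l2_inner_diff_left l2_inner_diff_right l2_diff l2_inner_cnj)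
  from arg_cong[where f = Re, OF this] show ?thesis by (simp add: l2_inner_self assms l2_diff)
qed

lemma l2_inner_eqI:
  assumes "y \<in> l2 I" "z \<in> l2 I" "\<And>x. x \<in> l2 I \<Longrightarrow> l2_inner I x y = l2_inner I x z"
  shows "y = z"
proof -
  let ?d = "\<lambda>i. y i - z i"
  have d: "?d \<in> l2 I" using assms by (simp add: l2_diff)
  have "l2_inner I ?d ?d = 0" using assms d by (subst l2_inner_diff_right) auto
  then have "?d = (\<lambda>i. 0)" using d by (simp add: l2_inner_self l2_norm_eq_0_iff)
  then show ?thesis by (simp add: fun_eq_iff)
qed

text \<open>The last clause holds for one limit and all \<open>N\<close>, \<open>e\<close> at once,
  so a Cauchy bound passes to the limit unweakened. \<open>bounded_ops_complete\<close> uses it with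
  \<open>e\<close> proportional to the norm of the argument, which turns pointwise limits into norm
  limits.\<close>

lemma l2_complete:
  assumes x: "\<And>n. x n \<in> l2 I"
    and Cauchy: "\<And>e. e > 0 \<Longrightarrow> \<exists>N. \<forall>n\<ge>N. \<forall>m\<ge>N. l2_norm I (\<lambda>i. x n i - x m i) \<le> e"
  shows "\<exists>y\<in>l2 I. (\<forall>i. (\<lambda>n. x n i) \<longlonglongrightarrow> y i) \<and>
    (\<forall>N e. (\<forall>n\<ge>N. \<forall>m\<ge>N. l2_norm I (\<lambda>i. x n i - x m i) \<le> e) \<longrightarrow>
      (\<forall>n\<ge>N. l2_norm I (\<lambda>i. x n i - y i) \<le> e))"
proof -
  have Cauchy_i: "Cauchy (\<lambda>n. x n i)" for i
  proof (rule CauchyI)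
    fix e :: real assume "e > 0"
    then obtain N where N: "\<And>n m. n \<ge> N \<Longrightarrow> m \<ge> N \<Longrightarrow> l2_norm I (\<lambda>i. x n i - x m i) \<le> e / 2"
      using Cauchy[of "e / 2"] by auto
    have "cmod (x m i - x n i) < e" if "m \<ge> N" "n \<ge> N" for m n
      using cmod_le_l2_norm[OF l2_diff[OF x[of m] x[of n]], of i] N[OF that] \<open>e > 0\<close> by simp
    then show "\<exists>M. \<forall>m\<ge>M. \<forall>n\<ge>M. norm (x m i - x n i) < e" by blast
  qed
  define y where "y i = lim (\<lambda>n. x n i)" for i
  have y: "(\<lambda>n. x n i) \<longlonglongrightarrow> y i" for i
    using Cauchy_i[of i] unfolding y_def
    by (simp add: Cauchy_convergent_iff convergent_LIMSEQ_iff)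
  have y0: "y i = 0" if "i \<notin> I" for i
    using y[of i] l2_outside[OF x that] by (simp add: LIMSEQ_const_iff)
  have *: "(\<lambda>i. x n i - y i) \<in> l2 I \<and> l2_norm I (\<lambda>i. x n i - y i) \<le> e"
    if N: "\<forall>n\<ge>N. \<forall>m\<ge>N. l2_norm I (\<lambda>i. x n i - x m i) \<le> e" and n: "n \<ge> N" for n N e
  proof -
    \<comment> \<open>Fatou's argument: on a finite set the norm depends continuously on finitely
      many coordinates, so the bound survives the coordinatewise limit in m.\<close>
    have "L2_set (\<lambda>i. cmod (x n i - y i)) F \<le> e" if F: "finite F" "F \<subseteq> I" for F
    proof (rule tendsto_upperbound)
      show "(\<lambda>m. L2_set (\<lambda>i. cmod (x n i - x m i)) F) \<longlonglongrightarrow> L2_set (\<lambda>i. cmod (x n i - y i)) F"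
        unfolding L2_set_def by (intro tendsto_intros y)
      have "L2_set (\<lambda>i. cmod (x n i - x m i)) F \<le> e" if "m \<ge> N" for m
        using L2_set_le_l2_norm[OF l2_diff[OF x[of n] x[of m]] F] N n that by fastforce
      then show "\<forall>\<^sub>F m in sequentially. L2_set (\<lambda>i. cmod (x n i - x m i)) F \<le> e"
        by (auto simp: eventually_sequentially)
    qed simp
    then show ?thesis
      using l2I_bound[of I "\<lambda>i. x n i - y i" e] y0 l2_outside[OF x[of n]] by simp
  qed
  obtain N where "\<forall>n\<ge>N. \<forall>m\<ge>N. l2_norm I (\<lambda>i. x n i - x m i) \<le> 1"
    using Cauchy[of 1] by auto
  from *[OF this, of N] have "(\<lambda>i. x N i - y i) \<in> l2 I" by simp
  from l2_diff[OF x[of N] this] have "y \<in> l2 I" by simp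
  then show ?thesis
  proof (rule bexI[rotated], intro conjI allI impI)
    show "(\<lambda>n. x n i) \<longlonglongrightarrow> y i" for i by (rule y)
    show "l2_norm I (\<lambda>i. x n i - y i) \<le> e"
      if "\<forall>n\<ge>N. \<forall>m\<ge>N. l2_norm I (\<lambda>i. x n i - x m i) \<le> e" "n \<ge> N" for N e n
      using *[OF that] by simp
  qed
qed


section \<open>Bounded operators\<close>

text \<open>The analytic half of \<open>bounded_ops\<close>, with the constant visible and without
  extensionality, so that it applies to \<open>series_op\<close> and \<open>op_cpoly\<close>, which
  are not restricted to \<open>l2 I\<close>. The constant may be negative; hence the absolute values
  and maxima of \<open>K\<close> below.\<close>

definition l2_bounded_by :: "'a set \<Rightarrow> 'a op \<Rightarrow> real \<Rightarrow> bool" where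
  "l2_bounded_by I A K \<longleftrightarrow>
     (\<forall>x\<in>l2 I. A x \<in> l2 I \<and> l2_norm I (A x) \<le> K * l2_norm I x) \<and>
     (\<forall>x\<in>l2 I. \<forall>y\<in>l2 I. A (\<lambda>i. x i + y i) = (\<lambda>i. A x i + A y i)) \<and>
     (\<forall>c. \<forall>x\<in>l2 I. A (\<lambda>i. c * x i) = (\<lambda>i. c * A x i))"

lemma l2b_mem: "l2_bounded_by I A K \<Longrightarrow> x \<in> l2 I \<Longrightarrow> A x \<in> l2 I"
  and l2b_norm: "l2_bounded_by I A K \<Longrightarrow> x \<in> l2 I \<Longrightarrow> l2_norm I (A x) \<le> K * l2_norm I x"
  and l2b_add: "l2_bounded_by I A K \<Longrightarrow> x \<in> l2 I \<Longrightarrow> y \<in> l2 I \<Longrightarrow>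
    A (\<lambda>i. x i + y i) = (\<lambda>i. A x i + A y i)"
  and l2b_scale: "l2_bounded_by I A K \<Longrightarrow> x \<in> l2 I \<Longrightarrow> A (\<lambda>i. c * x i) = (\<lambda>i. c * A x i)"
  unfolding l2_bounded_by_def by blast+

lemma l2b_diff:
  assumes A: "l2_bounded_by I A K" and x: "x \<in> l2 I" and y: "y \<in> l2 I"
  shows "A (\<lambda>i. x i - y i) = (\<lambda>i. A x i - A y i)"
  using l2b_add[OF A x l2_scale[OF y, of "-1"]] l2b_scale[OF A y, of "-1"] by simp

lemma l2b_zero: "l2_bounded_by I A K \<Longrightarrow> A (\<lambda>i. 0) = (\<lambda>i. 0)"
  using l2b_scale[of I A K "\<lambda>i. 0" 0] by simp

lemma l2b_mono:
  assumes "l2_bounded_by I A K" "K \<le> L"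
  shows "l2_bounded_by I A L"
proof -
  have "l2_norm I (A x) \<le> L * l2_norm I x" if "x \<in> l2 I" for x
    using l2b_norm[OF assms(1) that] mult_right_mono[OF assms(2) l2_norm_nonneg[of I x]] by linarith
  then show ?thesis using assms(1) unfolding l2_bounded_by_def by blast
qed

lemma l2b_cong:
  assumes "l2_bounded_by I A K" "\<And>x. x \<in> l2 I \<Longrightarrow> B x = A x"
  shows "l2_bounded_by I B K"
  using assms unfolding l2_bounded_by_def by (simp add: l2_add l2_scale)

lemma l2b_id: "l2_bounded_by I (\<lambda>x. x) 1"
  by (simp add: l2_bounded_by_def)

lemma l2b_compose:
  assumes A: "l2_bounded_by I A K" and B: "l2_bounded_by I B L" and K: "K \<ge> 0"
  shows "l2_bounded_by I (\<lambda>x. A (B x)) (K * L)"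
proof -
  have "l2_norm I (A (B x)) \<le> K * L * l2_norm I x" if "x \<in> l2 I" for x
    using l2b_norm[OF A l2b_mem[OF B that]] mult_left_mono[OF l2b_norm[OF B that] K] by linarith
  then show ?thesis
    unfolding l2_bounded_by_def
    by (simp add: l2b_mem[OF A] l2b_mem[OF B] l2b_add[OF A] l2b_add[OF B] l2b_scale[OF A] l2b_scale[OF B])
qed

lemma l2b_lincomb:
  assumes A: "l2_bounded_by I A K" and B: "l2_bounded_by I B L"
  shows "l2_bounded_by I (\<lambda>x i. c * A x i + d * B x i) (cmod c * K + cmod d * L)"
proof -
  have m: "(\<lambda>i. c * A x i + d * B x i) \<in> l2 I" if "x \<in> l2 I" for x
    by (intro l2_add l2_scale l2b_mem[OF A] l2b_mem[OF B] that)
  have "l2_norm I (\<lambda>i. c * A x i + d * B x i) \<le> (cmod c * K + cmod d * L) * l2_norm I x"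
    if "x \<in> l2 I" for x
  proof -
    have "l2_norm I (\<lambda>i. c * A x i + d * B x i) \<le> cmod c * l2_norm I (A x) + cmod d * l2_norm I (B x)"
      using l2_norm_triangle[OF l2_scale[OF l2b_mem[OF A that]] l2_scale[OF l2b_mem[OF B that]], of c d]
      by (simp add: l2_norm_scale)
    also have "\<dots> \<le> cmod c * (K * l2_norm I x) + cmod d * (L * l2_norm I x)"
      by (intro add_mono mult_left_mono l2b_norm[OF A] l2b_norm[OF B] that) auto
    finally show ?thesis by (simp add: algebra_simps)
  qed
  with m show ?thesis
    unfolding l2_bounded_by_def
    by (auto simp: l2b_add[OF A] l2b_add[OF B] l2b_scale[OF A] l2b_scale[OF B] algebra_simps)
qed

lemma bounded_ops_iff: "A \<in> bounded_ops I \<longleftrightarrow> A \<in> extensional (l2 I) \<and> (\<exists>K. l2_bounded_by I A K)"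
  unfolding bounded_ops_def l2_bounded_by_def PiE_iff by blast

lemma bounded_opsD:
  assumes "A \<in> bounded_ops I"
  obtains K where "l2_bounded_by I A K" "K \<ge> 0"
proof -
  from assms obtain K where K: "l2_bounded_by I A K" by (auto simp: bounded_ops_iff)
  from that[OF l2b_mono[OF K, of "max K 0"]] show ?thesis by simp
qed

lemma bounded_ops_restrict: "l2_bounded_by I A K \<Longrightarrow> restrict A (l2 I) \<in> bounded_ops I"
  unfolding bounded_ops_iff using l2b_cong[of I A K "restrict A (l2 I)"] by auto

lemma bounded_ops_eqI:
  assumes "A \<in> bounded_ops I" "B \<in> bounded_ops I" "\<And>x. x \<in> l2 I \<Longrightarrow> A x = B x"
  shows "A = B"
  using assms by (auto simp: bounded_ops_iff intro: extensionalityI)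


section \<open>Polynomials in an operator\<close>

text \<open>Complex coefficients, because the spectral bound splits polynomials into linear factors;
  unrestricted, because the identities for sums and scalar multiples then hold for every argument.
  \<open>op_poly_eq\<close> connects it with \<open>op_poly\<close>.\<close>

definition op_cpoly :: "'a op \<Rightarrow> complex poly \<Rightarrow> 'a op" where
  "op_cpoly T q = (\<lambda>x i. \<Sum>k\<le>degree q. coeff q k * (T ^^ k) x i)"

lemma op_cpoly_altdef:
  assumes "degree q \<le> n"
  shows "op_cpoly T q x i = (\<Sum>k\<le>n. coeff q k * (T ^^ k) x i)"
  unfolding op_cpoly_def
  by (rule sum.mono_neutral_left) (use assms in \<open>auto simp: coeff_eq_0\<close>)

lemma op_cpoly_add: "op_cpoly T (p + q) x = (\<lambda>i. op_cpoly T p x i + op_cpoly T q x i)"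
proof
  fix i
  let ?n = "max (degree p) (degree q)"
  show "op_cpoly T (p + q) x i = op_cpoly T p x i + op_cpoly T q x i"
    using op_cpoly_altdef[of p ?n T x i] op_cpoly_altdef[of q ?n T x i]
      op_cpoly_altdef[of "p + q" ?n T x i] degree_add_le_max[of p q]
    by (simp add: distrib_right sum.distrib)
qed

lemma op_cpoly_smult: "op_cpoly T (smult c p) x = (\<lambda>i. c * op_cpoly T p x i)"
  using op_cpoly_altdef[of "smult c p" "degree p" T x]
  by (simp add: op_cpoly_def[of T p] sum_distrib_left mult.assoc fun_eq_iff degree_smult_le)

lemma op_cpoly_diff: "op_cpoly T (p - q) x = (\<lambda>i. op_cpoly T p x i - op_cpoly T q x i)"
  using op_cpoly_add[of T p "- q" x] op_cpoly_smult[of T "- 1" q x] by simp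

lemma op_cpoly_const: "op_cpoly T [:c:] x = (\<lambda>i. c * x i)"
  by (simp add: op_cpoly_def)

lemma op_cpoly_0: "op_cpoly T 0 x = (\<lambda>i. 0)"
  by (simp add: op_cpoly_def)

lemma op_cpoly_1: "op_cpoly T 1 x = x"
  by (simp add: op_cpoly_def)

context
  fixes I :: "'a set" and T :: "'a op" and K :: real
  assumes T: "l2_bounded_by I T K"
begin

lemma l2b_funpow: "x \<in> l2 I \<Longrightarrow> (T ^^ k) x \<in> l2 I"
  by (induction k) (auto intro: l2b_mem[OF T])

lemma l2b_sum:
  assumes "finite F" "\<And>k. k \<in> F \<Longrightarrow> x k \<in> l2 I"
  shows "(\<lambda>i. \<Sum>k\<in>F. c k * x k i) \<in> l2 I \<and>
    T (\<lambda>i. \<Sum>k\<in>F. c k * x k i) = (\<lambda>i. \<Sum>k\<in>F. c k * T (x k) i)"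
  using assms
proof (induction F)
  case empty
  then show ?case by (simp add: l2b_zero[OF T])
next
  case (insert k F)
  then show ?case
    using l2b_add[OF T, of "\<lambda>i. c k * x k i" "\<lambda>i. \<Sum>k\<in>F. c k * x k i"]
    by (auto simp: l2_scale l2_add l2b_scale[OF T])
qed

lemma op_cpoly_mem: "x \<in> l2 I \<Longrightarrow> op_cpoly T q x \<in> l2 I"
  unfolding op_cpoly_def using l2b_sum[of "{..degree q}" "\<lambda>k. (T ^^ k) x" "coeff q"] l2b_funpow by auto

text \<open>Horner's rule. It pulls one \<open>T\<close> out of the sum by linearity and is the step
  of the inductions over polynomials below.\<close>

lemma op_cpoly_pCons:
  assumes x: "x \<in> l2 I"
  shows "op_cpoly T (pCons a q) x = (\<lambda>i. a * x i + T (op_cpoly T q x) i)"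
proof
  fix i
  have "T (op_cpoly T q x) = (\<lambda>i. \<Sum>k\<le>degree q. coeff q k * (T ^^ Suc k) x i)"
    unfolding op_cpoly_def using l2b_sum[of "{..degree q}" "\<lambda>k. (T ^^ k) x" "coeff q"] l2b_funpow x by auto
  moreover have "op_cpoly T (pCons a q) x i
      = (\<Sum>k\<le>Suc (degree q). coeff (pCons a q) k * (T ^^ k) x i)"
    by (rule op_cpoly_altdef) (rule degree_pCons_le)
  ultimately show "op_cpoly T (pCons a q) x i = a * x i + T (op_cpoly T q x) i"
    by (simp add: sum.atMost_Suc_shift del: sum.atMost_Suc)
qed

lemma op_cpoly_bounded: "\<exists>L\<ge>0. l2_bounded_by I (op_cpoly T q) L"
proof (induction q)
  case 0
  show ?case by (rule exI[of _ 0]) (simp add: op_cpoly_0 l2_bounded_by_def)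
next
  case (pCons a q)
  then obtain L where L: "l2_bounded_by I (op_cpoly T q) L" "L \<ge> 0" by blast
  have "l2_bounded_by I (\<lambda>x. T (op_cpoly T q x)) (max K 0 * L)"
    by (rule l2b_compose[OF l2b_mono[OF T] L(1)]) auto
  from l2b_lincomb[OF l2b_id this, of a 1]
  have "l2_bounded_by I (op_cpoly T (pCons a q)) (cmod a * 1 + cmod 1 * (max K 0 * L))"
    by (rule l2b_cong) (simp add: op_cpoly_pCons)
  then show ?case using L(2) by (intro exI[of _ "cmod a + max K 0 * L"]) simp
qed

lemma op_cpoly_mult:
  assumes x: "x \<in> l2 I"
  shows "op_cpoly T (p * q) x = op_cpoly T p (op_cpoly T q x)"
proof (induction p)
  case 0
  then show ?case by (simp add: op_cpoly_0)
next
  case (pCons a p)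
  then show ?case
    using x by (simp add: mult_pCons_left op_cpoly_add op_cpoly_smult op_cpoly_pCons op_cpoly_mem)
qed

end

text \<open>Needed in \<open>op_cfc_compose\<close>, where \<open>p\<close> approximates the inner
  function and \<open>r\<close> the outer one.\<close>

lemma op_cpoly_pcompose:
  assumes T: "l2_bounded_by I T K" and x: "x \<in> l2 I"
  shows "op_cpoly T (pcompose r p) x = op_cpoly (op_cpoly T p) r x"
proof -
  obtain L where L: "l2_bounded_by I (op_cpoly T p) L" using op_cpoly_bounded[OF T] by blast
  show ?thesis
  proof (induction r)
    case 0
    then show ?case by (simp add: op_cpoly_0)
  next
    case (pCons a r)
    then show ?case
      by (simp add: pcompose_pCons op_cpoly_add op_cpoly_const op_cpoly_mult[OF T x] op_cpoly_pCons[OF L x])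
  qed
qed

lemma l2b_op_cpoly_le:
  assumes "l2_bounded_by I T K" "\<And>x. x \<in> l2 I \<Longrightarrow> l2_norm I (op_cpoly T q x) \<le> L * l2_norm I x"
  shows "l2_bounded_by I (op_cpoly T q) L"
  using op_cpoly_bounded[OF assms(1), of q] assms(2) unfolding l2_bounded_by_def by blast

lemma op_cpoly_pow_norm:
  assumes T: "l2_bounded_by I T K" and Q: "\<And>x. x \<in> l2 I \<Longrightarrow> l2_norm I (op_cpoly T Q x) \<le> r * l2_norm I x"
    and r: "r \<ge> 0" and x: "x \<in> l2 I"
  shows "l2_norm I (op_cpoly T (Q ^ n) x) \<le> r ^ n * l2_norm I x"
proof (induction n)
  case 0
  then show ?case by (simp add: op_cpoly_1)
next
  case (Suc n)
  have "l2_norm I (op_cpoly T (Q ^ Suc n) x) \<le> r * l2_norm I (op_cpoly T (Q ^ n) x)"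
    using Q[OF op_cpoly_mem[OF T x]] by (simp add: op_cpoly_mult[OF T x])
  then show ?case using mult_left_mono[OF Suc r] by (simp add: mult.assoc)
qed


section \<open>Norm limits of operators and the Neumann series\<close>

text \<open>Completeness in operator norm, phrased with bounds on vectors. It produces both the
  Neumann series and the functional calculus.\<close>

lemma bounded_ops_complete:
  fixes B :: "nat \<Rightarrow> 'a op"
  assumes B: "\<And>n. \<exists>K. l2_bounded_by I (B n) K"
    and Cauchy: "\<And>e. e > 0 \<Longrightarrow>
      \<exists>N. \<forall>n\<ge>N. \<forall>m\<ge>N. \<forall>x\<in>l2 I. l2_norm I (\<lambda>i. B n x i - B m x i) \<le> e * l2_norm I x"
  shows "\<exists>C\<in>bounded_ops I. \<forall>e>0. \<exists>N. \<forall>n\<ge>N. \<forall>x\<in>l2 I. l2_norm I (\<lambda>i. B n x i - C x i) \<le> e * l2_norm I x"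
proof -
  obtain K where K: "\<And>n. l2_bounded_by I (B n) (K n)" using B by metis
  define limit_of where "limit_of x y \<longleftrightarrow> y \<in> l2 I \<and> (\<forall>i. (\<lambda>n. B n x i) \<longlonglongrightarrow> y i) \<and>
    (\<forall>N e. (\<forall>n\<ge>N. \<forall>m\<ge>N. l2_norm I (\<lambda>i. B n x i - B m x i) \<le> e) \<longrightarrow>
      (\<forall>n\<ge>N. l2_norm I (\<lambda>i. B n x i - y i) \<le> e))" for x y
  have "\<exists>y. limit_of x y" if x: "x \<in> l2 I" for x
    unfolding limit_of_def Bex_def[symmetric]
  proof (rule l2_complete)
    show "B n x \<in> l2 I" for n using l2b_mem[OF K x] .
    fix e :: real assume e: "e > 0"
    \<comment> \<open>The added 1 permits division also when x has norm 0.\<close>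
    define c where "c = l2_norm I x + 1"
    have c: "c > 0" "l2_norm I x \<le> c" using l2_norm_nonneg[of I x] unfolding c_def by linarith+
    obtain N where N: "\<forall>n\<ge>N. \<forall>m\<ge>N. \<forall>x\<in>l2 I. l2_norm I (\<lambda>i. B n x i - B m x i) \<le> e / c * l2_norm I x"
      using Cauchy[of "e / c"] e c by auto
    have "e / c * l2_norm I x \<le> e / c * c" using e c by (intro mult_left_mono) auto
    then have "e / c * l2_norm I x \<le> e" using c by simp
    then show "\<exists>N. \<forall>n\<ge>N. \<forall>m\<ge>N. l2_norm I (\<lambda>i. B n x i - B m x i) \<le> e"
      using N x by (intro exI[of _ N] allI impI) (rule order_trans, auto)
  qed
  then obtain C where "\<And>x. x \<in> l2 I \<Longrightarrow> limit_of x (C x)" by metis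
  then have C: "\<And>x. x \<in> l2 I \<Longrightarrow> C x \<in> l2 I"
    "\<And>x i. x \<in> l2 I \<Longrightarrow> (\<lambda>n. B n x i) \<longlonglongrightarrow> C x i"
    "\<And>x N e n. x \<in> l2 I \<Longrightarrow> \<forall>n\<ge>N. \<forall>m\<ge>N. l2_norm I (\<lambda>i. B n x i - B m x i) \<le> e \<Longrightarrow> n \<ge> N \<Longrightarrow>
      l2_norm I (\<lambda>i. B n x i - C x i) \<le> e"
    unfolding limit_of_def by simp_all
  have lim: "\<exists>N. \<forall>n\<ge>N. \<forall>x\<in>l2 I. l2_norm I (\<lambda>i. B n x i - C x i) \<le> e * l2_norm I x" if e: "e > 0" for e
  proof -
    obtain N where "\<forall>n\<ge>N. \<forall>m\<ge>N. \<forall>x\<in>l2 I. l2_norm I (\<lambda>i. B n x i - B m x i) \<le> e * l2_norm I x"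
      using Cauchy[OF e] by blast
    then show ?thesis by (intro exI[of _ N] allI impI ballI, rule_tac N = N in C(3)) auto
  qed
  obtain N where N: "\<forall>n\<ge>N. \<forall>x\<in>l2 I. l2_norm I (\<lambda>i. B n x i - C x i) \<le> 1 * l2_norm I x"
    using lim[of 1] by auto
  have "l2_bounded_by I C (K N + 1)"
    unfolding l2_bounded_by_def
  proof (intro conjI ballI allI)
    fix x assume x: "x \<in> l2 I"
    show "C x \<in> l2 I" by (rule C(1)[OF x])
    have "l2_norm I (C x) \<le> l2_norm I (B N x) + l2_norm I (\<lambda>i. C x i - B N x i)"
      using l2_norm_triangle_sub[OF C(1)[OF x] l2b_mem[OF K x]] .
    also have "\<dots> \<le> K N * l2_norm I x + 1 * l2_norm I x"
      using N x l2b_norm[OF K x] by (intro add_mono) (auto simp: l2_norm_minus_commute[of I "C x"])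
    finally show "l2_norm I (C x) \<le> (K N + 1) * l2_norm I x" by (simp add: algebra_simps)
    show "C (\<lambda>i. x i + y i) = (\<lambda>i. C x i + C y i)" if y: "y \<in> l2 I" for y
    proof
      fix i
      have "(\<lambda>n. B n (\<lambda>i. x i + y i) i) \<longlonglongrightarrow> C x i + C y i"
        by (simp add: l2b_add[OF K x y]) (intro tendsto_add C(2) x y)
      with C(2)[OF l2_add[OF x y], of i] show "C (\<lambda>i. x i + y i) i = C x i + C y i"
        by (rule LIMSEQ_unique)
    qed
    show "C (\<lambda>i. c * x i) = (\<lambda>i. c * C x i)" for c
    proof
      fix i
      have "(\<lambda>n. B n (\<lambda>i. c * x i) i) \<longlonglongrightarrow> c * C x i"
        by (simp add: l2b_scale[OF K x]) (intro tendsto_mult_left C(2) x)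
      with C(2)[OF l2_scale[OF x], of c i] show "C (\<lambda>i. c * x i) i = c * C x i"
        by (rule LIMSEQ_unique)
    qed
  qed
  then show ?thesis
    using lim by (intro bexI[of _ "restrict C (l2 I)"] bounded_ops_restrict) auto
qed

text \<open>Identifies two vectors that are both close to a common approximant; \<open>c\<close>
  absorbs whatever constant the accumulated errors carry, and its sign is immaterial.\<close>

lemma l2_eqI_epsilon:
  assumes "x \<in> l2 I" "y \<in> l2 I" "\<And>e. e > 0 \<Longrightarrow> l2_norm I (\<lambda>i. x i - y i) \<le> e * c"
  shows "x = y"
proof -
  have "l2_norm I (\<lambda>i. x i - y i) \<le> 0 + e" if "e > 0" for e
  proof -
    have "l2_norm I (\<lambda>i. x i - y i) \<le> e / (\<bar>c\<bar> + 1) * c"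
      by (rule assms(3)) (use that in auto)
    also have "\<dots> \<le> e / (\<bar>c\<bar> + 1) * (\<bar>c\<bar> + 1)" using that by (intro mult_left_mono) auto
    finally show ?thesis by simp
  qed
  then have "l2_norm I (\<lambda>i. x i - y i) \<le> 0" by (rule field_le_epsilon)
  then have "l2_norm I (\<lambda>i. x i - y i) = 0" using l2_norm_nonneg antisym by blast
  then show ?thesis using l2_norm_eq_0_iff[OF l2_diff[OF assms(1,2)]] by (simp add: fun_eq_iff)
qed

text \<open>A bounded left inverse of \<open>A - z\<close> with constant \<open>K\<close> gives the
  lower bound \<open>1 / (\<bar>K\<bar> + 1)\<close>.\<close>

lemma spectrum_if_not_bounded_below:
  assumes A: "A \<in> bounded_ops I" and z: "z \<notin> op_spectrum I A"
  shows "\<exists>\<delta>>0. \<forall>x\<in>l2 I. \<delta> * l2_norm I x \<le> l2_norm I (\<lambda>i. A x i - z * x i)"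
proof -
  from z obtain B where B: "B \<in> bounded_ops I" "op_mult I B (op_add_scalar I A (- z)) = op_id I"
    by (auto simp: op_spectrum_def op_invertible_in_def)
  obtain K where K: "l2_bounded_by I B K" using bounded_opsD[OF B(1)] by metis
  obtain L where L: "l2_bounded_by I A L" using bounded_opsD[OF A] by metis
  show ?thesis
  proof (intro exI[of _ "1 / (\<bar>K\<bar> + 1)"] conjI ballI)
    fix x assume x: "x \<in> l2 I"
    let ?u = "\<lambda>i. A x i - z * x i"
    have u: "?u \<in> l2 I" by (intro l2_diff l2_scale l2b_mem[OF L] x)
    have "B ?u = x"
      using fun_cong[OF B(2), of x] x by (simp add: op_mult_def compose_def op_add_scalar_def op_id_def)
    then have "l2_norm I x \<le> K * l2_norm I ?u" using l2b_norm[OF K u] by simp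
    also have "\<dots> \<le> (\<bar>K\<bar> + 1) * l2_norm I ?u" by (intro mult_right_mono) auto
    finally show "1 / (\<bar>K\<bar> + 1) * l2_norm I x \<le> l2_norm I ?u" by (simp add: field_simps)
  qed simp
qed

text \<open>With \<open>d = z - c\<close> and \<open>Q\<close> representing
  \<open>(A - c) / d\<close>, which has norm at most \<open>\<rho> = r / cmod d < 1\<close>, one has
  \<open>A - z = - d (1 - Q)\<close>. The partial sums \<open>P n\<close> of the geometric series
  are kept as polynomials in \<open>A\<close>, so that they commute with \<open>1 - Q\<close> by
  polynomial algebra.\<close>

lemma not_in_spectrum_Neumann:
  assumes A: "A \<in> bounded_ops I" and r: "r \<ge> 0"
    and bd: "\<And>x. x \<in> l2 I \<Longrightarrow> l2_norm I (\<lambda>i. A x i - c * x i) \<le> r * l2_norm I x"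
    and z: "cmod (z - c) > r"
  shows "z \<notin> op_spectrum I A"
proof -
  obtain KA where KA: "l2_bounded_by I A KA" using bounded_opsD[OF A] by metis
  define d where "d = z - c"
  have d: "d \<noteq> 0" "cmod d > r" using z r by (auto simp: d_def)
  define \<rho> where "\<rho> = r / cmod d"
  have \<rho>: "0 \<le> \<rho>" "\<rho> < 1" using r d by (auto simp: \<rho>_def)
  define Q where "Q = [:- c / d, 1 / d:]"
  define P where "P n = (\<Sum>k<n. Q ^ k)" for n
  have QP: "(1 - Q) * P n = 1 - Q ^ n" for n
    unfolding P_def by (rule one_diff_power_eq[symmetric])
  note mem = op_cpoly_mem[OF KA] and mult = op_cpoly_mult[OF KA]
  have Qx: "op_cpoly A Q x = (\<lambda>i. 1 / d * (A x i - c * x i))" if "x \<in> l2 I" for x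
    using that l2b_scale[OF KA that, of "1 / d"]
    by (simp add: Q_def op_cpoly_pCons[OF KA] op_cpoly_const fun_eq_iff diff_divide_distrib)
  have Qn: "l2_norm I (op_cpoly A Q x) \<le> \<rho> * l2_norm I x" if "x \<in> l2 I" for x
    using bd[OF that] d unfolding Qx[OF that] l2_norm_scale \<rho>_def
    by (simp add: norm_divide divide_right_mono)
  have Qpow: "l2_norm I (op_cpoly A (Q ^ n) x) \<le> \<rho> ^ n * l2_norm I x" if "x \<in> l2 I" for x n
    by (rule op_cpoly_pow_norm[OF KA Qn \<rho>(1) that])
  \<comment> \<open>No tail of the geometric series is summed: for \<open>y = (P n - P m) x\<close>
    the norm of y is at most \<open>\<rho>\<close> times itself plus the norm of
    \<open>(1 - Q) y\<close>, and \<open>(1 - Q) (P n - P m)\<close> telescopes to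
    \<open>Q ^ m - Q ^ n\<close>.\<close>
  have key: "(1 - \<rho>) * l2_norm I (\<lambda>i. op_cpoly A (P n) x i - op_cpoly A (P m) x i)
      \<le> (\<rho> ^ m + \<rho> ^ n) * l2_norm I x" if x: "x \<in> l2 I" for n m x
  proof -
    define y where "y = op_cpoly A (P n - P m) x"
    have y: "y \<in> l2 I" unfolding y_def by (rule mem[OF x])
    have "l2_norm I y \<le> l2_norm I (op_cpoly A Q y) + l2_norm I (\<lambda>i. y i - op_cpoly A Q y i)"
      by (rule l2_norm_triangle_sub[OF y mem[OF y]])
    moreover have "(\<lambda>i. y i - op_cpoly A Q y i) = op_cpoly A ((1 - Q) * (P n - P m)) x"
      by (simp add: mult[OF x] op_cpoly_diff op_cpoly_1 y_def)
    moreover have "(1 - Q) * (P n - P m) = Q ^ m - Q ^ n"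
      by (simp add: right_diff_distrib QP)
    ultimately have "l2_norm I y \<le> \<rho> * l2_norm I y
        + l2_norm I (\<lambda>i. op_cpoly A (Q ^ m) x i - op_cpoly A (Q ^ n) x i)"
      using Qn[OF y] by (simp add: op_cpoly_diff)
    also have "\<dots> \<le> \<rho> * l2_norm I y + (\<rho> ^ m * l2_norm I x + \<rho> ^ n * l2_norm I x)"
      using l2_norm_diff_le[OF mem[OF x] mem[OF x], of "Q ^ m" "Q ^ n"] Qpow[OF x, of m] Qpow[OF x, of n] by linarith
    finally show ?thesis by (simp add: y_def op_cpoly_diff algebra_simps)
  qed
  have pow0: "\<exists>N. \<forall>n\<ge>N. \<rho> ^ n \<le> e" if "e > 0" for e
  proof -
    have "(\<lambda>n. \<rho> ^ n) \<longlonglongrightarrow> 0" using \<rho> by (intro LIMSEQ_realpow_zero) auto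
    then have "\<forall>\<^sub>F n in sequentially. \<rho> ^ n < e" using that by (rule order_tendstoD)
    then show ?thesis by (auto simp: eventually_sequentially intro: less_imp_le)
  qed
  have "\<exists>C\<in>bounded_ops I. \<forall>e>0. \<exists>N. \<forall>n\<ge>N. \<forall>x\<in>l2 I.
      l2_norm I (\<lambda>i. op_cpoly A (P n) x i - C x i) \<le> e * l2_norm I x"
  proof (rule bounded_ops_complete)
    show "\<exists>K. l2_bounded_by I (op_cpoly A (P n)) K" for n using op_cpoly_bounded[OF KA] by blast
    fix e :: real assume e: "e > 0"
    have "e * (1 - \<rho>) / 2 > 0" using e \<rho> by simp
    from pow0[OF this] obtain N where N: "\<forall>n\<ge>N. \<rho> ^ n \<le> e * (1 - \<rho>) / 2" by blast
    have "l2_norm I (\<lambda>i. op_cpoly A (P n) x i - op_cpoly A (P m) x i) \<le> e * l2_norm I x"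
      if "n \<ge> N" "m \<ge> N" "x \<in> l2 I" for n m x
    proof -
      have "\<rho> ^ m + \<rho> ^ n \<le> e * (1 - \<rho>)" using N[rule_format, OF that(1)] N[rule_format, OF that(2)] by (simp add: field_simps)
      then have "(\<rho> ^ m + \<rho> ^ n) * l2_norm I x \<le> e * (1 - \<rho>) * l2_norm I x"
        by (rule mult_right_mono) simp
      with key[OF that(3), of n m]
      have "(1 - \<rho>) * l2_norm I (\<lambda>i. op_cpoly A (P n) x i - op_cpoly A (P m) x i) \<le> (1 - \<rho>) * (e * l2_norm I x)"
        by (simp add: mult_ac)
      then show ?thesis using \<rho> by simp
    qed
    then show "\<exists>N. \<forall>n\<ge>N. \<forall>m\<ge>N. \<forall>x\<in>l2 I.
        l2_norm I (\<lambda>i. op_cpoly A (P n) x i - op_cpoly A (P m) x i) \<le> e * l2_norm I x" by blast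
  qed
  then obtain C where C: "C \<in> bounded_ops I"
    "\<And>e. e > 0 \<Longrightarrow> \<exists>N. \<forall>n\<ge>N. \<forall>x\<in>l2 I. l2_norm I (\<lambda>i. op_cpoly A (P n) x i - C x i) \<le> e * l2_norm I x"
    by blast
  obtain KC where KC: "l2_bounded_by I C KC" using bounded_opsD[OF C(1)] by metis
  obtain KU where KU: "l2_bounded_by I (op_cpoly A (1 - Q)) KU" "KU \<ge> 0"
    using op_cpoly_bounded[OF KA] by blast
  have Ux: "op_cpoly A (1 - Q) x = (\<lambda>i. - 1 / d * (A x i - z * x i))" if "x \<in> l2 I" for x
    using that d by (simp add: op_cpoly_diff op_cpoly_1 Qx fun_eq_iff field_simps d_def)
  \<comment> \<open>\<open>C\<close> is known only as the limit of \<open>P n\<close>. Both inverse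
    identities come from \<open>(1 - Q) P n = 1 - Q ^ n\<close>, with n so large that
    \<open>P n\<close> is close to \<open>C\<close> and \<open>Q ^ n\<close> is close to 0.\<close>
  have UC: "op_cpoly A (1 - Q) (C x) = x" if x: "x \<in> l2 I" for x
  proof (rule l2_eqI_epsilon[where c = "(KU + 1) * l2_norm I x"])
    note Cx = l2b_mem[OF KC x]
    show "op_cpoly A (1 - Q) (C x) \<in> l2 I" "x \<in> l2 I" using mem Cx x by auto
    fix e :: real assume e: "e > 0"
    obtain N where N: "\<forall>n\<ge>N. \<forall>x\<in>l2 I. l2_norm I (\<lambda>i. op_cpoly A (P n) x i - C x i) \<le> e * l2_norm I x"
      using C(2)[OF e] by blast
    obtain M where M: "\<forall>n\<ge>M. \<rho> ^ n \<le> e" using pow0[OF e] by blast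
    define n where "n = max N M"
    have 1: "op_cpoly A (1 - Q) (op_cpoly A (P n) x) = (\<lambda>i. x i - op_cpoly A (Q ^ n) x i)"
      using mult[OF x, of "1 - Q" "P n"] by (simp add: QP op_cpoly_diff op_cpoly_1)
    have "l2_norm I (\<lambda>i. op_cpoly A (1 - Q) (C x) i - op_cpoly A (1 - Q) (op_cpoly A (P n) x) i)
        \<le> KU * l2_norm I (\<lambda>i. C x i - op_cpoly A (P n) x i)"
      using l2b_norm[OF KU(1) l2_diff[OF Cx mem[OF x]], of "P n"] by (simp add: l2b_diff[OF KU(1) Cx mem[OF x]])
    also have "\<dots> \<le> KU * (e * l2_norm I x)"
      using N x KU(2) by (intro mult_left_mono) (auto simp: l2_norm_minus_commute[of I "C x"] n_def)
    finally have 2: "l2_norm I (\<lambda>i. op_cpoly A (1 - Q) (C x) i - op_cpoly A (1 - Q) (op_cpoly A (P n) x) i)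
        \<le> KU * (e * l2_norm I x)" .
    have "l2_norm I (op_cpoly A (Q ^ n) x) \<le> e * l2_norm I x"
      using Qpow[OF x, of n] mult_right_mono[of "\<rho> ^ n" e "l2_norm I x"] M by (simp add: n_def)
    then have 3: "l2_norm I (\<lambda>i. op_cpoly A (1 - Q) (op_cpoly A (P n) x) i - x i) \<le> e * l2_norm I x"
      unfolding l2_norm_minus_commute[of I _ x] 1 by simp
    show "l2_norm I (\<lambda>i. op_cpoly A (1 - Q) (C x) i - x i) \<le> e * ((KU + 1) * l2_norm I x)"
      using l2_norm_diff_triangle[OF mem[OF Cx] mem[OF mem[OF x]] x, of "1 - Q" "1 - Q" "P n"] 2 3
      by (simp add: algebra_simps)
  qed
  have CU: "C (op_cpoly A (1 - Q) x) = x" if x: "x \<in> l2 I" for x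
  proof (rule l2_eqI_epsilon[where c = "l2_norm I (op_cpoly A (1 - Q) x) + l2_norm I x"])
    let ?u = "op_cpoly A (1 - Q) x"
    have u: "?u \<in> l2 I" using mem[OF x] .
    note Cu = l2b_mem[OF KC u]
    show "C ?u \<in> l2 I" "x \<in> l2 I" using Cu x by auto
    fix e :: real assume e: "e > 0"
    obtain N where N: "\<forall>n\<ge>N. \<forall>x\<in>l2 I. l2_norm I (\<lambda>i. op_cpoly A (P n) x i - C x i) \<le> e * l2_norm I x"
      using C(2)[OF e] by blast
    obtain M where M: "\<forall>n\<ge>M. \<rho> ^ n \<le> e" using pow0[OF e] by blast
    define n where "n = max N M"
    have 1: "op_cpoly A (P n) ?u = (\<lambda>i. x i - op_cpoly A (Q ^ n) x i)"
      using mult[OF x, of "P n" "1 - Q"] by (simp add: mult.commute[of "P n"] QP op_cpoly_diff op_cpoly_1)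
    have 2: "l2_norm I (\<lambda>i. C ?u i - op_cpoly A (P n) ?u i) \<le> e * l2_norm I ?u"
      using N u by (subst l2_norm_minus_commute) (auto simp: n_def)
    have "l2_norm I (op_cpoly A (Q ^ n) x) \<le> e * l2_norm I x"
      using Qpow[OF x, of n] mult_right_mono[of "\<rho> ^ n" e "l2_norm I x"] M by (simp add: n_def)
    then have 3: "l2_norm I (\<lambda>i. op_cpoly A (P n) ?u i - x i) \<le> e * l2_norm I x"
      unfolding l2_norm_minus_commute[of I _ x] 1 by simp
    show "l2_norm I (\<lambda>i. C ?u i - x i) \<le> e * (l2_norm I ?u + l2_norm I x)"
      using l2_norm_diff_triangle[OF Cu mem[OF u] x, of "P n"] 2 3
      by (simp add: algebra_simps)
  qed
  \<comment> \<open>Since \<open>A - z = - d (1 - Q)\<close> and \<open>C\<close> inverts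
    \<open>1 - Q\<close>, the inverse carries the factor \<open>- 1 / d\<close>.\<close>
  define D where "D = (\<lambda>x\<in>l2 I. \<lambda>i. - 1 / d * C x i)"
  have "D \<in> bounded_ops I"
    unfolding D_def using bounded_ops_restrict[OF l2b_lincomb[OF KC KC, of "- 1 / d" 0]] by simp
  moreover have "op_add_scalar I A (- z) \<in> bounded_ops I"
    unfolding op_add_scalar_def using bounded_ops_restrict[OF l2b_lincomb[OF KA l2b_id, of 1 "- z"]] by simp
  moreover have "op_mult I (op_add_scalar I A (- z)) D = op_id I"
  proof -
    have "(\<lambda>i. A (\<lambda>i. - 1 / d * C x i) i - z * (- 1 / d * C x i)) = x" if x: "x \<in> l2 I" for x
      using UC[OF x] unfolding Ux[OF l2b_mem[OF KC x]] l2b_scale[OF KA l2b_mem[OF KC x]]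
      by (simp add: fun_eq_iff algebra_simps)
    moreover have "(\<lambda>i. - 1 / d * C x i) \<in> l2 I" if "x \<in> l2 I" for x
      by (intro l2_scale l2b_mem[OF KC] that)
    ultimately show ?thesis
      by (auto simp: op_mult_def compose_def op_add_scalar_def op_id_def D_def fun_eq_iff
          intro!: restrict_ext)
  qed
  moreover have "op_mult I D (op_add_scalar I A (- z)) = op_id I"
  proof -
    have "(\<lambda>i. - 1 / d * C (\<lambda>i. A x i - z * x i) i) = x" if x: "x \<in> l2 I" for x
    proof -
      have m: "(\<lambda>i. A x i - z * x i) \<in> l2 I" by (intro l2_diff l2_scale l2b_mem[OF KA] x)
      show ?thesis using CU[OF x] unfolding Ux[OF x] l2b_scale[OF KC m] .
    qed
    moreover have "(\<lambda>i. A x i - z * x i) \<in> l2 I" if "x \<in> l2 I" for x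
      by (intro l2_diff l2_scale l2b_mem[OF KA] that)
    ultimately show ?thesis
      by (auto simp: op_mult_def compose_def op_add_scalar_def op_id_def D_def fun_eq_iff
          intro!: restrict_ext)
  qed
  ultimately show ?thesis by (auto simp: op_spectrum_def op_invertible_in_def)
qed


section \<open>Self-adjoint operators\<close>

definition op_selfadj :: "'a set \<Rightarrow> 'a op \<Rightarrow> bool" where
  "op_selfadj I T \<longleftrightarrow> (\<forall>x\<in>l2 I. \<forall>y\<in>l2 I. l2_inner I (T x) y = l2_inner I x (T y))"

text \<open>The approximate point spectrum. Being bounded below is inherited by products, with
  constants multiplying, so the failure for a product can be traced to one factor.\<close>

definition approx_spectrum :: "'a set \<Rightarrow> 'a op \<Rightarrow> complex set" where
  "approx_spectrum I T = {z. \<not> (\<exists>\<delta>>0. \<forall>x\<in>l2 I. \<delta> * l2_norm I x \<le> l2_norm I (\<lambda>i. T x i - z * x i))}"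

lemma approx_spectrum_subset: "T \<in> bounded_ops I \<Longrightarrow> approx_spectrum I T \<subseteq> op_spectrum I T"
  unfolding approx_spectrum_def using spectrum_if_not_bounded_below by blast

lemma op_selfadjD:
  "op_selfadj I T \<Longrightarrow> x \<in> l2 I \<Longrightarrow> y \<in> l2 I \<Longrightarrow> l2_inner I (T x) y = l2_inner I x (T y)"
  by (simp add: op_selfadj_def)

lemma selfadj_inner_real:
  assumes "op_selfadj I T" "x \<in> l2 I"
  shows "Im (l2_inner I (T x) x) = 0"
  using arg_cong[where f = Im, OF l2_inner_cnj[of I "T x" x]] op_selfadjD[OF assms assms(2)] by simp

text \<open>The form of \<open>T\<close> is real, so the imaginary part of the form of
  \<open>T - z\<close> at x has modulus \<open>\<bar>Im z\<bar>\<close> times the squared norm of x.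
  By Cauchy-Schwarz, \<open>T - z\<close> is bounded below by
  \<open>\<bar>Im z\<bar>\<close>.\<close>

lemma approx_spectrum_real:
  assumes T: "l2_bounded_by I T K" and sa: "op_selfadj I T" and z: "z \<in> approx_spectrum I T"
  shows "z = complex_of_real (Re z)"
proof (rule ccontr)
  assume "z \<noteq> complex_of_real (Re z)"
  then have im: "Im z \<noteq> 0" by (simp add: complex_eq_iff)
  have "\<bar>Im z\<bar> * l2_norm I x \<le> l2_norm I (\<lambda>i. T x i - z * x i)" if x: "x \<in> l2 I" for x
  proof (cases "l2_norm I x = 0")
    case False
    let ?u = "\<lambda>i. T x i - z * x i"
    have u: "?u \<in> l2 I" by (intro l2_diff l2_scale l2b_mem[OF T] x)
    have "l2_inner I ?u x = l2_inner I (T x) x - z * complex_of_real ((l2_norm I x)\<^sup>2)"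
      using x by (simp add: l2_inner_diff_left l2b_mem[OF T] l2_scale l2_inner_scale_left l2_inner_self)
    then have "\<bar>Im (l2_inner I ?u x)\<bar> = \<bar>Im z\<bar> * (l2_norm I x)\<^sup>2"
      using selfadj_inner_real[OF sa x] by (simp add: abs_mult)
    then have "\<bar>Im z\<bar> * (l2_norm I x)\<^sup>2 \<le> l2_norm I ?u * l2_norm I x"
      using abs_Im_le_cmod[of "l2_inner I ?u x"] l2_Cauchy_Schwarz[OF u x] by linarith
    then show ?thesis using False l2_norm_nonneg[of I x] by (simp add: power2_eq_square less_le)
  qed simp
  moreover have "\<bar>Im z\<bar> > 0" using im by simp
  ultimately show False using z unfolding approx_spectrum_def by blast
qed

section \<open>Operator norm, and lower bounds for polynomials in an operator\<close>

lemma op_norm_bdd_above: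
  assumes A: "l2_bounded_by I A K"
  shows "bdd_above ((\<lambda>x. l2_norm I (A x)) ` {x \<in> l2 I. l2_norm I x \<le> 1})"
proof (rule bdd_aboveI2)
  fix x assume "x \<in> {x \<in> l2 I. l2_norm I x \<le> 1}"
  then have x: "x \<in> l2 I" "l2_norm I x \<le> 1" by auto
  have "l2_norm I (A x) \<le> K * l2_norm I x" by (rule l2b_norm[OF A x(1)])
  also have "\<dots> \<le> \<bar>K\<bar> * 1" using x by (intro mult_mono) auto
  finally show "l2_norm I (A x) \<le> \<bar>K\<bar>" by simp
qed

lemma op_norm_bound:
  assumes A: "l2_bounded_by I A K" and x: "x \<in> l2 I"
  shows "l2_norm I (A x) \<le> op_norm I A * l2_norm I x"
proof (cases "l2_norm I x = 0")
  case True
  then show ?thesis using l2b_norm[OF A x] by simp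
next
  case False
  define c where "c = 1 / l2_norm I x"
  have c: "c > 0" using False l2_norm_nonneg[of I x] by (simp add: c_def less_le)
  let ?y = "\<lambda>i. complex_of_real c * x i"
  have y: "?y \<in> l2 I" "l2_norm I ?y \<le> 1"
    using c False l2_scale[OF x, of c] unfolding l2_norm_scale by (auto simp: c_def norm_divide)
  have "l2_norm I (A ?y) \<le> op_norm I A"
    unfolding op_norm_def using y by (intro cSUP_upper op_norm_bdd_above[OF A]) auto
  then have "c * l2_norm I (A x) \<le> op_norm I A"
    using c by (simp add: l2b_scale[OF A x] l2_norm_scale)
  then show ?thesis using c by (simp add: c_def field_simps)
qed

lemma op_norm_le:
  assumes "\<And>x. x \<in> l2 I \<Longrightarrow> l2_norm I (A x) \<le> K * l2_norm I x" "K \<ge> 0"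
  shows "op_norm I A \<le> K"
  unfolding op_norm_def
proof (rule cSUP_least)
  show "{x \<in> l2 I. l2_norm I x \<le> 1} \<noteq> {}" using l2_zero by fastforce
  fix x assume "x \<in> {x \<in> l2 I. l2_norm I x \<le> 1}"
  then have x: "x \<in> l2 I" "l2_norm I x \<le> 1" by auto
  show "l2_norm I (A x) \<le> K" using assms(1)[OF x(1)] mult_left_mono[OF x(2) assms(2)] by simp
qed

lemma op_norm_nonneg:
  assumes "l2_bounded_by I A K"
  shows "op_norm I A \<ge> 0"
proof -
  have "l2_norm I (A (\<lambda>i. 0)) \<le> op_norm I A"
    unfolding op_norm_def by (rule cSUP_upper[OF _ op_norm_bdd_above[OF assms]]) simp
  then show ?thesis using l2_norm_nonneg order_trans by blast
qed

lemma l2_exists_nonzero: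
  assumes "I \<noteq> {}"
  obtains x where "x \<in> l2 I" "l2_norm I x > 0"
proof -
  obtain i where i: "i \<in> I" using assms by blast
  define x :: "'a \<Rightarrow> complex" where "x = (\<lambda>j. if j = i then 1 else 0)"
  have "finite {j \<in> I. (cmod (x j))\<^sup>2 \<noteq> 0}"
    by (rule finite_subset[of _ "{i}"]) (auto simp: x_def)
  then have x: "x \<in> l2 I"
    using i by (auto simp: l2_def x_def intro: finite_nonzero_values_imp_summable_on)
  moreover have "l2_norm I x \<noteq> 0"
    using l2_norm_eq_0_iff[OF x] by (auto simp: x_def fun_eq_iff)
  ultimately show ?thesis using that l2_norm_nonneg[of I x] by (simp add: less_le)
qed

text \<open>
  With \<open>M = \<parallel>S\<parallel>\<close>, expanding \<open>\<parallel>S\<^sup>2x - M\<^sup>2x\<parallel>\<^sup>2\<close> shows that a lower bound for \<open>S\<^sup>2 - M\<^sup>2\<close>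
  would improve the norm of \<open>S\<close>.
\<close>

lemma selfadj_norm_attained:
  assumes S: "l2_bounded_by I S K" and sa: "op_selfadj I S" and I: "I \<noteq> {}"
  shows "\<not> (\<exists>\<delta>>0. \<forall>x\<in>l2 I. \<delta> * l2_norm I x \<le>
    l2_norm I (\<lambda>i. S (S x) i - complex_of_real ((op_norm I S)\<^sup>2) * x i))"
proof
  define M where "M = op_norm I S"
  assume "\<exists>\<delta>>0. \<forall>x\<in>l2 I. \<delta> * l2_norm I x \<le>
    l2_norm I (\<lambda>i. S (S x) i - complex_of_real ((op_norm I S)\<^sup>2) * x i)"
  then obtain \<delta> where \<delta>: "\<delta> > 0" "\<And>x. x \<in> l2 I \<Longrightarrow> \<delta> * l2_norm I x \<le>
    l2_norm I (\<lambda>i. S (S x) i - complex_of_real (M\<^sup>2) * x i)"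
    unfolding M_def by blast
  have M0: "M \<ge> 0" unfolding M_def by (rule op_norm_nonneg[OF S])
  have Mb: "l2_norm I (S x) \<le> M * l2_norm I x" if "x \<in> l2 I" for x
    unfolding M_def by (rule op_norm_bound[OF S that])
  have ineq: "M\<^sup>2 * (l2_norm I (S x))\<^sup>2 \<le> (M ^ 4 - \<delta>\<^sup>2) * (l2_norm I x)\<^sup>2" if x: "x \<in> l2 I" for x
  proof -
    note Sx = l2b_mem[OF S x]
    note SSx = l2b_mem[OF S Sx]
    have "(\<delta> * l2_norm I x)\<^sup>2 \<le> (l2_norm I (\<lambda>i. S (S x) i - complex_of_real (M\<^sup>2) * x i))\<^sup>2"
      using \<delta> x by (intro power_mono) auto
    also have "\<dots> = (l2_norm I (S (S x)))\<^sup>2 - 2 * Re (l2_inner I (S (S x)) (\<lambda>i. complex_of_real (M\<^sup>2) * x i))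
        + (l2_norm I (\<lambda>i. complex_of_real (M\<^sup>2) * x i))\<^sup>2"
      by (rule l2_norm_diff_square[OF SSx l2_scale[OF x]])
    also have "l2_inner I (S (S x)) (\<lambda>i. complex_of_real (M\<^sup>2) * x i) = complex_of_real (M\<^sup>2 * (l2_norm I (S x))\<^sup>2)"
      using l2_inner_self[OF Sx] by (simp add: l2_inner_scale_right op_selfadjD[OF sa Sx x])
    also have "l2_norm I (\<lambda>i. complex_of_real (M\<^sup>2) * x i) = M\<^sup>2 * l2_norm I x"
      by (simp add: l2_norm_scale norm_power)
    finally have "\<delta>\<^sup>2 * (l2_norm I x)\<^sup>2 \<le> (l2_norm I (S (S x)))\<^sup>2 - 2 * (M\<^sup>2 * (l2_norm I (S x))\<^sup>2)
        + M ^ 4 * (l2_norm I x)\<^sup>2"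
      by (simp add: power_mult_distrib flip: power_mult)
    moreover have "(l2_norm I (S (S x)))\<^sup>2 \<le> M\<^sup>2 * (l2_norm I (S x))\<^sup>2"
      using power_mono[OF Mb[OF Sx], of 2] by (simp add: power_mult_distrib)
    ultimately show ?thesis by (simp add: algebra_simps)
  qed
  obtain x where x: "x \<in> l2 I" "l2_norm I x > 0" using l2_exists_nonzero[OF I] .
  have "0 \<le> (M ^ 4 - \<delta>\<^sup>2) * (l2_norm I x)\<^sup>2"
    using ineq[OF x(1)] by (rule order_trans[rotated]) simp
  then have nn: "M ^ 4 - \<delta>\<^sup>2 \<ge> 0" using x(2) by (simp add: zero_le_mult_iff)
  then have "M \<noteq> 0" using \<delta>(1) by auto
  then have M: "M > 0" using M0 by simp
  \<comment> \<open>The improved bound for \<open>S\<close>: it is smaller than \<open>M\<close>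
    because \<open>\<delta>\<close> is positive, which contradicts the minimality of the operator
    norm. Division by \<open>M\<close> is allowed, since \<open>M ^ 4\<close> is at least
    \<open>\<delta>\<^sup>2\<close>.\<close>
  define L where "L = sqrt ((M ^ 4 - \<delta>\<^sup>2) / M\<^sup>2)"
  have L0: "L \<ge> 0" using nn by (simp add: L_def)
  have "l2_norm I (S x) \<le> L * l2_norm I x" if x: "x \<in> l2 I" for x
  proof (rule power2_le_imp_le)
    have "(l2_norm I (S x))\<^sup>2 \<le> (M ^ 4 - \<delta>\<^sup>2) / M\<^sup>2 * (l2_norm I x)\<^sup>2"
      using ineq[OF x] M by (simp add: field_simps)
    then show "(l2_norm I (S x))\<^sup>2 \<le> (L * l2_norm I x)\<^sup>2"
      using nn by (simp add: L_def power_mult_distrib)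
  qed (use L0 in simp)
  then have "M \<le> L" unfolding M_def using L0 by (rule op_norm_le)
  then have "M\<^sup>2 \<le> (M ^ 4 - \<delta>\<^sup>2) / M\<^sup>2"
    using M nn power_mono[of M L 2] by (simp add: L_def)
  then have "M ^ 4 \<le> M ^ 4 - \<delta>\<^sup>2"
    using M by (simp add: field_simps flip: power_add)
  then show False using \<delta>(1) by simp
qed

text \<open>Induction on the degree: a complex root z is split off as the left factor,
  \<open>T - z\<close> is bounded below because z avoids the approximate spectrum, and the lower
  bounds multiply.\<close>

lemma op_cpoly_bounded_below:
  assumes T: "l2_bounded_by I T K"
  shows "q \<noteq> 0 \<Longrightarrow> \<forall>z. poly q z = 0 \<longrightarrow> z \<notin> approx_spectrum I T \<Longrightarrow>
    \<exists>\<delta>>0. \<forall>x\<in>l2 I. \<delta> * l2_norm I x \<le> l2_norm I (op_cpoly T q x)"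
proof (induction "degree q" arbitrary: q)
  case 0
  then obtain c where q: "q = [:c:]" using degree_eq_zeroE by metis
  then have "cmod c > 0" using 0 by simp
  then show ?case by (intro exI[of _ "cmod c"]) (simp add: q op_cpoly_const l2_norm_scale)
next
  case (Suc n)
  obtain z where z: "poly q z = 0" using alg_closed_imp_poly_has_root[of q] Suc.hyps(2) by auto
  then obtain r where r: "q = [:- z, 1:] * r" using poly_eq_0_iff_dvd by (metis dvdE)
  have "r \<noteq> 0" using r Suc.prems(1) by auto
  moreover have "n = degree r"
    using Suc.hyps(2) \<open>r \<noteq> 0\<close> unfolding r by (subst (asm) degree_mult_eq) auto
  ultimately obtain \<delta>1 where \<delta>1: "\<delta>1 > 0" "\<And>x. x \<in> l2 I \<Longrightarrow> \<delta>1 * l2_norm I x \<le> l2_norm I (op_cpoly T r x)"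
    using Suc.hyps(1)[of r] Suc.prems(2) by (auto simp: r)
  obtain \<delta>2 where \<delta>2: "\<delta>2 > 0" "\<And>x. x \<in> l2 I \<Longrightarrow> \<delta>2 * l2_norm I x \<le> l2_norm I (\<lambda>i. T x i - z * x i)"
    using Suc.prems(2) z unfolding approx_spectrum_def by blast
  have "\<delta>2 * \<delta>1 * l2_norm I x \<le> l2_norm I (op_cpoly T q x)" if x: "x \<in> l2 I" for x
  proof -
    note m = op_cpoly_mem[OF T x, of r]
    have "\<delta>2 * (\<delta>1 * l2_norm I x) \<le> \<delta>2 * l2_norm I (op_cpoly T r x)"
      using \<delta>1(2)[OF x] \<delta>2(1) by simp
    also have "\<dots> \<le> l2_norm I (\<lambda>i. T (op_cpoly T r x) i - z * op_cpoly T r x i)"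
      by (rule \<delta>2(2)[OF m])
    also have "(\<lambda>i. T (op_cpoly T r x) i - z * op_cpoly T r x i) = op_cpoly T q x"
      by (simp only: r op_cpoly_mult[OF T x] op_cpoly_pCons[OF T m])
        (simp add: op_cpoly_0 l2b_zero[OF T])
    finally show ?thesis by (simp add: mult.assoc)
  qed
  then show ?case using \<delta>1(1) \<delta>2(1) by (intro exI[of _ "\<delta>2 * \<delta>1"]) simp
qed

section \<open>Real polynomials in a self-adjoint operator and their norms\<close>

abbreviation cpoly_of :: "real poly \<Rightarrow> complex poly" where
  "cpoly_of p \<equiv> map_poly complex_of_real p"

lemma cpoly_of_diff: "cpoly_of (p - q) = cpoly_of p - cpoly_of q"
  by (rule poly_eqI) (simp add: coeff_map_poly)

lemma cpoly_of_add: "cpoly_of (p + q) = cpoly_of p + cpoly_of q"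
  by (rule poly_eqI) (simp add: coeff_map_poly)

lemma cpoly_of_mult: "cpoly_of (p * q) = cpoly_of p * cpoly_of q"
  by (rule poly_eqI) (simp add: coeff_map_poly coeff_mult)

lemma cpoly_of_pcompose: "cpoly_of (pcompose p q) = pcompose (cpoly_of p) (cpoly_of q)"
  by (induction p) (simp_all add: pcompose_pCons cpoly_of_add cpoly_of_mult map_poly_pCons)

lemma poly_cpoly_of: "poly (cpoly_of p) (complex_of_real t) = complex_of_real (poly p t)"
  by (induction p) (simp_all add: map_poly_pCons)

text \<open>Real coefficients leave the inner product unconjugated, and \<open>T\<close> commutes
  with every polynomial in \<open>T\<close>, so \<open>T p(T)\<close> inherits self-adjointness from
  its factors.\<close>

lemma selfadj_op_cpoly:
  assumes T: "l2_bounded_by I T K" and sa: "op_selfadj I T"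
  shows "op_selfadj I (op_cpoly T (cpoly_of p))"
proof (induction p)
  case 0
  then show ?case by (simp add: op_selfadj_def op_cpoly_0 l2_inner_def)
next
  case (pCons a p)
  let ?P = "op_cpoly T (cpoly_of p)"
  have comm: "?P (T y) = T (?P y)" if y: "y \<in> l2 I" for y
  proof -
    have X: "op_cpoly T [:0, 1:] y = T y" if "y \<in> l2 I" for y
      using that by (simp add: op_cpoly_pCons[OF T] op_cpoly_const)
    have "?P (T y) = op_cpoly T (cpoly_of p * [:0, 1:]) y" using X[OF y] op_cpoly_mult[OF T y] by metis
    also have "\<dots> = T (?P y)"
      using X[OF op_cpoly_mem[OF T y]] op_cpoly_mult[OF T y] by (metis mult.commute)
    finally show ?thesis .
  qed
  have *: "op_cpoly T (cpoly_of (pCons a p)) x = (\<lambda>i. complex_of_real a * x i + T (?P x) i)"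
    if "x \<in> l2 I" for x
    using op_cpoly_pCons[OF T that] by (simp add: map_poly_pCons)
  show ?case
    unfolding op_selfadj_def
  proof (intro ballI)
    fix x y assume x: "x \<in> l2 I" and y: "y \<in> l2 I"
    note m = op_cpoly_mem[OF T] l2b_mem[OF T] l2_scale x y
    have "l2_inner I (T (?P x)) y = l2_inner I x (T (?P y))"
      using op_selfadjD[OF sa op_cpoly_mem[OF T x] y] op_selfadjD[OF pCons(2) x l2b_mem[OF T y]] comm[OF y] by simp
    then show "l2_inner I (op_cpoly T (cpoly_of (pCons a p)) x) y
        = l2_inner I x (op_cpoly T (cpoly_of (pCons a p)) y)"
      unfolding *[OF x] *[OF y]
      by (simp add: l2_inner_add_left l2_inner_add_right m l2_inner_scale_left l2_inner_scale_right)
  qed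
qed

text \<open>The root is delivered as a real number, because bounds on real polynomials are assumed
  only at real spectral points.\<close>

lemma approx_spectrum_root:
  assumes T: "l2_bounded_by I T K" and sa: "op_selfadj I T"
    and q: "\<not> (\<exists>\<delta>>0. \<forall>x\<in>l2 I. \<delta> * l2_norm I x \<le> l2_norm I (op_cpoly T q x))" "q \<noteq> 0"
  obtains t where "complex_of_real t \<in> approx_spectrum I T" "poly q (complex_of_real t) = 0"
  using op_cpoly_bounded_below[OF T q(2)] q(1) approx_spectrum_real[OF T sa] by metis

lemma op_cpoly_norm_le:
  assumes T: "l2_bounded_by I T K" and sa: "op_selfadj I T" and I: "I \<noteq> {}"
    and p: "\<And>t. complex_of_real t \<in> approx_spectrum I T \<Longrightarrow> \<bar>poly p t\<bar> \<le> e"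
    and x: "x \<in> l2 I"
  shows "l2_norm I (op_cpoly T (cpoly_of p) x) \<le> e * l2_norm I x"
proof -
  have square: "\<not> (\<exists>\<delta>>0. \<forall>x\<in>l2 I. \<delta> * l2_norm I x \<le>
      l2_norm I (op_cpoly T (cpoly_of r * cpoly_of r - [:complex_of_real ((op_norm I (op_cpoly T (cpoly_of r)))\<^sup>2):]) x))"
    for r
  proof -
    obtain L where L: "l2_bounded_by I (op_cpoly T (cpoly_of r)) L" using op_cpoly_bounded[OF T] by blast
    from selfadj_norm_attained[OF L selfadj_op_cpoly[OF T sa] I] show ?thesis
      by (simp add: op_cpoly_diff op_cpoly_const op_cpoly_mult[OF T] cong: ball_cong)
  qed
  \<comment> \<open>Applied to the polynomial X, the attained norm shows that the approximate
    spectrum is not empty. This settles the degenerate case \<open>q = 0\<close> below, where every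
    point is a root and one in the spectrum still has to be exhibited.\<close>
  obtain t0 where t0: "complex_of_real t0 \<in> approx_spectrum I T"
  proof (rule approx_spectrum_root[OF T sa square[of "[:0, 1:]"]])
    show "cpoly_of [:0, 1:] * cpoly_of [:0, 1:]
        - [:complex_of_real ((op_norm I (op_cpoly T (cpoly_of [:0, 1:])))\<^sup>2):] \<noteq> 0"
      by (simp add: map_poly_pCons)
  qed
  define M where "M = op_norm I (op_cpoly T (cpoly_of p))"
  obtain L where L: "l2_bounded_by I (op_cpoly T (cpoly_of p)) L" using op_cpoly_bounded[OF T] by blast
  define q where "q = cpoly_of p * cpoly_of p - [:complex_of_real (M\<^sup>2):]"
  obtain t where t: "complex_of_real t \<in> approx_spectrum I T" "poly q (complex_of_real t) = 0"
  proof (cases "q = 0")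
    case True
    then show ?thesis using that[OF t0] by simp
  next
    case False
    show ?thesis using approx_spectrum_root[OF T sa square[of p, folded M_def] False[unfolded q_def]] that unfolding q_def by blast
  qed
  from t(2) have "complex_of_real ((poly p t)\<^sup>2) = complex_of_real (M\<^sup>2)"
    by (simp add: q_def poly_cpoly_of power2_eq_square)
  then have "(poly p t)\<^sup>2 = M\<^sup>2" by (simp only: of_real_eq_iff)
  then have "\<bar>poly p t\<bar> = \<bar>M\<bar>" by (simp add: abs_eq_iff power2_eq_iff)
  then have "\<bar>poly p t\<bar> = M" using op_norm_nonneg[OF L] by (simp add: M_def)
  then have "M \<le> e" using p[OF t(1)] by simp
  then show ?thesis
    using op_norm_bound[OF L x] mult_right_mono[of M e "l2_norm I x"] by (simp add: M_def)
qed


section \<open>Continuous functional calculus\<close>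

text \<open>Self-adjoint with spectrum in [a, b], encoded as a norm bound around the midpoint with
  half the length as radius. This is the form in which the Neumann series applies.\<close>

definition op_between :: "'a set \<Rightarrow> 'a op \<Rightarrow> real \<Rightarrow> real \<Rightarrow> bool" where
  "op_between I T a b \<longleftrightarrow> T \<in> bounded_ops I \<and> op_selfadj I T \<and> a \<le> b \<and>
     (\<forall>x\<in>l2 I. l2_norm I (\<lambda>i. T x i - complex_of_real ((a + b) / 2) * x i) \<le> (b - a) / 2 * l2_norm I x)"

text \<open>A real point outside [a, b] is farther from the midpoint than the radius. Real points
  suffice, since \<open>op_cfc\<close> tests convergence only there.\<close>

lemma op_between_spectrum:
  assumes T: "op_between I T a b" and t: "complex_of_real t \<in> op_spectrum I T"
  shows "t \<in> {a..b}"
proof (rule ccontr)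
  assume "t \<notin> {a..b}"
  then have "\<bar>t - (a + b) / 2\<bar> > (b - a) / 2"
    using T by (auto simp: op_between_def abs_if field_simps)
  then have "cmod (complex_of_real t - complex_of_real ((a + b) / 2)) > (b - a) / 2"
    by (metis norm_of_real of_real_diff)
  from not_in_spectrum_Neumann[OF _ _ _ this] T t show False
    by (auto simp: op_between_def)
qed

text \<open>Bounds on the quadratic form locate the approximate spectrum in [a, b]; the polynomial
  norm bound for X minus the midpoint then turns this into the norm estimate of
  \<open>op_between\<close>.\<close>

lemma op_betweenI_form:
  assumes T: "T \<in> bounded_ops I" and sa: "op_selfadj I T" and I: "I \<noteq> {}"
    and form: "\<And>x. x \<in> l2 I \<Longrightarrow> a * (l2_norm I x)\<^sup>2 \<le> Re (l2_inner I (T x) x)"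
      "\<And>x. x \<in> l2 I \<Longrightarrow> Re (l2_inner I (T x) x) \<le> b * (l2_norm I x)\<^sup>2"
  shows "op_between I T a b"
proof -
  obtain K where K: "l2_bounded_by I T K" using bounded_opsD[OF T] by metis
  have spec: "t \<in> {a..b}" if t: "complex_of_real t \<in> approx_spectrum I T" for t
  proof (rule ccontr)
    assume out: "t \<notin> {a..b}"
    \<comment> \<open>The distance of \<open>t\<close> from [a, b]. One of the two form bounds keeps
      the form of \<open>T - t\<close> away from 0 by this factor, and Cauchy-Schwarz makes it a
      lower bound for \<open>T - t\<close>.\<close>
    define \<delta> where "\<delta> = max (a - t) (t - b)"
    have \<delta>: "\<delta> > 0" using out by (auto simp: \<delta>_def max_def)
    have "\<delta> * l2_norm I x \<le> l2_norm I (\<lambda>i. T x i - complex_of_real t * x i)" if x: "x \<in> l2 I" for x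
    proof (cases "l2_norm I x = 0")
      case False
      let ?u = "\<lambda>i. T x i - complex_of_real t * x i"
      have u: "?u \<in> l2 I" by (intro l2_diff l2_scale l2b_mem[OF K] x)
      have "Re (l2_inner I ?u x) = Re (l2_inner I (T x) x) - t * (l2_norm I x)\<^sup>2"
        using x by (simp add: l2_inner_diff_left l2b_mem[OF K] l2_scale l2_inner_scale_left l2_inner_self)
      then have "(a - t) * (l2_norm I x)\<^sup>2 \<le> \<bar>Re (l2_inner I ?u x)\<bar>"
        "(t - b) * (l2_norm I x)\<^sup>2 \<le> \<bar>Re (l2_inner I ?u x)\<bar>"
        using form[OF x] by (simp_all add: left_diff_distrib)
      then have "\<delta> * (l2_norm I x)\<^sup>2 \<le> \<bar>Re (l2_inner I ?u x)\<bar>" by (simp add: \<delta>_def max_def)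
      also have "\<dots> \<le> l2_norm I ?u * l2_norm I x"
        using abs_Re_le_cmod[of "l2_inner I ?u x"] l2_Cauchy_Schwarz[OF u x] by linarith
      finally show ?thesis using False l2_norm_nonneg[of I x] by (simp add: power2_eq_square less_le)
    qed simp
    then show False using t \<delta> unfolding approx_spectrum_def by blast
  qed
  obtain x where x: "x \<in> l2 I" "l2_norm I x > 0" using l2_exists_nonzero[OF I] .
  have "a * (l2_norm I x)\<^sup>2 \<le> b * (l2_norm I x)\<^sup>2" using form[OF x(1)] by linarith
  then have ab: "a \<le> b" using x(2) by simp
  have "l2_norm I (op_cpoly T (cpoly_of [:- ((a + b) / 2), 1:]) x) \<le> (b - a) / 2 * l2_norm I x"
    if x: "x \<in> l2 I" for x
  proof (rule op_cpoly_norm_le[OF K sa I _ x])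
    fix t assume "complex_of_real t \<in> approx_spectrum I T"
    from spec[OF this] show "\<bar>poly [:- ((a + b) / 2), 1:] t\<bar> \<le> (b - a) / 2"
      by (auto simp: abs_if field_simps)
  qed
  moreover have "op_cpoly T (cpoly_of [:- ((a + b) / 2), 1:]) x
      = (\<lambda>i. T x i - complex_of_real ((a + b) / 2) * x i)" if x: "x \<in> l2 I" for x
    using op_cpoly_pCons[OF K x, of "- complex_of_real ((a + b) / 2)" "[:1:]"] by (simp add: map_poly_pCons op_cpoly_1 op_cpoly_const)
  ultimately show ?thesis using T sa ab by (auto simp: op_between_def)
qed

lemma Weierstrass_poly:
  fixes h :: "real \<Rightarrow> real"
  assumes "continuous_on {a..b} h" "e > 0"
  shows "\<exists>p. \<forall>t\<in>{a..b}. \<bar>poly p t - h t\<bar> \<le> e"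
proof -
  obtain g where g: "real_polynomial_function g" "\<And>x. x \<in> {a..b} \<Longrightarrow> \<bar>h x - g x\<bar> < e"
    using Stone_Weierstrass_real_polynomial_function[OF compact_Icc assms] by blast
  obtain c n where "g = (\<lambda>x. \<Sum>i\<le>n. c i * x ^ i)"
    using g(1) real_polynomial_function_iff_sum by metis
  then have "g x = poly (\<Sum>i\<le>n. monom (c i) i) x" for x
    by (simp add: poly_sum poly_monom)
  then show ?thesis
    using g(2) by (intro exI[of _ "\<Sum>i\<le>n. monom (c i) i"]) (metis abs_minus_commute less_imp_le)
qed

lemma op_poly_eq: "x \<in> l2 I \<Longrightarrow> op_poly I p A x = op_cpoly A (cpoly_of p) x"
  by (simp add: op_poly_def op_cpoly_def degree_map_poly coeff_map_poly)

text \<open>Evaluates the definite description in \<open>op_cfc\<close>. The witness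
  \<open>C\<close> is the norm limit of \<open>P n\<close> at \<open>T\<close> for Weierstrass
  polynomials \<open>P n\<close> on [a, b]; self-adjointness passes to this limit. The approximation
  clause asks for closeness on [a, b], so that one polynomial can serve many operators.\<close>

lemma
  assumes T: "op_between I T a b" and I: "I \<noteq> {}" and h: "continuous_on {a..b} h"
  shows op_cfc_bounded: "op_cfc I T h \<in> bounded_ops I" (is ?A)
    and op_cfc_approx: "\<And>p e x. (\<And>t. t \<in> {a..b} \<Longrightarrow> \<bar>poly p t - h t\<bar> \<le> e) \<Longrightarrow> x \<in> l2 I \<Longrightarrow>
      l2_norm I (\<lambda>i. op_cpoly T (cpoly_of p) x i - op_cfc I T h x i) \<le> e * l2_norm I x"
    and op_cfc_selfadj: "op_selfadj I (op_cfc I T h)" (is ?C)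
proof -
  have bT: "T \<in> bounded_ops I" and sa: "op_selfadj I T" and ab: "a \<le> b"
    using T by (auto simp: op_between_def)
  obtain K where K: "l2_bounded_by I T K" using bounded_opsD[OF bT] by metis
  note mem = op_cpoly_mem[OF K]
  let ?spec = "{t. complex_of_real t \<in> op_spectrum I T}"
  have diff: "l2_norm I (\<lambda>i. op_cpoly T (cpoly_of p) x i - op_cpoly T (cpoly_of q) x i) \<le> e * l2_norm I x"
    if "\<And>t. t \<in> ?spec \<Longrightarrow> \<bar>poly p t - poly q t\<bar> \<le> e" "x \<in> l2 I" for p q e x
  proof -
    have "l2_norm I (op_cpoly T (cpoly_of (p - q)) x) \<le> e * l2_norm I x"
      by (rule op_cpoly_norm_le[OF K sa I _ that(2)]) (use that(1) approx_spectrum_subset[OF bT] in auto)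
    then show ?thesis by (simp add: cpoly_of_diff op_cpoly_diff)
  qed
  have spec: "t \<in> {a..b}" if "t \<in> ?spec" for t using op_between_spectrum[OF T] that by simp
  have "\<forall>n. \<exists>p. \<forall>t\<in>{a..b}. \<bar>poly p t - h t\<bar> \<le> 1 / real (Suc n)"
    by (intro allI Weierstrass_poly[OF h]) simp
  from choice[OF this] obtain P where P: "\<And>n t. t \<in> {a..b} \<Longrightarrow> \<bar>poly (P n) t - h t\<bar> \<le> 1 / real (Suc n)"
    by blast
  have small: "\<exists>N. \<forall>n\<ge>N. 1 / real (Suc n) \<le> e" if "e > 0" for e
  proof -
    have "\<forall>\<^sub>F n in sequentially. 1 / real (Suc n) < e"
      using that LIMSEQ_inverse_real_of_nat by (intro order_tendstoD(2)) (auto simp: inverse_eq_divide)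
    then show ?thesis by (auto simp: eventually_sequentially intro: less_imp_le)
  qed
  have "\<exists>C\<in>bounded_ops I. \<forall>e>0. \<exists>N. \<forall>n\<ge>N. \<forall>x\<in>l2 I.
      l2_norm I (\<lambda>i. op_cpoly T (cpoly_of (P n)) x i - C x i) \<le> e * l2_norm I x"
  proof (rule bounded_ops_complete)
    show "\<exists>K. l2_bounded_by I (op_cpoly T (cpoly_of (P n))) K" for n using op_cpoly_bounded[OF K] by blast
    fix e :: real assume e: "e > 0"
    then obtain N where N: "\<And>n. n \<ge> N \<Longrightarrow> 1 / real (Suc n) \<le> e / 2" using small[of "e / 2"] by auto
    have "\<bar>poly (P n) t - poly (P m) t\<bar> \<le> e" if "n \<ge> N" "m \<ge> N" "t \<in> ?spec" for n m t
      using P[OF spec[OF that(3)], of n] P[OF spec[OF that(3)], of m] N[OF that(1)] N[OF that(2)] by linarith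
    then show "\<exists>N. \<forall>n\<ge>N. \<forall>m\<ge>N. \<forall>x\<in>l2 I. l2_norm I
        (\<lambda>i. op_cpoly T (cpoly_of (P n)) x i - op_cpoly T (cpoly_of (P m)) x i) \<le> e * l2_norm I x"
      by (intro exI[of _ N] allI impI ballI diff)
  qed
  then obtain C where C: "C \<in> bounded_ops I"
    "\<And>e. e > 0 \<Longrightarrow> \<exists>N. \<forall>n\<ge>N. \<forall>x\<in>l2 I.
      l2_norm I (\<lambda>i. op_cpoly T (cpoly_of (P n)) x i - C x i) \<le> e * l2_norm I x" by blast
  obtain KC where KC: "l2_bounded_by I C KC" using bounded_opsD[OF C(1)] by metis
  \<comment> \<open>Closeness is assumed only on the spectrum, because the competing sequences in
    \<open>op_cfc\<close> are controlled nowhere else. The slack d pays for the two detours through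
    \<open>P n\<close>.\<close>
  have approx: "l2_norm I (\<lambda>i. op_cpoly T (cpoly_of p) x i - C x i) \<le> e * l2_norm I x"
    if p: "\<And>t. t \<in> ?spec \<Longrightarrow> \<bar>poly p t - h t\<bar> \<le> e" and x: "x \<in> l2 I" for p e x
  proof (rule field_le_epsilon)
    fix d :: real assume d: "d > 0"
    define d' where "d' = d / (2 * (l2_norm I x + 1))"
    have c: "l2_norm I x + 1 > 0" using l2_norm_nonneg[of I x] by linarith
    have d': "d' > 0" "2 * d' * l2_norm I x \<le> d" using d c by (auto simp: d'_def field_simps)
    obtain N where N: "\<forall>n\<ge>N. \<forall>x\<in>l2 I.
      l2_norm I (\<lambda>i. op_cpoly T (cpoly_of (P n)) x i - C x i) \<le> d' * l2_norm I x" using C(2)[OF d'(1)] by blast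
    obtain M where M: "\<forall>n\<ge>M. 1 / real (Suc n) \<le> d'" using small[OF d'(1)] by blast
    define n where "n = max N M"
    have n: "n \<ge> N" "1 / real (Suc n) \<le> d'" using M by (auto simp: n_def)
    have "\<bar>poly p t - poly (P n) t\<bar> \<le> e + d'" if "t \<in> ?spec" for t
      using p[OF that] P[OF spec[OF that], of n] n(2) by linarith
    from diff[OF this x]
    have "l2_norm I (\<lambda>i. op_cpoly T (cpoly_of p) x i - op_cpoly T (cpoly_of (P n)) x i) \<le> (e + d') * l2_norm I x" .
    then have "l2_norm I (\<lambda>i. op_cpoly T (cpoly_of p) x i - C x i) \<le> (e + d') * l2_norm I x + d' * l2_norm I x"
      using l2_norm_diff_triangle[OF mem[OF x] mem[OF x] l2b_mem[OF KC x], of "cpoly_of p" "cpoly_of (P n)"]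
        N[rule_format, OF n(1) x] by linarith
    then show "l2_norm I (\<lambda>i. op_cpoly T (cpoly_of p) x i - C x i) \<le> e * l2_norm I x + d"
      using d'(2) by (simp add: algebra_simps)
  qed
  have minus: "op_minus I (op_poly I p T) B x = (\<lambda>i. op_cpoly T (cpoly_of p) x i - B x i)" if "x \<in> l2 I" for p B x
    using that by (simp add: op_minus_def op_poly_eq)
  have minus_bounded: "\<exists>K. l2_bounded_by I (op_minus I (op_poly I p T) B) K" if "l2_bounded_by I B L" for p B L
  proof -
    obtain Kp where Kp: "l2_bounded_by I (op_cpoly T (cpoly_of p)) Kp" using op_cpoly_bounded[OF K] by blast
    from l2b_cong[OF l2b_lincomb[OF Kp that, of 1 "-1"], of "op_minus I (op_poly I p T) B"] show ?thesis
      by (auto simp: minus)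
  qed
  have C_lim: "(\<lambda>n. op_norm I (op_minus I (op_poly I (p n) T) C)) \<longlonglongrightarrow> 0"
    if p: "uniform_limit ?spec (\<lambda>n. poly (p n)) h sequentially" for p
  proof (rule LIMSEQ_I)
    fix e :: real assume e: "e > 0"
    then have "\<forall>\<^sub>F n in sequentially. \<forall>t\<in>?spec. dist (poly (p n) t) (h t) < e / 2"
      using p by (intro uniform_limitD) auto
    then obtain N where N: "\<And>n t. n \<ge> N \<Longrightarrow> t \<in> ?spec \<Longrightarrow> \<bar>poly (p n) t - h t\<bar> < e / 2"
      by (auto simp: eventually_sequentially dist_real_def)
    have "op_norm I (op_minus I (op_poly I (p n) T) C) \<le> e / 2" if n: "n \<ge> N" for n
    proof (rule op_norm_le)
      fix x assume x: "x \<in> l2 I"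
      show "l2_norm I (op_minus I (op_poly I (p n) T) C x) \<le> e / 2 * l2_norm I x"
        unfolding minus[OF x] by (rule approx[OF _ x]) (use N[OF n] in \<open>auto intro: less_imp_le\<close>)
    qed (use e in simp)
    moreover have "op_norm I (op_minus I (op_poly I (p n) T) C) \<ge> 0" for n
      using minus_bounded[OF KC] op_norm_nonneg by blast
    ultimately show "\<exists>N. \<forall>n\<ge>N. norm (op_norm I (op_minus I (op_poly I (p n) T) C) - 0) < e"
      using e by (intro exI[of _ N]) (fastforce simp: abs_of_nonneg)
  qed
  \<comment> \<open>\<open>P\<close> is itself an admissible sequence, since the real points of the
    spectrum lie in [a, b]; so \<open>B\<close> and \<open>C\<close> are limits of the same
    operators.\<close>
  have C_unique: "B = C"
    if B: "B \<in> bounded_ops I" "\<forall>p. uniform_limit ?spec (\<lambda>n. poly (p n)) h sequentially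
        \<longrightarrow> (\<lambda>n. op_norm I (op_minus I (op_poly I (p n) T) B)) \<longlonglongrightarrow> 0" for B
  proof (rule bounded_ops_eqI[OF B(1) C(1)])
    fix x assume x: "x \<in> l2 I"
    obtain KB where KB: "l2_bounded_by I B KB" using bounded_opsD[OF B(1)] by metis
    have "uniform_limit ?spec (\<lambda>n. poly (P n)) h sequentially"
    proof (rule uniform_limitI)
      fix e :: real assume e: "e > 0"
      obtain N where N: "\<forall>n\<ge>N. 1 / real (Suc n) \<le> e / 2" using small[of "e / 2"] e by auto
      have "dist (poly (P n) t) (h t) < e" if "n \<ge> N" "t \<in> ?spec" for n t
        using P[OF spec[OF that(2)], of n] N[rule_format, OF that(1)] e by (simp add: dist_real_def)
      then show "\<forall>\<^sub>F n in sequentially. \<forall>t\<in>?spec. dist (poly (P n) t) (h t) < e"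
        by (auto simp: eventually_sequentially)
    qed
    with B(2) have lim: "(\<lambda>n. op_norm I (op_minus I (op_poly I (P n) T) B)) \<longlonglongrightarrow> 0" by blast
    show "B x = C x"
    proof (rule l2_eqI_epsilon[where c = "2 * l2_norm I x"])
      show "B x \<in> l2 I" "C x \<in> l2 I" using l2b_mem[OF KB x] l2b_mem[OF KC x] by auto
      fix e :: real assume e: "e > 0"
      from order_tendstoD(2)[OF lim e] obtain N1 where
        N1: "\<And>n. n \<ge> N1 \<Longrightarrow> op_norm I (op_minus I (op_poly I (P n) T) B) < e"
        by (auto simp: eventually_sequentially)
      obtain N2 where N2: "\<forall>n\<ge>N2. \<forall>x\<in>l2 I.
        l2_norm I (\<lambda>i. op_cpoly T (cpoly_of (P n)) x i - C x i) \<le> e * l2_norm I x" using C(2)[OF e] by blast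
      define n where "n = max N1 N2"
      obtain L where L: "l2_bounded_by I (op_minus I (op_poly I (P n) T) B) L" using minus_bounded[OF KB] by blast
      have "l2_norm I (\<lambda>i. op_cpoly T (cpoly_of (P n)) x i - B x i)
          \<le> op_norm I (op_minus I (op_poly I (P n) T) B) * l2_norm I x"
        using op_norm_bound[OF L x] unfolding minus[OF x] .
      also have "\<dots> \<le> e * l2_norm I x"
        using N1[of n] by (intro mult_right_mono) (auto simp: n_def intro: less_imp_le)
      finally have "l2_norm I (\<lambda>i. B x i - op_cpoly T (cpoly_of (P n)) x i) \<le> e * l2_norm I x"
        by (subst l2_norm_minus_commute)
      moreover have "l2_norm I (\<lambda>i. op_cpoly T (cpoly_of (P n)) x i - C x i) \<le> e * l2_norm I x"
        using N2 x by (simp add: n_def)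
      ultimately show "l2_norm I (\<lambda>i. B x i - C x i) \<le> e * (2 * l2_norm I x)"
        using l2_norm_diff_triangle[OF l2b_mem[OF KB x] mem[OF x] l2b_mem[OF KC x], of "cpoly_of (P n)"]
        by (simp add: algebra_simps)
    qed
  qed
  have CE: "op_cfc I T h = C"
    unfolding op_cfc_def
  proof (rule the_equality)
    show "C \<in> bounded_ops I \<and> (\<forall>p. uniform_limit ?spec (\<lambda>n. poly (p n)) h sequentially
        \<longrightarrow> (\<lambda>n. op_norm I (op_minus I (op_poly I (p n) T) C)) \<longlonglongrightarrow> 0)"
      by (intro conjI allI impI C(1) C_lim)
  qed (elim conjE, rule C_unique)
  show ?A unfolding CE by (rule C(1))
  show "l2_norm I (\<lambda>i. op_cpoly T (cpoly_of p) x i - op_cfc I T h x i) \<le> e * l2_norm I x"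
    if "\<And>t. t \<in> {a..b} \<Longrightarrow> \<bar>poly p t - h t\<bar> \<le> e" "x \<in> l2 I" for p e x
    unfolding CE by (rule approx[OF _ that(2)]) (rule that(1)[OF spec])
  show ?C
    unfolding CE op_selfadj_def
  proof (intro ballI)
    fix x y assume x: "x \<in> l2 I" and y: "y \<in> l2 I"
    note m = l2b_mem[OF KC] mem x y
    have close: "cmod (l2_inner I (C x) y - l2_inner I x (C y)) \<le> 2 * e * (l2_norm I x * l2_norm I y)" if e: "e > 0" for e
    proof -
      obtain n where "\<forall>m\<ge>n. \<forall>x\<in>l2 I. l2_norm I (\<lambda>i. op_cpoly T (cpoly_of (P m)) x i - C x i) \<le> e * l2_norm I x"
        using C(2)[OF e] by blast
      then have n: "\<forall>x\<in>l2 I. l2_norm I (\<lambda>i. op_cpoly T (cpoly_of (P n)) x i - C x i) \<le> e * l2_norm I x"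
        by simp
      let ?p = "op_cpoly T (cpoly_of (P n))"
      have eq: "l2_inner I (C x) y - l2_inner I x (C y)
          = l2_inner I x (\<lambda>i. ?p y i - C y i) - l2_inner I (\<lambda>i. ?p x i - C x i) y"
        using op_selfadjD[OF selfadj_op_cpoly[OF K sa] x y, of "P n"]
        by (simp add: l2_inner_diff_left l2_inner_diff_right m)
      have "cmod (l2_inner I (C x) y - l2_inner I x (C y))
          \<le> l2_norm I x * l2_norm I (\<lambda>i. ?p y i - C y i) + l2_norm I (\<lambda>i. ?p x i - C x i) * l2_norm I y"
        unfolding eq by (rule order_trans[OF norm_triangle_ineq4 add_mono[OF l2_Cauchy_Schwarz l2_Cauchy_Schwarz]])
          (intro l2_diff m)+
      also have "\<dots> \<le> l2_norm I x * (e * l2_norm I y) + (e * l2_norm I x) * l2_norm I y"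
        using n x y by (intro add_mono mult_left_mono mult_right_mono) auto
      finally show ?thesis by (simp add: algebra_simps)
    qed
    have "cmod (l2_inner I (C x) y - l2_inner I x (C y)) \<le> 0 + d" if d: "d > 0" for d
    proof -
      define c where "c = l2_norm I x * l2_norm I y"
      have c: "c \<ge> 0" by (simp add: c_def)
      have "2 * (d / (2 * (c + 1))) * c \<le> d" using c d by (simp add: field_simps)
      moreover have "d / (2 * (c + 1)) > 0" using c d by simp
      ultimately show ?thesis using close[of "d / (2 * (c + 1))"] unfolding c_def[symmetric] by linarith
    qed
    then have "cmod (l2_inner I (C x) y - l2_inner I x (C y)) \<le> 0" by (rule field_le_epsilon)
    then show "l2_inner I (C x) y = l2_inner I x (C y)" by simp
  qed
qed

text \<open>\<open>L\<close> is chosen before \<open>Y\<close> and \<open>e\<close>, so a polynomial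
  can be fixed first and the precision of \<open>Y\<close> afterwards. In the step,
  \<open>X u - Y v\<close> is split at \<open>Y u\<close>: the first difference uses that
  \<open>X\<close> is close to \<open>Y\<close>, the second the common bound
  \<open>K\<close>.\<close>

lemma op_cpoly_lipschitz:
  assumes X: "l2_bounded_by I X K"
  shows "\<exists>L\<ge>0. \<forall>Y e. l2_bounded_by I Y K \<longrightarrow>
    (\<forall>x\<in>l2 I. l2_norm I (\<lambda>i. X x i - Y x i) \<le> e * l2_norm I x) \<longrightarrow> e \<ge> 0 \<longrightarrow>
    (\<forall>x\<in>l2 I. l2_norm I (\<lambda>i. op_cpoly X q x i - op_cpoly Y q x i) \<le> L * e * l2_norm I x)"
proof (induction q)
  case 0
  then show ?case by (intro exI[of _ 0]) (simp add: op_cpoly_0)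
next
  case (pCons a q)
  then obtain L where L: "L \<ge> 0" "\<And>Y e x. l2_bounded_by I Y K \<Longrightarrow>
    \<forall>x\<in>l2 I. l2_norm I (\<lambda>i. X x i - Y x i) \<le> e * l2_norm I x \<Longrightarrow> e \<ge> 0 \<Longrightarrow> x \<in> l2 I \<Longrightarrow>
    l2_norm I (\<lambda>i. op_cpoly X q x i - op_cpoly Y q x i) \<le> L * e * l2_norm I x" by blast
  obtain M where M: "l2_bounded_by I (op_cpoly X q) M" "M \<ge> 0" using op_cpoly_bounded[OF X] by blast
  show ?case
  proof (intro exI[of _ "M + \<bar>K\<bar> * L"] conjI allI impI ballI)
    fix Y e x
    assume Y: "l2_bounded_by I Y K" and e: "\<forall>x\<in>l2 I. l2_norm I (\<lambda>i. X x i - Y x i) \<le> e * l2_norm I x" "e \<ge> 0"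
      and x: "x \<in> l2 I"
    let ?u = "op_cpoly X q x" and ?v = "op_cpoly Y q x"
    have m: "?u \<in> l2 I" "?v \<in> l2 I" "X ?u \<in> l2 I" "Y ?u \<in> l2 I" "Y ?v \<in> l2 I"
      using op_cpoly_mem[OF X x] op_cpoly_mem[OF Y x] l2b_mem[OF X] l2b_mem[OF Y] by auto
    have "l2_norm I (\<lambda>i. X ?u i - Y ?u i) \<le> e * l2_norm I ?u" using e(1) m by blast
    also have "\<dots> \<le> e * (M * l2_norm I x)" using l2b_norm[OF M(1) x] e(2) by (intro mult_left_mono)
    finally have 1: "l2_norm I (\<lambda>i. X ?u i - Y ?u i) \<le> e * (M * l2_norm I x)" .
    have "l2_norm I (\<lambda>i. Y ?u i - Y ?v i) \<le> \<bar>K\<bar> * l2_norm I (\<lambda>i. ?u i - ?v i)"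
      using l2b_norm[OF l2b_mono[OF Y abs_ge_self] l2_diff[OF m(1,2)]] by (simp add: l2b_diff[OF Y m(1,2)])
    also have "\<dots> \<le> \<bar>K\<bar> * (L * e * l2_norm I x)" using L(2)[OF Y e x] by (intro mult_left_mono) auto
    finally have 2: "l2_norm I (\<lambda>i. Y ?u i - Y ?v i) \<le> \<bar>K\<bar> * (L * e * l2_norm I x)" .
    have "(\<lambda>i. op_cpoly X (pCons a q) x i - op_cpoly Y (pCons a q) x i) = (\<lambda>i. X ?u i - Y ?v i)"
      by (simp add: op_cpoly_pCons[OF X x] op_cpoly_pCons[OF Y x])
    then show "l2_norm I (\<lambda>i. op_cpoly X (pCons a q) x i - op_cpoly Y (pCons a q) x i)
        \<le> (M + \<bar>K\<bar> * L) * e * l2_norm I x"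
      using l2_norm_diff_triangle[OF m(3,4,5)] 1 2 by (simp add: algebra_simps)
  qed (use L(1) M(2) in simp)
qed

text \<open>Makes the outer calculus of a composition available. A polynomial e'-close to
  \<open>g\<close> differs from the midpoint \<open>m\<close> by at most
  \<open>(d - c) / 2 + e'\<close> on the spectrum; the norm bound applies, and e' is
  arbitrary.\<close>

lemma op_between_op_cfc:
  assumes T: "op_between I T a b" and I: "I \<noteq> {}" and g: "continuous_on {a..b} g"
    and gcd: "\<And>t. t \<in> {a..b} \<Longrightarrow> g t \<in> {c..d}"
  shows "op_between I (op_cfc I T g) c d"
proof -
  note C = op_cfc_bounded[OF T I g] and approx = op_cfc_approx[OF T I g]
  have sa: "op_selfadj I T" and ab: "a \<le> b" using T by (auto simp: op_between_def)
  then have cd: "c \<le> d" using gcd[of a] by auto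
  obtain K where K: "l2_bounded_by I T K" using T bounded_opsD by (metis op_between_def)
  obtain KC where KC: "l2_bounded_by I (op_cfc I T g) KC" using bounded_opsD[OF C] by metis
  define m where "m = (c + d) / 2"
  have "l2_norm I (\<lambda>i. op_cfc I T g x i - complex_of_real m * x i) \<le> (d - c) / 2 * l2_norm I x"
    if x: "x \<in> l2 I" for x
  proof (rule field_le_epsilon)
    fix e :: real assume e: "e > 0"
    define s where "s = l2_norm I x + 1"
    have s: "s > 0" using l2_norm_nonneg[of I x] unfolding s_def by linarith
    define e' where "e' = e / (2 * s)"
    have e': "e' > 0" "2 * e' * l2_norm I x \<le> e" using e s by (auto simp: e'_def s_def field_simps)
    obtain p where p: "\<And>t. t \<in> {a..b} \<Longrightarrow> \<bar>poly p t - g t\<bar> \<le> e'" using Weierstrass_poly[OF g e'(1)] by blast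
    have "\<bar>poly (p - [:m:]) t\<bar> \<le> (d - c) / 2 + e'" if "complex_of_real t \<in> approx_spectrum I T" for t
    proof -
      have "t \<in> {a..b}"
        using that approx_spectrum_subset[of T I] op_between_spectrum[OF T] T by (auto simp: op_between_def)
      moreover from this have "\<bar>g t - m\<bar> \<le> (d - c) / 2" using gcd[of t] by (auto simp: m_def abs_if field_simps)
      moreover have "poly (p - [:m:]) t = (poly p t - g t) + (g t - m)" by simp
      ultimately show ?thesis using p[of t] abs_triangle_ineq[of "poly p t - g t" "g t - m"] by linarith
    qed
    from op_cpoly_norm_le[OF K sa I this x]
    have 1: "l2_norm I (\<lambda>i. op_cpoly T (cpoly_of p) x i - complex_of_real m * x i) \<le> ((d - c) / 2 + e') * l2_norm I x"
      by (simp add: cpoly_of_diff op_cpoly_diff op_cpoly_const map_poly_pCons)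
    have 2: "l2_norm I (\<lambda>i. op_cfc I T g x i - op_cpoly T (cpoly_of p) x i) \<le> e' * l2_norm I x"
      using approx[OF p x] by (subst l2_norm_minus_commute)
    have "l2_norm I (\<lambda>i. op_cfc I T g x i - complex_of_real m * x i)
        \<le> e' * l2_norm I x + ((d - c) / 2 + e') * l2_norm I x"
      using l2_norm_diff_triangle[OF l2b_mem[OF KC x] op_cpoly_mem[OF K x] l2_scale[OF x], of "complex_of_real m" "cpoly_of p"]
        1 2 by linarith
    also have "\<dots> \<le> (d - c) / 2 * l2_norm I x + e"
      using e'(2) by (simp add: algebra_simps)
    finally show "l2_norm I (\<lambda>i. op_cfc I T g x i - complex_of_real m * x i) \<le> (d - c) / 2 * l2_norm I x + e" .
  qed
  then show ?thesis
    unfolding op_between_def m_def using C cd op_cfc_selfadj[OF T I g] by blast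
qed

text \<open>Approximates \<open>h\<close> by a polynomial \<open>r\<close> and \<open>g\<close> by a
  polynomial \<open>p\<close>; at the level of polynomials the two calculi compose by
  \<open>op_cpoly_pcompose\<close>.\<close>

lemma op_cfc_compose:
  assumes T: "op_between I T a b" and I: "I \<noteq> {}" and g: "continuous_on {a..b} g"
    and gcd: "\<And>t. t \<in> {a..b} \<Longrightarrow> g t \<in> {c..d}" and h: "continuous_on {c..d} h"
  shows "op_cfc I (op_cfc I T g) h = op_cfc I T (\<lambda>t. h (g t))"
proof -
  define B where "B = op_cfc I T g"
  define D where "D = op_cfc I T (\<lambda>t. h (g t))"
  have B: "op_between I B c d" unfolding B_def by (rule op_between_op_cfc[OF T I g gcd])
  have hg: "continuous_on {a..b} (\<lambda>t. h (g t))"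
    by (rule continuous_on_compose2[OF h g]) (use gcd in auto)
  note D = op_cfc_bounded[OF T I hg, folded D_def] and D_approx = op_cfc_approx[OF T I hg, folded D_def]
  note C = op_cfc_bounded[OF B I h] and C_approx = op_cfc_approx[OF B I h]
  note B_approx = op_cfc_approx[OF T I g, folded B_def]
  obtain K where K: "l2_bounded_by I T K" using T bounded_opsD by (metis op_between_def)
  obtain KB where KB: "l2_bounded_by I B KB" using B bounded_opsD by (metis op_between_def)
  obtain KC where KC: "l2_bounded_by I (op_cfc I B h) KC" using bounded_opsD[OF C] by metis
  obtain KD where KD: "l2_bounded_by I D KD" using bounded_opsD[OF D] by metis
  have "op_cfc I B h x = D x" if x: "x \<in> l2 I" for x
  \<comment> \<open>The 4 is 1 + 1 + 2: from \<open>h\<close> to \<open>r\<close> at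
    \<open>B\<close>, from \<open>B\<close> to the polynomial \<open>Y\<close> inside
    \<open>r\<close>, and from the composite polynomial to \<open>h\<close> after
    \<open>g\<close>.\<close>
  proof (rule l2_eqI_epsilon[where c = "4 * l2_norm I x"])
    show "op_cfc I B h x \<in> l2 I" "D x \<in> l2 I" using l2b_mem[OF KC x] l2b_mem[OF KD x] by auto
    fix e :: real assume e: "e > 0"
    obtain r where r: "\<And>t. t \<in> {c..d} \<Longrightarrow> \<bar>poly r t - h t\<bar> \<le> e" using Weierstrass_poly[OF h e] by blast
    have KB1: "l2_bounded_by I B (KB + 1)" using l2b_mono[OF KB] by simp
    obtain L where L: "L \<ge> 0" "\<And>Y e x. l2_bounded_by I Y (KB + 1) \<Longrightarrow>
      \<forall>x\<in>l2 I. l2_norm I (\<lambda>i. B x i - Y x i) \<le> e * l2_norm I x \<Longrightarrow> e \<ge> 0 \<Longrightarrow> x \<in> l2 I \<Longrightarrow>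
      l2_norm I (\<lambda>i. op_cpoly B (cpoly_of r) x i - op_cpoly Y (cpoly_of r) x i) \<le> L * e * l2_norm I x"
      using op_cpoly_lipschitz[OF KB1, of "cpoly_of r"] by blast
    \<comment> \<open>\<open>g\<close> has values in [c, d], but its approximant \<open>p\<close>
      may leave this interval, by at most 1 once \<open>\<eta> \<le> 1\<close>.\<close>
    have "uniformly_continuous_on {c - 1..d + 1} (poly r)"
      by (intro compact_uniformly_continuous continuous_intros) auto
    then obtain \<delta> where \<delta>: "\<delta> > 0" "\<And>s t. s \<in> {c - 1..d + 1} \<Longrightarrow> t \<in> {c - 1..d + 1} \<Longrightarrow> \<bar>s - t\<bar> < \<delta> \<Longrightarrow>
      \<bar>poly r s - poly r t\<bar> < e"
      using e unfolding uniformly_continuous_on_def dist_real_def by metis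
    \<comment> \<open>Three demands: at most 1 keeps \<open>p\<close> in the enlarged interval and
      bounds \<open>Y\<close> by \<open>KB + 1\<close>; below \<open>\<delta>\<close> serves the
      uniform continuity of \<open>r\<close>; \<open>L * \<eta> \<le> e\<close> serves the Lipschitz
      estimate.\<close>
    define \<eta> where "\<eta> = min (min 1 (\<delta> / 2)) (e / (L + 1))"
    have \<eta>: "\<eta> > 0" "\<eta> \<le> 1" "\<eta> < \<delta>" "L * \<eta> \<le> e"
    proof -
      have "e / (L + 1) > 0" using e L(1) by simp
      then show "\<eta> > 0" "\<eta> \<le> 1" "\<eta> < \<delta>" using \<delta>(1) unfolding \<eta>_def by linarith+
      then have "L * \<eta> \<le> (L + 1) * (e / (L + 1))"
        using L(1) e by (intro mult_mono) (auto simp: \<eta>_def)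
      then show "L * \<eta> \<le> e" using L(1) by simp
    qed
    obtain p where p: "\<And>t. t \<in> {a..b} \<Longrightarrow> \<bar>poly p t - g t\<bar> \<le> \<eta>" using Weierstrass_poly[OF g \<eta>(1)] by blast
    define Y where "Y = op_cpoly T (cpoly_of p)"
    have BY: "l2_norm I (\<lambda>i. B x i - Y x i) \<le> \<eta> * l2_norm I x" if "x \<in> l2 I" for x
      unfolding Y_def using B_approx[OF p that] by (subst l2_norm_minus_commute)
    have Ymem: "Y x \<in> l2 I" if "x \<in> l2 I" for x unfolding Y_def by (rule op_cpoly_mem[OF K that])
    have KY: "l2_bounded_by I Y (KB + 1)"
      unfolding Y_def
    proof (rule l2b_op_cpoly_le[OF K], fold Y_def)
      fix x assume x: "x \<in> l2 I"
      have "l2_norm I (Y x) \<le> l2_norm I (B x) + l2_norm I (\<lambda>i. B x i - Y x i)"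
        using l2_norm_triangle_sub[OF Ymem[OF x] l2b_mem[OF KB x]] by (simp add: l2_norm_minus_commute[of I "Y x"])
      also have "\<dots> \<le> KB * l2_norm I x + 1 * l2_norm I x"
        using BY[OF x] mult_right_mono[OF \<eta>(2) l2_norm_nonneg[of I x]] by (intro add_mono l2b_norm[OF KB x]) linarith
      finally show "l2_norm I (Y x) \<le> (KB + 1) * l2_norm I x" by (simp add: algebra_simps)
    qed
    have rp: "\<bar>poly (pcompose r p) t - h (g t)\<bar> \<le> 2 * e" if t: "t \<in> {a..b}" for t
    proof -
      have "\<bar>poly r (poly p t) - poly r (g t)\<bar> < e"
        by (rule \<delta>(2)) (use p[OF t] gcd[OF t] \<eta> in auto)
      then show ?thesis using r[OF gcd[OF t]] by (simp add: poly_pcompose)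
    qed
    have m: "op_cpoly B (cpoly_of r) x \<in> l2 I" "op_cpoly Y (cpoly_of r) x \<in> l2 I"
      using op_cpoly_mem[OF KB x] op_cpoly_mem[OF KY x] by auto
    have 1: "l2_norm I (\<lambda>i. op_cfc I B h x i - op_cpoly B (cpoly_of r) x i) \<le> e * l2_norm I x"
      using C_approx[OF r x] by (subst l2_norm_minus_commute)
    have "l2_norm I (\<lambda>i. op_cpoly B (cpoly_of r) x i - op_cpoly Y (cpoly_of r) x i) \<le> L * \<eta> * l2_norm I x"
      by (rule L(2)[OF KY _ _ x]) (use BY \<eta>(1) in auto)
    also have "\<dots> \<le> e * l2_norm I x" using \<eta>(4) by (intro mult_right_mono) auto
    finally have 2: "l2_norm I (\<lambda>i. op_cpoly B (cpoly_of r) x i - op_cpoly Y (cpoly_of r) x i) \<le> e * l2_norm I x" .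
    have 3: "l2_norm I (\<lambda>i. op_cpoly Y (cpoly_of r) x i - D x i) \<le> 2 * e * l2_norm I x"
      using D_approx[OF rp x] op_cpoly_pcompose[OF K x, of "cpoly_of r" "cpoly_of p"]
      by (simp add: cpoly_of_pcompose Y_def)
    show "l2_norm I (\<lambda>i. op_cfc I B h x i - D x i) \<le> e * (4 * l2_norm I x)"
      using l2_norm_diff_triangle[OF l2b_mem[OF KC x] m(1) l2b_mem[OF KD x]]
        l2_norm_diff_triangle[OF m l2b_mem[OF KD x]] 1 2 3 by (simp add: algebra_simps)
  qed
  then show ?thesis
    using bounded_ops_eqI[OF C D] by (simp add: B_def D_def)
qed


section \<open>Summable series acting through a homomorphism\<close>

text \<open>Fubini with a summable weight: the uniform bound \<open>M\<close> on the inner absolute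
  sums makes the double family absolutely summable.\<close>

lemma
  fixes f :: "'a \<Rightarrow> complex" and a :: "'a \<Rightarrow> 'b \<Rightarrow> complex"
  assumes f: "(\<lambda>\<gamma>. cmod (f \<gamma>)) summable_on C"
    and a: "\<And>\<gamma>. \<gamma> \<in> C \<Longrightarrow> (\<lambda>h. cmod (a \<gamma> h)) summable_on B"
    and M: "\<And>\<gamma>. \<gamma> \<in> C \<Longrightarrow> (\<Sum>\<^sub>\<infinity>h\<in>B. cmod (a \<gamma> h)) \<le> M"
  shows weighted_infsum_summable: "(\<lambda>h. \<Sum>\<^sub>\<infinity>\<gamma>\<in>C. f \<gamma> * a \<gamma> h) summable_on B"
    and weighted_infsum_swap:
      "(\<Sum>\<^sub>\<infinity>h\<in>B. \<Sum>\<^sub>\<infinity>\<gamma>\<in>C. f \<gamma> * a \<gamma> h) = (\<Sum>\<^sub>\<infinity>\<gamma>\<in>C. f \<gamma> * (\<Sum>\<^sub>\<infinity>h\<in>B. a \<gamma> h))"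
proof -
  have "(\<lambda>p. cmod (case p of (\<gamma>, h) \<Rightarrow> f \<gamma> * a \<gamma> h)) summable_on (C \<times> B)"
  proof (subst Infinite_Sum.abs_summable_on_Sigma_iff, intro conjI ballI)
    show "(\<lambda>h. cmod (case (\<gamma>, h) of (\<gamma>, h) \<Rightarrow> f \<gamma> * a \<gamma> h)) summable_on B" if "\<gamma> \<in> C" for \<gamma>
      using summable_on_cmult_right[OF a[OF that], of "cmod (f \<gamma>)"] by (simp add: norm_mult)
    show "(\<lambda>\<gamma>. norm (\<Sum>\<^sub>\<infinity>h\<in>B. cmod (case (\<gamma>, h) of (\<gamma>, h) \<Rightarrow> f \<gamma> * a \<gamma> h))) summable_on C"
    proof (rule summable_on_comparison_test)
      show "(\<lambda>\<gamma>. cmod (f \<gamma>) * M) summable_on C" using f by (rule summable_on_cmult_left)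
      fix \<gamma> assume \<gamma>: "\<gamma> \<in> C"
      show "norm (\<Sum>\<^sub>\<infinity>h\<in>B. cmod (case (\<gamma>, h) of (\<gamma>, h) \<Rightarrow> f \<gamma> * a \<gamma> h)) \<le> cmod (f \<gamma>) * M"
        using M[OF \<gamma>] by (simp add: norm_mult infsum_cmult_right' infsum_nonneg mult_left_mono)
    qed simp
  qed
  then have S: "(\<lambda>(\<gamma>, h). f \<gamma> * a \<gamma> h) summable_on (C \<times> B)"
    by (rule abs_summable_summable)
  have "(\<lambda>(h, \<gamma>). f \<gamma> * a \<gamma> h) summable_on (B \<times> C)"
    using S by (subst (asm) summable_on_swap) simp
  from summable_on_Sigma_banach[OF this] show "(\<lambda>h. \<Sum>\<^sub>\<infinity>\<gamma>\<in>C. f \<gamma> * a \<gamma> h) summable_on B" by simp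
  show "(\<Sum>\<^sub>\<infinity>h\<in>B. \<Sum>\<^sub>\<infinity>\<gamma>\<in>C. f \<gamma> * a \<gamma> h) = (\<Sum>\<^sub>\<infinity>\<gamma>\<in>C. f \<gamma> * (\<Sum>\<^sub>\<infinity>h\<in>B. a \<gamma> h))"
    using infsum_swap_banach[OF S] by (simp add: infsum_cmult_right')
qed

lemma L1_abs_summable: "f \<in> L1 G \<Longrightarrow> (\<lambda>g. cmod (f g)) summable_on carrier G"
  by (simp add: L1_def)

definition L1_norm :: "'a monoid \<Rightarrow> ('a \<Rightarrow> complex) \<Rightarrow> real" where
  "L1_norm G f = (\<Sum>\<^sub>\<infinity>g\<in>carrier G. cmod (f g))"

lemma L1_norm_nonneg: "L1_norm G f \<ge> 0"
  by (simp add: L1_norm_def infsum_nonneg)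

lemma L1_bounded_summable:
  assumes f: "f \<in> L1 G" and u: "\<And>\<gamma>. \<gamma> \<in> carrier G \<Longrightarrow> cmod (u \<gamma>) \<le> U"
  shows "(\<lambda>\<gamma>. cmod (f \<gamma> * u \<gamma>)) summable_on carrier G"
    and "(\<Sum>\<^sub>\<infinity>\<gamma>\<in>carrier G. cmod (f \<gamma> * u \<gamma>)) \<le> L1_norm G f * U"
proof -
  have c: "(\<lambda>\<gamma>. cmod (f \<gamma>) * U) summable_on carrier G"
    using L1_abs_summable[OF f] by (rule summable_on_cmult_left)
  show s: "(\<lambda>\<gamma>. cmod (f \<gamma> * u \<gamma>)) summable_on carrier G"
    by (rule summable_on_comparison_test[OF c]) (simp_all add: norm_mult mult_left_mono u)
  have "(\<Sum>\<^sub>\<infinity>\<gamma>\<in>carrier G. cmod (f \<gamma> * u \<gamma>)) \<le> (\<Sum>\<^sub>\<infinity>\<gamma>\<in>carrier G. cmod (f \<gamma>) * U)"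
    by (rule infsum_mono[OF s c]) (simp add: norm_mult mult_left_mono u)
  then show "(\<Sum>\<^sub>\<infinity>\<gamma>\<in>carrier G. cmod (f \<gamma> * u \<gamma>)) \<le> L1_norm G f * U"
    by (simp add: L1_norm_def infsum_cmult_left')
qed

locale discrete_group = group G for G :: "'a monoid" (structure)

locale discrete_group_hom = group_hom G H h
  for G :: "'a monoid" (structure) and H :: "'b monoid" (structure) and h

sublocale discrete_group_hom \<subseteq> src: discrete_group G
  by unfold_locales

sublocale discrete_group_hom \<subseteq> tgt: discrete_group H
  by unfold_locales

section \<open>Translations, convolution and the trace on a single group\<close>

context discrete_group
begin

lemma bij_betw_left_translation: "k \<in> carrier G \<Longrightarrow> bij_betw (\<lambda>g. k \<otimes> g) (carrier G) (carrier G)"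
  by (rule bij_betw_byWitness[where f' = "\<lambda>g. inv k \<otimes> g"]) (auto simp: m_assoc[symmetric])

lemma bij_betw_right_translation: "k \<in> carrier G \<Longrightarrow> bij_betw (\<lambda>g. g \<otimes> k) (carrier G) (carrier G)"
  by (rule bij_betw_byWitness[where f' = "\<lambda>g. g \<otimes> inv k"]) (auto simp: m_assoc)

lemma bij_betw_inv: "bij_betw (\<lambda>g. inv g) (carrier G) (carrier G)"
  by (rule bij_betw_byWitness[where f' = "\<lambda>g. inv g"]) auto

lemma
  assumes x: "x \<in> l2 (carrier G)" and b: "bij_betw b (carrier G) (carrier G)"
  shows l2_reindex: "(\<lambda>g. if g \<in> carrier G then x (b g) else 0) \<in> l2 (carrier G)"
    and l2_norm_reindex: "l2_norm (carrier G) (\<lambda>g. if g \<in> carrier G then x (b g) else 0) = l2_norm (carrier G) x"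
proof -
  have "(\<lambda>g. (cmod (x (b g)))\<^sup>2) summable_on carrier G"
    using summable_on_reindex_bij_betw[OF b, of "\<lambda>g. (cmod (x g))\<^sup>2"] l2_summable[OF x] by simp
  then have "(\<lambda>g. (cmod (if g \<in> carrier G then x (b g) else 0))\<^sup>2) summable_on carrier G"
    by (rule summable_on_cong[THEN iffD1, rotated]) simp
  then show "(\<lambda>g. if g \<in> carrier G then x (b g) else 0) \<in> l2 (carrier G)" by (simp add: l2_def)
  have "(\<Sum>\<^sub>\<infinity>g\<in>carrier G. (cmod (if g \<in> carrier G then x (b g) else 0))\<^sup>2)
      = (\<Sum>\<^sub>\<infinity>g\<in>carrier G. (cmod (x (b g)))\<^sup>2)"
    by (rule infsum_cong) simp
  also have "\<dots> = (\<Sum>\<^sub>\<infinity>g\<in>carrier G. (cmod (x g))\<^sup>2)"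
    by (rule infsum_reindex_bij_betw[OF b])
  finally show "l2_norm (carrier G) (\<lambda>g. if g \<in> carrier G then x (b g) else 0) = l2_norm (carrier G) x"
    by (simp add: l2_norm_def)
qed

lemma right_mult_eq: "k \<in> carrier G \<Longrightarrow> g \<in> carrier G \<Longrightarrow> x (g \<otimes> k) = right_mult G (inv k) x g"
  by (simp add: right_mult_def)

lemma
  assumes "x \<in> l2 (carrier G)" "k \<in> carrier G"
  shows right_mult_l2: "right_mult G k x \<in> l2 (carrier G)"
    and l2_norm_right_mult: "l2_norm (carrier G) (right_mult G k x) = l2_norm (carrier G) x"
  using l2_reindex[OF assms(1) bij_betw_right_translation[of "inv k"]]
    l2_norm_reindex[OF assms(1) bij_betw_right_translation[of "inv k"]] assms(2)
  by (simp_all add: right_mult_def)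

lemma left_mult_l2:
  assumes "x \<in> l2 (carrier G)" "k \<in> carrier G"
  shows "left_mult G k x \<in> l2 (carrier G)"
  using l2_reindex[OF assms(1) bij_betw_left_translation[of "inv k"]] assms(2)
  by (simp add: left_mult_def)

text \<open>The second part tests the convolution against a bounded function, after substituting
  \<open>\<delta> \<otimes> \<gamma>\<close>. With values of a translated vector as
  \<open>u\<close>, this says that \<open>series_op\<close> turns convolution into composition; the
  same estimates for the constant 1 give summability.\<close>

lemma
  assumes f: "f \<in> L1 G" and h: "h \<in> L1 G"
  shows convolution_L1: "convolution G f h \<in> L1 G"
    and infsum_convolution: "(\<And>\<gamma>. \<gamma> \<in> carrier G \<Longrightarrow> cmod (u \<gamma>) \<le> U) \<Longrightarrow>
      (\<Sum>\<^sub>\<infinity>\<gamma>\<in>carrier G. convolution G f h \<gamma> * u \<gamma>)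
      = (\<Sum>\<^sub>\<infinity>\<delta>\<in>carrier G. f \<delta> * (\<Sum>\<^sub>\<infinity>\<gamma>\<in>carrier G. h \<gamma> * u (\<delta> \<otimes> \<gamma>)))"
proof -
  have bij: "bij_betw (\<lambda>\<gamma>. inv \<delta> \<otimes> \<gamma>) (carrier G) (carrier G)" if "\<delta> \<in> carrier G" for \<delta>
    using that by (intro bij_betw_left_translation) auto
  have *: "(\<lambda>\<gamma>. cmod (h (inv \<delta> \<otimes> \<gamma>) * u \<gamma>)) summable_on carrier G"
    "(\<Sum>\<^sub>\<infinity>\<gamma>\<in>carrier G. cmod (h (inv \<delta> \<otimes> \<gamma>) * u \<gamma>)) \<le> L1_norm G h * U"
    "(\<Sum>\<^sub>\<infinity>\<gamma>\<in>carrier G. h (inv \<delta> \<otimes> \<gamma>) * u \<gamma>) = (\<Sum>\<^sub>\<infinity>\<gamma>\<in>carrier G. h \<gamma> * u (\<delta> \<otimes> \<gamma>))"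
    if \<delta>: "\<delta> \<in> carrier G" and u: "\<And>\<gamma>. \<gamma> \<in> carrier G \<Longrightarrow> cmod (u \<gamma>) \<le> U" for \<delta> u U
  proof -
    let ?F = "\<lambda>\<gamma>. h \<gamma> * u (\<delta> \<otimes> \<gamma>)"
    have F: "?F (inv \<delta> \<otimes> \<gamma>) = h (inv \<delta> \<otimes> \<gamma>) * u \<gamma>" if "\<gamma> \<in> carrier G" for \<gamma>
      using that \<delta> by (simp add: m_assoc[symmetric])
    have u': "cmod (u (\<delta> \<otimes> \<gamma>)) \<le> U" if "\<gamma> \<in> carrier G" for \<gamma> using u \<delta> that by simp
    note b = L1_bounded_summable[OF h u']
    show "(\<lambda>\<gamma>. cmod (h (inv \<delta> \<otimes> \<gamma>) * u \<gamma>)) summable_on carrier G"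
      using b(1) summable_on_reindex_bij_betw[OF bij[OF \<delta>], of "\<lambda>\<gamma>. cmod (?F \<gamma>)"]
      by (subst (asm) summable_on_cong[of _ _ "\<lambda>\<gamma>. cmod (h (inv \<delta> \<otimes> \<gamma>) * u \<gamma>)"]) (simp_all only: F)
    have "(\<Sum>\<^sub>\<infinity>\<gamma>\<in>carrier G. cmod (h (inv \<delta> \<otimes> \<gamma>) * u \<gamma>)) = (\<Sum>\<^sub>\<infinity>\<gamma>\<in>carrier G. cmod (?F (inv \<delta> \<otimes> \<gamma>)))"
      by (rule infsum_cong) (simp only: F)
    also have "\<dots> = (\<Sum>\<^sub>\<infinity>\<gamma>\<in>carrier G. cmod (?F \<gamma>))"
      by (rule infsum_reindex_bij_betw[OF bij[OF \<delta>]])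
    finally show "(\<Sum>\<^sub>\<infinity>\<gamma>\<in>carrier G. cmod (h (inv \<delta> \<otimes> \<gamma>) * u \<gamma>)) \<le> L1_norm G h * U"
      using b(2) by simp
    have "(\<Sum>\<^sub>\<infinity>\<gamma>\<in>carrier G. h (inv \<delta> \<otimes> \<gamma>) * u \<gamma>) = (\<Sum>\<^sub>\<infinity>\<gamma>\<in>carrier G. ?F (inv \<delta> \<otimes> \<gamma>))"
      by (rule infsum_cong) (simp only: F)
    also have "\<dots> = (\<Sum>\<^sub>\<infinity>\<gamma>\<in>carrier G. ?F \<gamma>)"
      by (rule infsum_reindex_bij_betw[OF bij[OF \<delta>]])
    finally show "(\<Sum>\<^sub>\<infinity>\<gamma>\<in>carrier G. h (inv \<delta> \<otimes> \<gamma>) * u \<gamma>) = (\<Sum>\<^sub>\<infinity>\<gamma>\<in>carrier G. h \<gamma> * u (\<delta> \<otimes> \<gamma>))" .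
  qed
  have "(\<lambda>\<gamma>. \<Sum>\<^sub>\<infinity>\<delta>\<in>carrier G. f \<delta> * (h (inv \<delta> \<otimes> \<gamma>) * 1)) summable_on carrier G"
    using L1_abs_summable[OF f] *(1)[of _ "\<lambda>_. 1" 1] *(2)[of _ "\<lambda>_. 1" 1]
    by (intro weighted_infsum_summable[where M = "L1_norm G h * 1"]) auto
  then have "convolution G f h summable_on carrier G"
    by (rule summable_on_cong[THEN iffD1, rotated]) (simp add: convolution_def)
  then show "convolution G f h \<in> L1 G"
    by (simp add: L1_def summable_on_iff_abs_summable_on_complex convolution_def)
  assume u: "\<And>\<gamma>. \<gamma> \<in> carrier G \<Longrightarrow> cmod (u \<gamma>) \<le> U"
  have "(\<Sum>\<^sub>\<infinity>\<gamma>\<in>carrier G. convolution G f h \<gamma> * u \<gamma>)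
      = (\<Sum>\<^sub>\<infinity>\<gamma>\<in>carrier G. \<Sum>\<^sub>\<infinity>\<delta>\<in>carrier G. f \<delta> * (h (inv \<delta> \<otimes> \<gamma>) * u \<gamma>))"
    by (rule infsum_cong) (simp add: convolution_def mult.assoc flip: infsum_cmult_left')
  also have "\<dots> = (\<Sum>\<^sub>\<infinity>\<delta>\<in>carrier G. f \<delta> * (\<Sum>\<^sub>\<infinity>\<gamma>\<in>carrier G. h (inv \<delta> \<otimes> \<gamma>) * u \<gamma>))"
    by (rule weighted_infsum_swap[OF L1_abs_summable[OF f]]) (use *(1)[OF _ u] *(2)[OF _ u] in auto)
  also have "\<dots> = (\<Sum>\<^sub>\<infinity>\<delta>\<in>carrier G. f \<delta> * (\<Sum>\<^sub>\<infinity>\<gamma>\<in>carrier G. h \<gamma> * u (\<delta> \<otimes> \<gamma>)))"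
    by (rule infsum_cong) (simp add: *(3)[OF _ u])
  finally show "(\<Sum>\<^sub>\<infinity>\<gamma>\<in>carrier G. convolution G f h \<gamma> * u \<gamma>)
      = (\<Sum>\<^sub>\<infinity>\<delta>\<in>carrier G. f \<delta> * (\<Sum>\<^sub>\<infinity>\<gamma>\<in>carrier G. h \<gamma> * u (\<delta> \<otimes> \<gamma>)))" .
qed

lemma unit_series_L1: "unit_series G \<in> L1 G"
proof -
  have "finite {g \<in> carrier G. cmod (unit_series G g) \<noteq> 0}"
    by (rule finite_subset[of _ "{\<one>}"]) (auto simp: unit_series_def)
  then show ?thesis by (auto simp: L1_def unit_series_def intro: finite_nonzero_values_imp_summable_on)
qed

lemma infsum_unit_series: "(\<Sum>\<^sub>\<infinity>g\<in>carrier G. unit_series G g * u g) = u \<one>"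
proof -
  have "(\<Sum>\<^sub>\<infinity>g\<in>carrier G. unit_series G g * u g) = (\<Sum>\<^sub>\<infinity>g\<in>{\<one>}. u g)"
    by (rule infsum_cong_neutral) (auto simp: unit_series_def)
  then show ?thesis by simp
qed

lemma unit_series_l2: "unit_series G \<in> l2 (carrier G)"
proof -
  have "finite {g \<in> carrier G. (cmod (unit_series G g))\<^sup>2 \<noteq> 0}"
    by (rule finite_subset[of _ "{\<one>}"]) (auto simp: unit_series_def)
  then show ?thesis by (auto simp: l2_def unit_series_def intro: finite_nonzero_values_imp_summable_on)
qed

lemma l2_norm_unit_series: "l2_norm (carrier G) (unit_series G) = 1"
proof -
  have "(\<Sum>\<^sub>\<infinity>g\<in>carrier G. (cmod (unit_series G g))\<^sup>2) = (\<Sum>\<^sub>\<infinity>g\<in>{\<one>}. 1)"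
    by (rule infsum_cong_neutral) (auto simp: unit_series_def)
  then show ?thesis by (simp add: l2_norm_def)
qed

lemma vN_trace_eq: "vN_trace G A = A (unit_series G) \<one>"
proof -
  have "vN_trace G A = (\<Sum>\<^sub>\<infinity>g\<in>carrier G. unit_series G g * A (unit_series G) g)"
    unfolding vN_trace_def l2_inner_def by (rule infsum_cong) (simp add: unit_series_def)
  then show ?thesis by (simp add: infsum_unit_series)
qed

text \<open>The trace is one coordinate of the image of a vector of norm 1, so it is 1-Lipschitz for
  the operator norm.\<close>

lemma vN_trace_diff_le:
  assumes "\<And>x. x \<in> l2 (carrier G) \<Longrightarrow> A x \<in> l2 (carrier G)" "\<And>x. x \<in> l2 (carrier G) \<Longrightarrow> B x \<in> l2 (carrier G)"
    and "\<And>x. x \<in> l2 (carrier G) \<Longrightarrow> l2_norm (carrier G) (\<lambda>g. A x g - B x g) \<le> e * l2_norm (carrier G) x"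
  shows "cmod (vN_trace G A - vN_trace G B) \<le> e"
  using cmod_le_l2_norm[OF l2_diff[OF assms(1,2)], of "unit_series G" "unit_series G" \<one>]
    assms(3)[OF unit_series_l2] unit_series_l2
  by (simp add: vN_trace_eq l2_norm_unit_series)

end

definition L1_star :: "'a monoid \<Rightarrow> ('a \<Rightarrow> complex) \<Rightarrow> ('a \<Rightarrow> complex)" where
  "L1_star G f = (\<lambda>g. if g \<in> carrier G then cnj (f (inv\<^bsub>G\<^esub> g)) else 0)"

lemma (in discrete_group) L1_star_L1:
  assumes "f \<in> L1 G"
  shows "L1_star G f \<in> L1 G"
proof -
  have "(\<lambda>g. cmod (f (inv g))) summable_on carrier G"
    using summable_on_reindex_bij_betw[OF bij_betw_inv, of "\<lambda>g. cmod (f g)"] L1_abs_summable[OF assms] by simp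
  then have "(\<lambda>g. cmod (L1_star G f g)) summable_on carrier G"
    by (rule summable_on_cong[THEN iffD1, rotated]) (simp add: L1_star_def)
  then show ?thesis by (simp add: L1_def L1_star_def)
qed

text \<open>
  The composite of \<^const>\<open>right_reg\<close> with push-forward along \<open>\<phi>\<close>
  (\<open>right_reg_push_forward\<close> below); it turns convolution over the source into
  composition directly, so that convolutions in the quotients never have to be considered.
\<close>

definition series_op :: "'a monoid \<Rightarrow> 'b monoid \<Rightarrow> ('a \<Rightarrow> 'b) \<Rightarrow> ('a \<Rightarrow> complex) \<Rightarrow> 'b op" where
  "series_op G H \<phi> f x =
     (\<lambda>h. if h \<in> carrier H then \<Sum>\<^sub>\<infinity>\<gamma>\<in>carrier G. f \<gamma> * x (h \<otimes>\<^bsub>H\<^esub> \<phi> \<gamma>) else 0)"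

lemma L2_set_sum_le:
  fixes a :: "'k \<Rightarrow> 'i \<Rightarrow> complex"
  assumes "finite K"
  shows "L2_set (\<lambda>h. cmod (\<Sum>\<gamma>\<in>K. a \<gamma> h)) F \<le> (\<Sum>\<gamma>\<in>K. L2_set (\<lambda>h. cmod (a \<gamma> h)) F)"
  using assms
proof (induction K)
  case empty
  then show ?case by (simp add: L2_set_def)
next
  case (insert \<gamma> K)
  have "L2_set (\<lambda>h. cmod (\<Sum>\<gamma>\<in>insert \<gamma> K. a \<gamma> h)) F \<le> L2_set (\<lambda>h. cmod (a \<gamma> h) + cmod (\<Sum>\<gamma>\<in>K. a \<gamma> h)) F"
    using insert.hyps by (intro L2_set_mono) (auto intro: norm_triangle_ineq)
  also have "\<dots> \<le> L2_set (\<lambda>h. cmod (a \<gamma> h)) F + L2_set (\<lambda>h. cmod (\<Sum>\<gamma>\<in>K. a \<gamma> h)) F"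
    by (rule L2_set_triangle_ineq)
  finally show ?case using insert by simp
qed

section \<open>The action of source series on the target: boundedness, products and adjoints\<close>

context discrete_group_hom
begin

lemma series_op_summable:
  assumes f: "f \<in> L1 G" and x: "x \<in> l2 (carrier H)"
  shows "(\<lambda>\<gamma>. f \<gamma> * x (k \<otimes>\<^bsub>H\<^esub> h \<gamma>)) summable_on carrier G"
  by (rule abs_summable_summable) (rule L1_bounded_summable(1)[OF f cmod_le_l2_norm[OF x]])

text \<open>Minkowski's inequality for translates of x, which all have the norm of x. There are two
  truncations: finitely many coordinates \<open>F\<close>, and finitely many terms \<open>K\<close>,
  the latter removed by a limit.\<close>

lemma series_op_mem_norm:
  assumes f: "f \<in> L1 G" and x: "x \<in> l2 (carrier H)"
  shows "series_op G H h f x \<in> l2 (carrier H)"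
    and "l2_norm (carrier H) (series_op G H h f x) \<le> L1_norm G f * l2_norm (carrier H) x"
proof -
  have "L2_set (\<lambda>k. cmod (series_op G H h f x k)) F \<le> L1_norm G f * l2_norm (carrier H) x"
    if F: "finite F" "F \<subseteq> carrier H" for F
  proof (rule tendsto_upperbound)
    let ?s = "\<lambda>K k. \<Sum>\<gamma>\<in>K. f \<gamma> * x (k \<otimes>\<^bsub>H\<^esub> h \<gamma>)"
    have "((\<lambda>K. ?s K k) \<longlongrightarrow> series_op G H h f x k) (finite_subsets_at_top (carrier G))" if "k \<in> F" for k
      using has_sum_infsum[OF series_op_summable[OF f x, of k]] F that
      by (auto simp: has_sum_def series_op_def)
    then show "((\<lambda>K. L2_set (\<lambda>k. cmod (?s K k)) F) \<longlongrightarrow> L2_set (\<lambda>k. cmod (series_op G H h f x k)) F)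
        (finite_subsets_at_top (carrier G))"
      unfolding L2_set_def by (intro tendsto_real_sqrt tendsto_sum tendsto_power tendsto_norm)
    have "L2_set (\<lambda>k. cmod (?s K k)) F \<le> L1_norm G f * l2_norm (carrier H) x"
      if K: "finite K" "K \<subseteq> carrier G" for K
    proof -
      have "L2_set (\<lambda>k. cmod (?s K k)) F \<le> (\<Sum>\<gamma>\<in>K. L2_set (\<lambda>k. cmod (f \<gamma> * x (k \<otimes>\<^bsub>H\<^esub> h \<gamma>))) F)"
        by (rule L2_set_sum_le[OF K(1)])
      also have "\<dots> \<le> (\<Sum>\<gamma>\<in>K. cmod (f \<gamma>) * l2_norm (carrier H) x)"
      proof (rule sum_mono)
        fix \<gamma> assume "\<gamma> \<in> K"
        then have \<gamma>: "h \<gamma> \<in> carrier H" using K(2) by auto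
        have "L2_set (\<lambda>k. cmod (f \<gamma> * x (k \<otimes>\<^bsub>H\<^esub> h \<gamma>))) F = cmod (f \<gamma>) * L2_set (\<lambda>k. cmod (x (k \<otimes>\<^bsub>H\<^esub> h \<gamma>))) F"
          by (simp add: norm_mult L2_set_right_distrib)
        also have "L2_set (\<lambda>k. cmod (x (k \<otimes>\<^bsub>H\<^esub> h \<gamma>))) F
            = L2_set (\<lambda>k. cmod (right_mult H (inv\<^bsub>H\<^esub> h \<gamma>) x k)) F"
          using F(2) \<gamma> by (intro L2_set_cong) (auto simp: tgt.right_mult_eq)
        also have "cmod (f \<gamma>) * \<dots> \<le> cmod (f \<gamma>) * l2_norm (carrier H) x"
          using L2_set_le_l2_norm[OF tgt.right_mult_l2[OF x, of "inv\<^bsub>H\<^esub> h \<gamma>"] F] \<gamma>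
          by (intro mult_left_mono) (auto simp: tgt.l2_norm_right_mult[OF x])
        finally show "L2_set (\<lambda>k. cmod (f \<gamma> * x (k \<otimes>\<^bsub>H\<^esub> h \<gamma>))) F \<le> cmod (f \<gamma>) * l2_norm (carrier H) x" .
      qed
      also have "\<dots> = (\<Sum>\<gamma>\<in>K. cmod (f \<gamma>)) * l2_norm (carrier H) x" by (rule sum_distrib_right[symmetric])
      also have "\<dots> \<le> L1_norm G f * l2_norm (carrier H) x"
        unfolding L1_norm_def using finite_sum_le_infsum[OF L1_abs_summable[OF f] K]
        by (intro mult_right_mono) auto
      finally show ?thesis .
    qed
    then show "\<forall>\<^sub>F K in finite_subsets_at_top (carrier G).
        L2_set (\<lambda>k. cmod (?s K k)) F \<le> L1_norm G f * l2_norm (carrier H) x"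
      by (intro eventually_finite_subsets_at_top_weakI)
  qed simp
  then show "series_op G H h f x \<in> l2 (carrier H)"
    "l2_norm (carrier H) (series_op G H h f x) \<le> L1_norm G f * l2_norm (carrier H) x"
    using l2I_bound[of "carrier H" "series_op G H h f x"] by (auto simp: series_op_def)
qed

lemma series_op_bounded:
  assumes f: "f \<in> L1 G"
  shows "l2_bounded_by (carrier H) (series_op G H h f) (L1_norm G f)"
  unfolding l2_bounded_by_def
proof (intro conjI ballI allI)
  fix x y assume x: "x \<in> l2 (carrier H)" and y: "y \<in> l2 (carrier H)"
  show "series_op G H h f (\<lambda>i. x i + y i) = (\<lambda>i. series_op G H h f x i + series_op G H h f y i)"
    using series_op_summable[OF f x] series_op_summable[OF f y]
    by (auto simp: series_op_def fun_eq_iff distrib_left infsum_add)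
next
  fix c x assume x: "x \<in> l2 (carrier H)"
  show "series_op G H h f (\<lambda>i. c * x i) = (\<lambda>i. c * series_op G H h f x i)"
    by (auto simp: series_op_def fun_eq_iff mult.left_commute[of _ c] infsum_cmult_right')
qed (use series_op_mem_norm[OF f] in auto)

lemma series_op_convolution:
  assumes f: "f \<in> L1 G" and g: "g \<in> L1 G" and x: "x \<in> l2 (carrier H)"
  shows "series_op G H h (convolution G f g) x = series_op G H h f (series_op G H h g x)"
proof
  fix k
  show "series_op G H h (convolution G f g) x k = series_op G H h f (series_op G H h g x) k"
  proof (cases "k \<in> carrier H")
    case True
    then show ?thesis
      using src.infsum_convolution[OF f g cmod_le_l2_norm[OF x], of "\<lambda>\<gamma>. k \<otimes>\<^bsub>H\<^esub> h \<gamma>"]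
      by (simp add: series_op_def H.m_assoc cong: infsum_cong)
  qed (simp add: series_op_def)
qed

lemma series_op_unit: "x \<in> l2 (carrier H) \<Longrightarrow> series_op G H h (unit_series G) x = x"
  using src.infsum_unit_series by (auto simp: series_op_def fun_eq_iff l2_outside)

text \<open>For each \<open>\<gamma>\<close> the translation is moved from x to y; the sums over the
  two groups are interchanged before and after. Replacing \<open>\<gamma>\<close> by its inverse
  then produces \<open>L1_star\<close>.\<close>

lemma series_op_adjoint:
  assumes f: "f \<in> L1 G" and x: "x \<in> l2 (carrier H)" and y: "y \<in> l2 (carrier H)"
  shows "l2_inner (carrier H) (series_op G H h f x) y
    = l2_inner (carrier H) x (series_op G H h (L1_star G f) y)"
proof -
  let ?M = "l2_norm (carrier H) x * l2_norm (carrier H) y"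
  define a where "a \<gamma> k = right_mult H (inv\<^bsub>H\<^esub> h \<gamma>) x k * cnj (y k)" for \<gamma> k
  define b where "b \<gamma> k = x k * cnj (right_mult H (h \<gamma>) y k)" for \<gamma> k
  have a: "(\<lambda>k. cmod (a \<gamma> k)) summable_on carrier H" "(\<Sum>\<^sub>\<infinity>k\<in>carrier H. cmod (a \<gamma> k)) \<le> ?M"
    and b: "(\<lambda>k. cmod (b \<gamma> k)) summable_on carrier H" "(\<Sum>\<^sub>\<infinity>k\<in>carrier H. cmod (b \<gamma> k)) \<le> ?M"
    if "\<gamma> \<in> carrier G" for \<gamma>
    using l2_inner_abs_summable[OF tgt.right_mult_l2[OF x] y, of "inv\<^bsub>H\<^esub> h \<gamma>"]
      l2_inner_abs_le[OF tgt.right_mult_l2[OF x] y, of "inv\<^bsub>H\<^esub> h \<gamma>"]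
      l2_inner_abs_summable[OF x tgt.right_mult_l2[OF y], of "h \<gamma>"]
      l2_inner_abs_le[OF x tgt.right_mult_l2[OF y], of "h \<gamma>"] that
    unfolding a_def b_def by (simp_all add: tgt.l2_norm_right_mult[OF x] tgt.l2_norm_right_mult[OF y])
  have ab: "(\<Sum>\<^sub>\<infinity>k\<in>carrier H. a \<gamma> k) = (\<Sum>\<^sub>\<infinity>k\<in>carrier H. b \<gamma> k)" if \<gamma>: "\<gamma> \<in> carrier G" for \<gamma>
  proof -
    have "(\<Sum>\<^sub>\<infinity>k\<in>carrier H. a \<gamma> k) = (\<Sum>\<^sub>\<infinity>k\<in>carrier H. b \<gamma> (k \<otimes>\<^bsub>H\<^esub> h \<gamma>))"
      using \<gamma> by (intro infsum_cong) (simp add: a_def b_def right_mult_def H.m_assoc)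
    also have "\<dots> = (\<Sum>\<^sub>\<infinity>k\<in>carrier H. b \<gamma> k)"
      using \<gamma> by (intro infsum_reindex_bij_betw tgt.bij_betw_right_translation) auto
    finally show ?thesis .
  qed
  have "l2_inner (carrier H) (series_op G H h f x) y
      = (\<Sum>\<^sub>\<infinity>k\<in>carrier H. \<Sum>\<^sub>\<infinity>\<gamma>\<in>carrier G. f \<gamma> * a \<gamma> k)"
    unfolding l2_inner_def
  proof (rule infsum_cong)
    fix k assume k: "k \<in> carrier H"
    have "(\<Sum>\<^sub>\<infinity>\<gamma>\<in>carrier G. f \<gamma> * a \<gamma> k) = (\<Sum>\<^sub>\<infinity>\<gamma>\<in>carrier G. f \<gamma> * x (k \<otimes>\<^bsub>H\<^esub> h \<gamma>) * cnj (y k))"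
      using k by (intro infsum_cong) (simp add: a_def right_mult_def)
    then show "series_op G H h f x k * cnj (y k) = (\<Sum>\<^sub>\<infinity>\<gamma>\<in>carrier G. f \<gamma> * a \<gamma> k)"
      using k by (simp add: series_op_def infsum_cmult_left')
  qed
  also have "\<dots> = (\<Sum>\<^sub>\<infinity>\<gamma>\<in>carrier G. f \<gamma> * (\<Sum>\<^sub>\<infinity>k\<in>carrier H. a \<gamma> k))"
    by (rule weighted_infsum_swap[OF L1_abs_summable[OF f] a])
  also have "\<dots> = (\<Sum>\<^sub>\<infinity>\<gamma>\<in>carrier G. f \<gamma> * (\<Sum>\<^sub>\<infinity>k\<in>carrier H. b \<gamma> k))"
    by (rule infsum_cong) (simp only: ab)
  also have "\<dots> = (\<Sum>\<^sub>\<infinity>k\<in>carrier H. \<Sum>\<^sub>\<infinity>\<gamma>\<in>carrier G. f \<gamma> * b \<gamma> k)"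
    by (rule weighted_infsum_swap[OF L1_abs_summable[OF f] b, symmetric])
  also have "\<dots> = l2_inner (carrier H) x (series_op G H h (L1_star G f) y)"
    unfolding l2_inner_def
  proof (rule infsum_cong)
    fix k assume k: "k \<in> carrier H"
    have "(\<Sum>\<^sub>\<infinity>\<gamma>\<in>carrier G. L1_star G f \<gamma> * y (k \<otimes>\<^bsub>H\<^esub> h \<gamma>))
        = (\<Sum>\<^sub>\<infinity>\<gamma>\<in>carrier G. L1_star G f (inv\<^bsub>G\<^esub> \<gamma>) * y (k \<otimes>\<^bsub>H\<^esub> h (inv\<^bsub>G\<^esub> \<gamma>)))"
      by (rule infsum_reindex_bij_betw[OF src.bij_betw_inv, symmetric])
    also have "\<dots> = (\<Sum>\<^sub>\<infinity>\<gamma>\<in>carrier G. cnj (f \<gamma> * cnj (right_mult H (h \<gamma>) y k)))"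
      using k by (intro infsum_cong) (simp add: L1_star_def right_mult_def)
    finally have "cnj (series_op G H h (L1_star G f) y k) = (\<Sum>\<^sub>\<infinity>\<gamma>\<in>carrier G. f \<gamma> * cnj (right_mult H (h \<gamma>) y k))"
      using k by (simp only: series_op_def if_True infsum_cnj complex_cnj_cnj)
    then show "(\<Sum>\<^sub>\<infinity>\<gamma>\<in>carrier G. f \<gamma> * b \<gamma> k) = x k * cnj (series_op G H h (L1_star G f) y k)"
      by (simp add: b_def mult.left_commute[of _ "x k"] infsum_cmult_right')
  qed
  finally show ?thesis .
qed

lemma series_op_left_mult:
  assumes "k \<in> carrier H"
  shows "series_op G H h f (left_mult H k x) = left_mult H k (series_op G H h f x)"
  using assms by (auto simp: series_op_def left_mult_def fun_eq_iff H.m_assoc intro!: infsum_cong)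

text \<open>The source is the disjoint union of the fibres of \<open>h\<close>, and the sum over it
  is regrouped fibre by fibre.\<close>

lemma right_reg_push_forward:
  assumes f: "f \<in> L1 G"
  shows "right_reg H (push_forward G h f) = restrict (series_op G H h f) (l2 (carrier H))"
  unfolding right_reg_def
proof (rule restrict_ext, rule ext)
  fix x k assume x: "x \<in> l2 (carrier H)"
  show "(\<Sum>\<^sub>\<infinity>\<gamma>\<in>carrier H. push_forward G h f \<gamma> * right_mult H (inv\<^bsub>H\<^esub> \<gamma>) x k) = series_op G H h f x k"
  proof (cases "k \<in> carrier H")
    case k: True
    let ?B = "\<lambda>m. {\<gamma> \<in> carrier G. h \<gamma> = m}"
    have bij: "bij_betw (\<lambda>\<gamma>. (h \<gamma>, \<gamma>)) (carrier G) (Sigma (carrier H) ?B)"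
      by (rule bij_betw_byWitness[where f' = snd]) auto
    let ?F = "\<lambda>(m, \<gamma>). f \<gamma> * x (k \<otimes>\<^bsub>H\<^esub> m)"
    have S: "?F summable_on Sigma (carrier H) ?B"
      using summable_on_reindex_bij_betw[OF bij, of ?F] series_op_summable[OF f x, of k] by simp
    have "(\<Sum>\<^sub>\<infinity>m\<in>carrier H. push_forward G h f m * right_mult H (inv\<^bsub>H\<^esub> m) x k)
        = (\<Sum>\<^sub>\<infinity>m\<in>carrier H. \<Sum>\<^sub>\<infinity>\<gamma>\<in>?B m. ?F (m, \<gamma>))"
      using k by (intro infsum_cong) (simp add: push_forward_def right_mult_def infsum_cmult_left')
    also have "\<dots> = infsum ?F (Sigma (carrier H) ?B)" by (rule infsum_Sigma_banach[OF S])
    also have "\<dots> = (\<Sum>\<^sub>\<infinity>\<gamma>\<in>carrier G. ?F (h \<gamma>, \<gamma>))"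
      by (rule infsum_reindex_bij_betw[OF bij, symmetric])
    finally show ?thesis using k by (simp add: series_op_def)
  qed (simp add: series_op_def right_mult_def)
qed

lemma vN_trace_series_op:
  "vN_trace H (series_op G H h f) = (\<Sum>\<^sub>\<infinity>\<gamma>\<in>carrier G. f \<gamma> * (if h \<gamma> = \<one>\<^bsub>H\<^esub> then 1 else 0))"
  unfolding tgt.vN_trace_eq by (simp add: series_op_def unit_series_def cong: infsum_cong)

end


section \<open>The Gram operator and the determinant of an invertible series\<close>

context discrete_group_hom
begin

context
  fixes f g :: "'a \<Rightarrow> complex"
  assumes f: "f \<in> L1 G" and g: "g \<in> L1 G"
    and fg: "convolution G f g = unit_series G" and gf: "convolution G g f = unit_series G"
begin

private abbreviation "C \<equiv> carrier H"
private definition "A = right_reg H (push_forward G h f)"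
text \<open>The product of the adjoint of \<open>A\<close> with \<open>A\<close>, by
  \<open>T_eq\<close>, written as the action of a single source series so that its powers come from
  convolution powers.\<close>

private definition "gram = restrict (series_op G H h (convolution G (L1_star G f) f)) (l2 C)"

private lemma A_eq: "x \<in> l2 C \<Longrightarrow> A x = series_op G H h f x"
  unfolding A_def right_reg_push_forward[OF f] by simp

private lemma op_adjoint_A: "op_adjoint C A = restrict (series_op G H h (L1_star G f)) (l2 C)"
  unfolding op_adjoint_def
proof (rule the_equality)
  let ?B = "restrict (series_op G H h (L1_star G f)) (l2 C)"
  have B: "?B \<in> bounded_ops C"
    by (rule bounded_ops_restrict[OF series_op_bounded[OF src.L1_star_L1[OF f]]])
  have adj: "l2_inner C (A x) y = l2_inner C x (?B y)" if "x \<in> l2 C" "y \<in> l2 C" for x y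
    using series_op_adjoint[OF f that] that by (simp add: A_eq)
  show "?B \<in> bounded_ops C \<and> (\<forall>x\<in>l2 C. \<forall>y\<in>l2 C. l2_inner C (A x) y = l2_inner C x (?B y))"
    using B adj by blast
  fix B' assume B': "B' \<in> bounded_ops C \<and> (\<forall>x\<in>l2 C. \<forall>y\<in>l2 C. l2_inner C (A x) y = l2_inner C x (B' y))"
  show "B' = ?B"
  proof (rule bounded_ops_eqI)
    fix y assume y: "y \<in> l2 C"
    have "B' y \<in> l2 C" "?B y \<in> l2 C" using B B' y by (auto elim!: bounded_opsD dest: l2b_mem simp del: restrict_apply)
    then show "B' y = ?B y"
      by (rule l2_inner_eqI) (metis B' adj y)
  qed (use B B' in auto)
qed

private lemma T_eq: "op_mult C (op_adjoint C A) A = gram"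
  unfolding op_adjoint_A op_mult_def gram_def compose_def
  by (rule restrict_ext)
    (simp add: A_eq series_op_mem_norm(1)[OF f] series_op_convolution[OF src.L1_star_L1[OF f] f])

private lemma T_bounded: "gram \<in> bounded_ops C"
  unfolding gram_def by (rule bounded_ops_restrict[OF series_op_bounded[OF src.convolution_L1[OF src.L1_star_L1[OF f] f]]])

private lemma T_inner:
  assumes x: "x \<in> l2 C" and y: "y \<in> l2 C"
  shows "l2_inner C (gram x) y = l2_inner C (A x) (A y)" "l2_inner C x (gram y) = l2_inner C (A x) (A y)"
proof -
  note m = series_op_mem_norm(1)[OF f x] series_op_mem_norm(1)[OF f y]
  have gram_eq: "gram z = series_op G H h (L1_star G f) (series_op G H h f z)" if "z \<in> l2 C" for z
    using that by (simp add: gram_def series_op_convolution[OF src.L1_star_L1[OF f] f])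
  show "l2_inner C x (gram y) = l2_inner C (A x) (A y)"
    using series_op_adjoint[OF f x m(2)] x y by (simp add: gram_eq A_eq)
  show "l2_inner C (gram x) y = l2_inner C (A x) (A y)"
    using arg_cong[where f = cnj, OF series_op_adjoint[OF f y m(1)]] x y by (simp add: gram_eq A_eq l2_inner_cnj)
qed

text \<open>The form of \<open>gram\<close> at x is the squared norm of \<open>A x\<close>. The
  upper end comes from the norm of \<open>f\<close>. For the lower end, \<open>g\<close> acts as a
  left inverse of \<open>A\<close>, so x has norm at most \<open>L1_norm G g\<close> times that of
  \<open>A x\<close>; the added 1 makes the denominator visibly positive. Neither end depends on the
  target.\<close>

private lemma T_between: "op_between C gram (1 / (L1_norm G g + 1)\<^sup>2) ((L1_norm G f)\<^sup>2)"
proof (rule op_betweenI_form[OF T_bounded])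
  show "op_selfadj C gram" by (simp add: op_selfadj_def T_inner)
  show "C \<noteq> {}" by blast
  fix x assume x: "x \<in> l2 C"
  note Ax = series_op_mem_norm(1)[OF f x]
  have eq: "Re (l2_inner C (gram x) x) = (l2_norm C (A x))\<^sup>2"
    by (simp add: T_inner x A_eq l2_inner_self[OF Ax])
  show "Re (l2_inner C (gram x) x) \<le> (L1_norm G f)\<^sup>2 * (l2_norm C x)\<^sup>2"
    using power_mono[OF series_op_mem_norm(2)[OF f x], of 2] unfolding eq
    by (simp add: A_eq x power_mult_distrib)
  let ?c = "L1_norm G g + 1"
  have c: "?c > 0" using L1_norm_nonneg[of G g] by simp
  have "x = series_op G H h g (A x)"
    using series_op_convolution[OF g f x] by (simp add: gf series_op_unit x A_eq)
  then have "l2_norm C x \<le> L1_norm G g * l2_norm C (A x)"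
    using series_op_mem_norm(2)[OF g Ax] by (simp add: A_eq x)
  also have "\<dots> \<le> ?c * l2_norm C (A x)" by (intro mult_right_mono) auto
  finally have "(l2_norm C x)\<^sup>2 \<le> ?c\<^sup>2 * (l2_norm C (A x))\<^sup>2"
    using power_mono[of "l2_norm C x" "?c * l2_norm C (A x)" 2] by (simp add: power_mult_distrib)
  then show "1 / ?c\<^sup>2 * (l2_norm C x)\<^sup>2 \<le> Re (l2_inner C (gram x) x)"
    using c unfolding eq by (simp add: field_simps)
qed

text \<open>Selects the branch of \<open>FK_det\<close> without the limit. The inverse, the action
  of \<open>g\<close>, lies in \<open>group_vN H\<close> because right actions commute with left
  translations.\<close>

private lemma A_invertible: "op_invertible_in C (group_vN H) A"
proof -
  let ?B = "restrict (series_op G H h g) (l2 C)"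
  have "restrict (series_op G H h u) (l2 C) \<in> group_vN H" if "u \<in> L1 G" for u
    unfolding group_vN_def
    using bounded_ops_restrict[OF series_op_bounded[OF that]]
    by (auto simp: tgt.left_mult_l2 series_op_left_mult)
  then have "?B \<in> group_vN H" "A \<in> group_vN H"
    using f g unfolding A_def right_reg_push_forward[OF f] by blast+
  moreover have "A (?B x) = x" "?B (A x) = x" if x: "x \<in> l2 C" for x
    using series_op_convolution[OF f g x] series_op_convolution[OF g f x] x
    by (simp_all add: A_eq series_op_mem_norm(1) f g fg gf series_op_unit)
  then have "op_mult C A ?B = op_id C" "op_mult C ?B A = op_id C"
    unfolding op_mult_def compose_def op_id_def by (auto intro!: restrict_ext simp del: restrict_apply)
  ultimately show ?thesis unfolding op_invertible_in_def by blast
qed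

text \<open>The logarithm of the absolute value becomes one function of the Gram operator.
  Positivity of \<open>a\<close> keeps the logarithm continuous on the range
  \<open>{sqrt a..sqrt b}\<close> of the square root.\<close>

lemma FK_det_invertible:
  fixes a b :: real
  defines "a \<equiv> 1 / (L1_norm G g + 1)\<^sup>2" and "b \<equiv> (L1_norm G f)\<^sup>2"
  shows "op_between (carrier H) (restrict (series_op G H h (convolution G (L1_star G f) f)) (l2 (carrier H))) a b"
    and "FK_det H (right_reg H (push_forward G h f))
      = exp (Re (vN_trace H (op_cfc (carrier H)
          (restrict (series_op G H h (convolution G (L1_star G f) f)) (l2 (carrier H))) (\<lambda>t. ln (sqrt t)))))"
proof -
  show btw: "op_between C (restrict (series_op G H h (convolution G (L1_star G f) f)) (l2 C)) a b"
    using T_between unfolding a_def b_def gram_def .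
  have a: "a > 0" using L1_norm_nonneg[of G g] by (simp add: a_def)
  have C: "C \<noteq> {}" by blast
  have "op_abs C A = op_cfc C gram sqrt" unfolding op_abs_def T_eq ..
  moreover have "op_cfc C (op_cfc C gram sqrt) ln = op_cfc C gram (\<lambda>t. ln (sqrt t))"
  proof (rule op_cfc_compose[OF btw[folded gram_def] C, where c = "sqrt a" and d = "sqrt b"])
    show "continuous_on {a..b} sqrt" by (intro continuous_intros)
    show "continuous_on {sqrt a..sqrt b} ln" using a by (intro continuous_intros) auto
  qed auto
  ultimately show "FK_det H (right_reg H (push_forward G h f))
      = exp (Re (vN_trace H (op_cfc C (restrict (series_op G H h (convolution G (L1_star G f) f)) (l2 C))
          (\<lambda>t. ln (sqrt t)))))"
    using A_invertible unfolding gram_def FK_det_def exp_trace_log_abs_def A_def by simp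
qed

end

lemma vN_trace_right_reg:
  "f \<in> L1 G \<Longrightarrow> vN_trace H (right_reg H (push_forward G h f)) = vN_trace H (series_op G H h f)"
  by (simp add: right_reg_push_forward tgt.vN_trace_eq tgt.unit_series_l2)

end

text \<open>Powers are formed in the source group, so in every quotient the powers of the operator
  come from the same sequence of series.\<close>

primrec convolution_power :: "'a monoid \<Rightarrow> ('a \<Rightarrow> complex) \<Rightarrow> nat \<Rightarrow> ('a \<Rightarrow> complex)" where
  "convolution_power G k 0 = unit_series G"
| "convolution_power G k (Suc n) = convolution G k (convolution_power G k n)"

lemma (in discrete_group) convolution_power_L1: "k \<in> L1 G \<Longrightarrow> convolution_power G k n \<in> L1 G"
  by (induction n) (simp_all add: unit_series_L1 convolution_L1)

lemma (in discrete_group_hom) vN_trace_op_cpoly: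
  assumes k: "k \<in> L1 G"
  shows "vN_trace H (op_cpoly (restrict (series_op G H h k) (l2 (carrier H))) q)
    = (\<Sum>j\<le>degree q. coeff q j * vN_trace H (series_op G H h (convolution_power G k j)))"
proof -
  let ?T = "restrict (series_op G H h k) (l2 (carrier H))"
  have "(?T ^^ j) x = series_op G H h (convolution_power G k j) x" if x: "x \<in> l2 (carrier H)" for j x
  proof (induction j)
    case 0
    then show ?case using x by (simp add: series_op_unit)
  next
    case (Suc j)
    then show ?case
      using x by (simp add: series_op_mem_norm(1) series_op_convolution k src.convolution_power_L1)
  qed
  then show ?thesis by (simp add: tgt.vN_trace_eq op_cpoly_def tgt.unit_series_l2)
qed

text \<open>The error depends only on how well \<open>p\<close> approximates \<open>u\<close> on
  [a, b], not on the target group: this is the uniformity behind the convergence of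
  determinants.\<close>

lemma (in discrete_group_hom) vN_trace_op_cfc_approx:
  assumes k: "k \<in> L1 G" and T: "op_between (carrier H) (restrict (series_op G H h k) (l2 (carrier H))) a b"
    and u: "continuous_on {a..b} u" and p: "\<And>t. t \<in> {a..b} \<Longrightarrow> \<bar>poly p t - u t\<bar> \<le> e"
  shows "cmod (vN_trace H (op_cfc (carrier H) (restrict (series_op G H h k) (l2 (carrier H))) u)
    - (\<Sum>j\<le>degree p. complex_of_real (coeff p j) * vN_trace H (series_op G H h (convolution_power G k j)))) \<le> e"
proof -
  let ?T = "restrict (series_op G H h k) (l2 (carrier H))"
  have C: "carrier H \<noteq> {}" by blast
  note cfc = op_cfc_bounded[OF T C u]
  obtain K where K: "l2_bounded_by (carrier H) (op_cfc (carrier H) ?T u) K" using bounded_opsD[OF cfc] by metis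
  have "?T \<in> bounded_ops (carrier H)" using T by (simp add: op_between_def)
  then obtain L where L: "l2_bounded_by (carrier H) ?T L" using bounded_opsD by metis
  have "cmod (vN_trace H (op_cpoly ?T (cpoly_of p)) - vN_trace H (op_cfc (carrier H) ?T u)) \<le> e"
    by (rule tgt.vN_trace_diff_le[OF op_cpoly_mem[OF L] l2b_mem[OF K] op_cfc_approx[OF T C u p]])
  then show ?thesis
    by (subst norm_minus_commute) (simp add: vN_trace_op_cpoly[OF k] degree_map_poly coeff_map_poly)
qed


section \<open>Convergence of marked groups\<close>

lemma cayley_ball_mono: "M \<le> N \<Longrightarrow> cayley_ball G S M \<subseteq> cayley_ball G S N"
  by (induction N) (auto simp: le_Suc_eq)

text \<open>Balls grow by one letter on the right, whereas \<open>generate\<close> contains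
  arbitrary products. The induction therefore claims that right multiplication by the element keeps
  the union of all balls, from any starting point x.\<close>

lemma marked_group_word:
  assumes mg: "marked_group d G S" and g: "g \<in> carrier G"
  shows "\<exists>N. g \<in> cayley_ball G S N"
proof -
  interpret group G using mg by (simp add: marked_group_def)
  have S: "set S \<subseteq> carrier G" "generate G (set S) = carrier G" using mg by (auto simp: marked_group_def)
  have "\<forall>M. \<forall>x\<in>cayley_ball G S M. \<exists>N. x \<otimes>\<^bsub>G\<^esub> g \<in> cayley_ball G S N" if "g \<in> generate G (set S)" for g
    using that
  proof (induction rule: generate.induct)
    case one
    then show ?case using cayley_ball_subset[OF mg] by fastforce
  next
    case (incl s)
    show ?case
    proof (intro allI ballI)
      fix M x assume "x \<in> cayley_ball G S M"
      with incl have "x \<otimes>\<^bsub>G\<^esub> s \<in> cayley_ball G S (Suc M)" by auto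
      then show "\<exists>N. x \<otimes>\<^bsub>G\<^esub> s \<in> cayley_ball G S N" ..
    qed
  next
    case (inv s)
    show ?case
    proof (intro allI ballI)
      fix M x assume "x \<in> cayley_ball G S M"
      with inv have "x \<otimes>\<^bsub>G\<^esub> inv\<^bsub>G\<^esub> s \<in> cayley_ball G S (Suc M)" by auto
      then show "\<exists>N. x \<otimes>\<^bsub>G\<^esub> inv\<^bsub>G\<^esub> s \<in> cayley_ball G S N" ..
    qed
  next
    case (eng g1 g2)
    show ?case
    proof (intro allI ballI)
      fix M x assume x: "x \<in> cayley_ball G S M"
      obtain N where N: "x \<otimes>\<^bsub>G\<^esub> g1 \<in> cayley_ball G S N" using eng.IH(1) x by blast
      obtain N' where "x \<otimes>\<^bsub>G\<^esub> g1 \<otimes>\<^bsub>G\<^esub> g2 \<in> cayley_ball G S N'" using eng.IH(2) N by blast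
      moreover have "x \<in> carrier G" "g1 \<in> carrier G" "g2 \<in> carrier G"
        using x cayley_ball_subset[OF mg] eng.hyps S(2) by auto
      ultimately show "\<exists>N. x \<otimes>\<^bsub>G\<^esub> (g1 \<otimes>\<^bsub>G\<^esub> g2) \<in> cayley_ball G S N" by (auto simp: m_assoc)
    qed
  qed
  moreover have "\<one>\<^bsub>G\<^esub> \<in> cayley_ball G S 0" by simp
  ultimately show ?thesis using g S(2) l_one by metis
qed

lemma cayley_ball_hom:
  assumes mg: "marked_group d G S" and h: "group_hom G H h" and g: "g \<in> cayley_ball G S N"
  shows "h g \<in> cayley_ball H (map h S) N"
  using g
proof (induction N arbitrary: g)
  case 0
  interpret group_hom G H h by (rule h)
  show ?case using 0 by simp
next
  case (Suc N)
  interpret group_hom G H h by (rule h)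
  have S: "set S \<subseteq> carrier G" using mg by (simp add: marked_group_def)
  note B = subsetD[OF cayley_ball_subset[OF mg]]
  from Suc.prems consider "g \<in> cayley_ball G S N"
    | x s where "g = x \<otimes>\<^bsub>G\<^esub> s" "x \<in> cayley_ball G S N" "s \<in> set S"
    | x s where "g = x \<otimes>\<^bsub>G\<^esub> inv\<^bsub>G\<^esub> s" "x \<in> cayley_ball G S N" "s \<in> set S" by auto
  then show ?case
  proof cases
    case 1
    then show ?thesis using Suc.IH by simp
  next
    case 2
    then have "h g = h x \<otimes>\<^bsub>H\<^esub> h s" using B S by auto
    then show ?thesis using Suc.IH[OF 2(2)] 2(3) by auto
  next
    case 3
    then have "h g = h x \<otimes>\<^bsub>H\<^esub> inv\<^bsub>H\<^esub> h s" using B S by auto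
    then have "h g \<in> {g \<otimes>\<^bsub>H\<^esub> inv\<^bsub>H\<^esub> s | g s. g \<in> cayley_ball H (map h S) N \<and> s \<in> set (map h S)}"
      using Suc.IH[OF 3(2)] 3(3) by auto
    then show ?thesis by simp
  qed
qed

text \<open>The graph isomorphism \<open>\<psi>\<close> carries \<open>p g\<close> to
  \<open>q g\<close>, because both follow the same labelled path from the unit; it is injective and
  preserves the unit.\<close>

lemma cayley_balls_isomorphic_kernel:
  assumes mg: "marked_group d G S" and p: "group_hom G H p" and q: "group_hom G K q"
    and iso: "cayley_balls_isomorphic d H (map p S) K (map q S) N" and g: "g \<in> cayley_ball G S N"
  shows "p g = \<one>\<^bsub>H\<^esub> \<longleftrightarrow> q g = \<one>\<^bsub>K\<^esub>"
proof -
  interpret p: group_hom G H p by (rule p)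
  interpret q: group_hom G K q by (rule q)
  have S: "set S \<subseteq> carrier G" and len: "length S = d" using mg by (auto simp: marked_group_def)
  note B = subsetD[OF cayley_ball_subset[OF mg]]
  obtain \<psi> where bij: "bij_betw \<psi> (cayley_ball H (map p S) N) (cayley_ball K (map q S) N)"
    and one: "\<psi> \<one>\<^bsub>H\<^esub> = \<one>\<^bsub>K\<^esub>"
    and edge: "\<And>x y i. x \<in> cayley_ball H (map p S) N \<Longrightarrow> y \<in> cayley_ball H (map p S) N \<Longrightarrow> i < d \<Longrightarrow>
      y = x \<otimes>\<^bsub>H\<^esub> map p S ! i \<longleftrightarrow> \<psi> y = \<psi> x \<otimes>\<^bsub>K\<^esub> map q S ! i"
    using iso unfolding cayley_balls_isomorphic_def by blast
  have pB: "p g \<in> cayley_ball H (map p S) N" if "g \<in> cayley_ball G S M" "M \<le> N" for g M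
    by (rule subsetD[OF cayley_ball_mono[OF that(2)] cayley_ball_hom[OF mg p that(1)]])
  have step: "\<psi> (p (x \<otimes>\<^bsub>G\<^esub> s)) = \<psi> (p x) \<otimes>\<^bsub>K\<^esub> q s"
    if "p x \<in> cayley_ball H (map p S) N" "p (x \<otimes>\<^bsub>G\<^esub> s) \<in> cayley_ball H (map p S) N"
      "x \<in> carrier G" "s \<in> set S" for x s
  proof -
    from \<open>s \<in> set S\<close> obtain i where i: "i < d" "s = S ! i" using len by (auto simp: in_set_conv_nth)
    moreover have "s \<in> carrier G" using \<open>s \<in> set S\<close> S by blast
    ultimately show ?thesis using edge[OF that(1,2) i(1)] \<open>x \<in> carrier G\<close> len by simp
  qed
  \<comment> \<open>\<open>M\<close> bounds the length of the word while \<open>N\<close> stays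
    fixed: \<open>\<psi>\<close> lives on the balls of radius \<open>N\<close>, which contain the
    image of every prefix.\<close>
  have "\<psi> (p g) = q g" if "g \<in> cayley_ball G S M" "M \<le> N" for g M
    using that
  proof (induction M arbitrary: g)
    case 0
    then show ?case using one by simp
  next
    case (Suc M)
    then have M: "M \<le> N" by simp
    note pg = pB[OF Suc.prems]
    from Suc.prems(1) consider "g \<in> cayley_ball G S M"
      | x s where "g = x \<otimes>\<^bsub>G\<^esub> s" "x \<in> cayley_ball G S M" "s \<in> set S"
      | x s where "g = x \<otimes>\<^bsub>G\<^esub> inv\<^bsub>G\<^esub> s" "x \<in> cayley_ball G S M" "s \<in> set S" by auto
    then show ?case
    proof cases
      case 1
      then show ?thesis using Suc.IH M by simp
    next
      case 2
      have c: "x \<in> carrier G" "s \<in> carrier G" using 2 B S by auto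
      show ?thesis
        using step[OF pB[OF 2(2) M] _ c(1) 2(3)] pg Suc.IH[OF 2(2) M] c by (simp add: 2(1))
    next
      case 3
      have c: "x \<in> carrier G" "s \<in> carrier G" "g \<in> carrier G" using 3 B S by auto
      \<comment> \<open>Edges carry generators only. A step along an inverse generator is read
        backwards, as the edge from g to x, and \<open>q s\<close> is cancelled in
        \<open>K\<close>.\<close>
      have x: "x = g \<otimes>\<^bsub>G\<^esub> s" using c by (simp add: 3(1) p.G.m_assoc)
      have "\<psi> (p x) = \<psi> (p g) \<otimes>\<^bsub>K\<^esub> q s"
        using step[OF pg _ c(3) 3(3)] pB[OF 3(2) M] x by simp
      then have "q x = \<psi> (p g) \<otimes>\<^bsub>K\<^esub> q s" using Suc.IH[OF 3(2) M] by simp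
      moreover have "\<psi> (p g) \<in> carrier K"
      proof -
        have "cayley_ball K (map q S) N \<subseteq> carrier K"
        proof -
          have "q s \<in> carrier K" if "s \<in> set S" for s using S that by auto
          then show ?thesis by (induction N) auto
        qed
        then show ?thesis using bij_betwE[OF bij] pg by blast
      qed
      moreover have "q x = q g \<otimes>\<^bsub>K\<^esub> q s" using x c by simp
      ultimately show ?thesis using c by (metis q.H.right_cancel q.hom_closed)
    qed
  qed
  from this[OF g] have "\<psi> (p g) = q g" by simp
  moreover have "\<one>\<^bsub>H\<^esub> \<in> cayley_ball H (map p S) N" using cayley_ball_mono[of 0 N H "map p S"] by auto
  ultimately show ?thesis
    using one bij_betw_imp_inj_on[OF bij] pB[OF g] by (metis inj_onD order_refl)
qed

text \<open>The radius is a supremum, so exceeding \<open>N\<close> only provides isomorphic balls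
  of some larger radius; as balls increase, these still contain any given word.\<close>

lemma marked_dist_less_imp_isomorphic:
  assumes "marked_dist d G S H T < (1 / 2) ^ N"
  shows "\<exists>N'\<ge>N. cayley_balls_isomorphic d G S H T N'"
proof -
  have "enat N < marked_radius d G S H T"
  proof (cases "marked_radius d G S H T")
    case (enat R)
    then have "(1 / 2 :: real) ^ R < (1 / 2) ^ N" using assms by (simp add: marked_dist_def)
    then have "N < R" by (simp add: power_strict_decreasing_iff)
    then show ?thesis by (simp add: enat)
  qed simp
  then obtain N' where "N < N'" "cayley_balls_isomorphic d G S H T N'"
    unfolding marked_radius_def less_Sup_iff by auto
  then show ?thesis by (intro exI[of _ N']) simp
qed

lemma marked_dist_tendsto_kernel:
  assumes mg: "marked_group d G S" and p: "group_hom G H p"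
    and q: "\<And>n. n \<ge> 1 \<Longrightarrow> group_hom G (K n) (q n)"
    and lim: "(\<lambda>n. marked_dist d (K n) (map (q n) S) H (map p S)) \<longlonglongrightarrow> 0" and g: "g \<in> carrier G"
  shows "\<forall>\<^sub>F n in sequentially. q n g = \<one>\<^bsub>K n\<^esub> \<longleftrightarrow> p g = \<one>\<^bsub>H\<^esub>"
proof -
  obtain N where N: "g \<in> cayley_ball G S N" using marked_group_word[OF mg g] by blast
  have "\<forall>\<^sub>F n in sequentially. marked_dist d (K n) (map (q n) S) H (map p S) < (1 / 2) ^ N"
    by (rule order_tendstoD(2)[OF lim]) simp
  then show ?thesis
    using eventually_ge_at_top[of 1]
  proof eventually_elim
    case (elim n)
    obtain N' where N': "N' \<ge> N" "cayley_balls_isomorphic d (K n) (map (q n) S) H (map p S) N'"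
      using marked_dist_less_imp_isomorphic[OF elim(1)] by blast
    have "g \<in> cayley_ball G S N'" by (rule subsetD[OF cayley_ball_mono[OF N'(1)] N])
    from cayley_balls_isomorphic_kernel[OF mg q[OF elim(2)] p N'(2) this] show ?case .
  qed
qed

text \<open>Dominated convergence with majorant \<open>2 * cmod (f \<gamma>)\<close>. Eventual
  equality makes the difference vanish exactly on the finite set \<open>F\<close>; the tail outside
  it weighs less than \<open>e / 2\<close> and is multiplied by at most 2.\<close>

lemma L1_weighted_tendsto:
  fixes u :: "nat \<Rightarrow> 'a \<Rightarrow> complex"
  assumes f: "f \<in> L1 G"
    and u: "\<And>n \<gamma>. cmod (u n \<gamma>) \<le> 1" and v: "\<And>\<gamma>. cmod (v \<gamma>) \<le> 1"
    and ev: "\<And>\<gamma>. \<gamma> \<in> carrier G \<Longrightarrow> \<forall>\<^sub>F n in sequentially. u n \<gamma> = v \<gamma>"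
  shows "(\<lambda>n. \<Sum>\<^sub>\<infinity>\<gamma>\<in>carrier G. f \<gamma> * u n \<gamma>) \<longlonglongrightarrow> (\<Sum>\<^sub>\<infinity>\<gamma>\<in>carrier G. f \<gamma> * v \<gamma>)"
proof (rule tendstoI)
  fix e :: real assume e: "e > 0"
  note s = L1_abs_summable[OF f]
  have "((\<lambda>F. \<Sum>\<gamma>\<in>F. cmod (f \<gamma>)) \<longlongrightarrow> (\<Sum>\<^sub>\<infinity>\<gamma>\<in>carrier G. cmod (f \<gamma>))) (finite_subsets_at_top (carrier G))"
    using has_sum_infsum[OF s] by (simp add: has_sum_def)
  then have "\<forall>\<^sub>F F in finite_subsets_at_top (carrier G).
      dist (\<Sum>\<gamma>\<in>F. cmod (f \<gamma>)) (\<Sum>\<^sub>\<infinity>\<gamma>\<in>carrier G. cmod (f \<gamma>)) < e / 2"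
    using e by (intro tendstoD) auto
  then obtain F where F: "finite F" "F \<subseteq> carrier G"
    "dist (\<Sum>\<gamma>\<in>F. cmod (f \<gamma>)) (\<Sum>\<^sub>\<infinity>\<gamma>\<in>carrier G. cmod (f \<gamma>)) < e / 2"
    unfolding eventually_finite_subsets_at_top by blast
  have sD: "(\<lambda>\<gamma>. cmod (f \<gamma>)) summable_on (carrier G - F)"
    using s by (rule summable_on_subset) auto
  have "(\<Sum>\<^sub>\<infinity>\<gamma>\<in>carrier G - F. cmod (f \<gamma>)) = (\<Sum>\<^sub>\<infinity>\<gamma>\<in>carrier G. cmod (f \<gamma>)) - (\<Sum>\<gamma>\<in>F. cmod (f \<gamma>))"
    using F s by (subst infsum_Diff) auto
  then have tail: "(\<Sum>\<^sub>\<infinity>\<gamma>\<in>carrier G - F. cmod (f \<gamma>)) < e / 2"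
    using F(3) unfolding dist_real_def by linarith
  have "\<forall>\<^sub>F n in sequentially. \<forall>\<gamma>\<in>F. u n \<gamma> = v \<gamma>"
    using F ev by (intro eventually_ball_finite) auto
  then show "\<forall>\<^sub>F n in sequentially.
      dist (\<Sum>\<^sub>\<infinity>\<gamma>\<in>carrier G. f \<gamma> * u n \<gamma>) (\<Sum>\<^sub>\<infinity>\<gamma>\<in>carrier G. f \<gamma> * v \<gamma>) < e"
  proof eventually_elim
    case (elim n)
    have d2: "cmod (u n \<gamma> - v \<gamma>) \<le> 2" for \<gamma>
      using norm_triangle_ineq4[of "u n \<gamma>" "v \<gamma>"] u[of n \<gamma>] v[of \<gamma>] by simp
    have "(\<Sum>\<^sub>\<infinity>\<gamma>\<in>carrier G. f \<gamma> * (u n \<gamma> - v \<gamma>)) + (\<Sum>\<^sub>\<infinity>\<gamma>\<in>carrier G. f \<gamma> * v \<gamma>)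
        = (\<Sum>\<^sub>\<infinity>\<gamma>\<in>carrier G. f \<gamma> * (u n \<gamma> - v \<gamma>) + f \<gamma> * v \<gamma>)"
      by (rule infsum_add[OF abs_summable_summable[OF L1_bounded_summable(1)[OF f d2]]
            abs_summable_summable[OF L1_bounded_summable(1)[OF f v]], symmetric])
    also have "\<dots> = (\<Sum>\<^sub>\<infinity>\<gamma>\<in>carrier G. f \<gamma> * u n \<gamma>)"
      by (simp add: right_diff_distrib)
    finally have "(\<Sum>\<^sub>\<infinity>\<gamma>\<in>carrier G. f \<gamma> * u n \<gamma>) - (\<Sum>\<^sub>\<infinity>\<gamma>\<in>carrier G. f \<gamma> * v \<gamma>)
        = (\<Sum>\<^sub>\<infinity>\<gamma>\<in>carrier G. f \<gamma> * (u n \<gamma> - v \<gamma>))"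
      by (simp only: diff_eq_eq)
    also have "\<dots> = (\<Sum>\<^sub>\<infinity>\<gamma>\<in>carrier G - F. f \<gamma> * (u n \<gamma> - v \<gamma>))"
      using elim by (intro infsum_cong_neutral) auto
    finally have eq: "dist (\<Sum>\<^sub>\<infinity>\<gamma>\<in>carrier G. f \<gamma> * u n \<gamma>) (\<Sum>\<^sub>\<infinity>\<gamma>\<in>carrier G. f \<gamma> * v \<gamma>)
        = cmod (\<Sum>\<^sub>\<infinity>\<gamma>\<in>carrier G - F. f \<gamma> * (u n \<gamma> - v \<gamma>))" by (simp add: dist_norm)
    have s2: "(\<lambda>\<gamma>. cmod (f \<gamma>) * 2) summable_on (carrier G - F)" using sD by (rule summable_on_cmult_left)
    have le: "cmod (f \<gamma> * (u n \<gamma> - v \<gamma>)) \<le> cmod (f \<gamma>) * 2" for \<gamma>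
      using d2 by (simp add: norm_mult mult_left_mono)
    have s3: "(\<lambda>\<gamma>. cmod (f \<gamma> * (u n \<gamma> - v \<gamma>))) summable_on (carrier G - F)"
      by (rule summable_on_comparison_test[OF s2 le]) simp
    have "cmod (\<Sum>\<^sub>\<infinity>\<gamma>\<in>carrier G - F. f \<gamma> * (u n \<gamma> - v \<gamma>))
        \<le> (\<Sum>\<^sub>\<infinity>\<gamma>\<in>carrier G - F. cmod (f \<gamma> * (u n \<gamma> - v \<gamma>)))"
      by (rule norm_infsum_bound[OF s3])
    also have "\<dots> \<le> (\<Sum>\<^sub>\<infinity>\<gamma>\<in>carrier G - F. cmod (f \<gamma>) * 2)" by (rule infsum_mono[OF s3 s2 le])
    also have "\<dots> < e" using tail by (simp add: infsum_cmult_left')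
    finally show ?case unfolding eq .
  qed
qed

theorem corollary23:
  fixes \<Gamma>t :: "'a monoid" and \<Gamma> :: "'b monoid" and \<Gamma>n :: "nat \<Rightarrow> 'c monoid"
    and d :: nat and St :: "'a list"
    and \<phi> :: "'a \<Rightarrow> 'b" and \<phi>n :: "nat \<Rightarrow> 'a \<Rightarrow> 'c"
  assumes "marked_group d \<Gamma>t St"
    and "group \<Gamma>" and "\<And>n. n \<ge> 1 \<Longrightarrow> group (\<Gamma>n n)"
    and "\<phi> \<in> epi \<Gamma>t \<Gamma>" and "\<And>n. n \<ge> 1 \<Longrightarrow> \<phi>n n \<in> epi \<Gamma>t (\<Gamma>n n)"
    and "(\<lambda>n. marked_dist d (\<Gamma>n n) (map (\<phi>n n) St) \<Gamma> (map \<phi> St)) \<longlonglongrightarrow> 0"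
  shows "(\<forall>f\<in>L1 \<Gamma>t.
            (\<lambda>n. vN_trace (\<Gamma>n n) (right_reg (\<Gamma>n n) (push_forward \<Gamma>t (\<phi>n n) f)))
              \<longlonglongrightarrow> vN_trace \<Gamma> (right_reg \<Gamma> (push_forward \<Gamma>t \<phi> f))) \<and>
         (\<forall>f. L1_invertible \<Gamma>t f \<longrightarrow>
            (\<lambda>n. FK_det (\<Gamma>n n) (right_reg (\<Gamma>n n) (push_forward \<Gamma>t (\<phi>n n) f)))
              \<longlonglongrightarrow> FK_det \<Gamma> (right_reg \<Gamma> (push_forward \<Gamma>t \<phi> f)))"
proof -
  have grp: "group \<Gamma>t" using assms(1) by (simp add: marked_group_def)
  have hom: "discrete_group_hom \<Gamma>t \<Gamma> \<phi>"
    using grp assms(2,4) by (auto simp: discrete_group_hom_def group_hom_def group_hom_axioms_def epi_def)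
  have homn: "discrete_group_hom \<Gamma>t (\<Gamma>n n) (\<phi>n n)" if "n \<ge> 1" for n
    using grp assms(3,5)[OF that] by (auto simp: discrete_group_hom_def group_hom_def group_hom_axioms_def epi_def)
  interpret \<phi>: discrete_group_hom \<Gamma>t \<Gamma> \<phi> by (rule hom)
  let ?\<pi> = "series_op \<Gamma>t \<Gamma> \<phi>" and ?\<pi>n = "\<lambda>n. series_op \<Gamma>t (\<Gamma>n n) (\<phi>n n)"
  have ker: "\<forall>\<^sub>F n in sequentially. \<phi>n n \<gamma> = \<one>\<^bsub>\<Gamma>n n\<^esub> \<longleftrightarrow> \<phi> \<gamma> = \<one>\<^bsub>\<Gamma>\<^esub>" if "\<gamma> \<in> carrier \<Gamma>t" for \<gamma>
    using marked_dist_tendsto_kernel[OF assms(1) _ _ assms(6) that] hom homn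
    by (auto simp: discrete_group_hom_def)
  have trace: "(\<lambda>n. vN_trace (\<Gamma>n n) (?\<pi>n n f)) \<longlonglongrightarrow> vN_trace \<Gamma> (?\<pi> f)" if f: "f \<in> L1 \<Gamma>t" for f
  proof -
    have "(\<lambda>n. \<Sum>\<^sub>\<infinity>\<gamma>\<in>carrier \<Gamma>t. f \<gamma> * (if \<phi>n n \<gamma> = \<one>\<^bsub>\<Gamma>n n\<^esub> then 1 else 0))
      \<longlonglongrightarrow> (\<Sum>\<^sub>\<infinity>\<gamma>\<in>carrier \<Gamma>t. f \<gamma> * (if \<phi> \<gamma> = \<one>\<^bsub>\<Gamma>\<^esub> then 1 else 0))"
      by (rule L1_weighted_tendsto[OF f]) (auto elim!: eventually_mono[OF ker])
    \<comment> \<open>The quotients are assumed to be groups only from index 1 on, so the trace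
      formula is transferred along a tail of the sequence.\<close>
    then show ?thesis
      unfolding \<phi>.vN_trace_series_op
      by (rule Lim_transform_eventually)
        (rule eventually_mono[OF eventually_ge_at_top[of 1]],
          simp add: discrete_group_hom.vN_trace_series_op[OF homn])
  qed
  have part_a: "(\<lambda>n. vN_trace (\<Gamma>n n) (right_reg (\<Gamma>n n) (push_forward \<Gamma>t (\<phi>n n) f)))
      \<longlonglongrightarrow> vN_trace \<Gamma> (right_reg \<Gamma> (push_forward \<Gamma>t \<phi> f))" if f: "f \<in> L1 \<Gamma>t" for f
    unfolding \<phi>.vN_trace_right_reg[OF f] using trace[OF f]
    by (rule Lim_transform_eventually)
      (rule eventually_mono[OF eventually_ge_at_top[of 1]],
        simp add: discrete_group_hom.vN_trace_right_reg[OF homn f])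
  have part_b: "(\<lambda>n. FK_det (\<Gamma>n n) (right_reg (\<Gamma>n n) (push_forward \<Gamma>t (\<phi>n n) f)))
      \<longlonglongrightarrow> FK_det \<Gamma> (right_reg \<Gamma> (push_forward \<Gamma>t \<phi> f))" if "L1_invertible \<Gamma>t f" for f
  proof -
    from that obtain g where f: "f \<in> L1 \<Gamma>t" and g: "g \<in> L1 \<Gamma>t"
      and fg: "convolution \<Gamma>t f g = unit_series \<Gamma>t" and gf: "convolution \<Gamma>t g f = unit_series \<Gamma>t"
      by (auto simp: L1_invertible_def)
    define k where "k = convolution \<Gamma>t (L1_star \<Gamma>t f) f"
    have k: "k \<in> L1 \<Gamma>t" unfolding k_def by (rule \<phi>.src.convolution_L1[OF \<phi>.src.L1_star_L1[OF f] f])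
    define a where "a = 1 / (L1_norm \<Gamma>t g + 1)\<^sup>2"
    define b where "b = (L1_norm \<Gamma>t f)\<^sup>2"
    have "a > 0" using L1_norm_nonneg[of \<Gamma>t g] by (simp add: a_def)
    then have u: "continuous_on {a..b} (\<lambda>t. ln (sqrt t))" by (intro continuous_intros) auto
    note det = \<phi>.FK_det_invertible[OF f g fg gf, folded k_def a_def b_def]
    note detn = discrete_group_hom.FK_det_invertible[OF homn f g fg gf, folded k_def a_def b_def]
    let ?L = "vN_trace \<Gamma> (op_cfc (carrier \<Gamma>) (restrict (?\<pi> k) (l2 (carrier \<Gamma>))) (\<lambda>t. ln (sqrt t)))"
    let ?Ln = "\<lambda>n. vN_trace (\<Gamma>n n) (op_cfc (carrier (\<Gamma>n n))
      (restrict (?\<pi>n n k) (l2 (carrier (\<Gamma>n n)))) (\<lambda>t. ln (sqrt t)))"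
    have "?Ln \<longlonglongrightarrow> ?L"
    proof (rule tendstoI)
      fix e :: real assume e: "e > 0"
      \<comment> \<open>One third each for replacing the logarithm by \<open>p\<close> in the n-th
        quotient, for the convergence of the polynomial traces, and for the same replacement in the
        limit group. \<open>p\<close> is chosen before n.\<close>
      then have "e / 3 > 0" by simp
      from Weierstrass_poly[OF u this] obtain p
        where p: "\<And>t. t \<in> {a..b} \<Longrightarrow> \<bar>poly p t - ln (sqrt t)\<bar> \<le> e / 3" by blast
      let ?S = "\<Sum>j\<le>degree p. complex_of_real (coeff p j) * vN_trace \<Gamma> (?\<pi> (convolution_power \<Gamma>t k j))"
      let ?Sn = "\<lambda>n. \<Sum>j\<le>degree p. complex_of_real (coeff p j) *
        vN_trace (\<Gamma>n n) (?\<pi>n n (convolution_power \<Gamma>t k j))"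
      have "?Sn \<longlonglongrightarrow> ?S"
        by (intro tendsto_sum tendsto_mult_left trace \<phi>.src.convolution_power_L1 k)
      then have "\<forall>\<^sub>F n in sequentially. dist (?Sn n) ?S < e / 3" by (rule tendstoD) (use e in simp)
      then show "\<forall>\<^sub>F n in sequentially. dist (?Ln n) ?L < e"
        using eventually_ge_at_top[of 1]
      proof eventually_elim
        case (elim n)
        have "dist (?Ln n) (?Sn n) \<le> e / 3" unfolding dist_norm
          by (rule discrete_group_hom.vN_trace_op_cfc_approx[OF homn[OF elim(2)] k detn(1)[OF elim(2)] u p])
        moreover have "dist ?L ?S \<le> e / 3" unfolding dist_norm
          by (rule \<phi>.vN_trace_op_cfc_approx[OF k det(1) u p])
        ultimately show ?case
          using elim(1) dist_triangle[of "?Ln n" ?L "?Sn n"] dist_triangle[of "?Sn n" ?L ?S]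
            dist_commute[of ?L ?S] by linarith
      qed
    qed
    then have "(\<lambda>n. exp (Re (?Ln n))) \<longlonglongrightarrow> exp (Re ?L)" by (intro tendsto_intros)
    then show ?thesis
      unfolding det(2)
      by (rule Lim_transform_eventually)
        (rule eventually_mono[OF eventually_ge_at_top[of 1]], simp add: detn(2))
  qed
  show ?thesis using part_a part_b by blast
qed

end
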